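(* Let $0 < d_0 \le \min\{d_1,d_2\}$ and consider the probabilistic generative model for a pair of random vectors $(\mathbf{z}_1,\mathbf{z}_2)\in\mathbb{R}^{d_1}\times\mathbb{R}^{d_2}$ with shared latent vector $\boldsymbol{\phi}\in\mathbb{R}^{d_0}$ given by the graphical model in which $\mathbf{z}_1$ and $\mathbf{z}_2$ are each generated from $\boldsymbol{\phi}$: $$\boldsymbol{\phi}\sim\mathcal{N}(\boldsymbol{\mu}_0, I_{d_0}),$$ $$\mathbf{z}_1\mid\boldsymbol{\phi}\sim\mathcal{N}(W_1\boldsymbol{\phi}+\boldsymbol{\mu}_{\epsilon_1},\Psi_1),\quad W_1\in\mathbb{R}^{d_1\times d_0},\ \Psi_1\succcurlyeq 0,$$ $$\mathbf{z}_2\mid\boldsymbol{\phi}\sim\mathcal{N}(W_2\boldsymbol{\phi}+\boldsymbol{\mu}_{\epsilon_2},\Psi_2),\quad W_2\in\mathbb{R}^{d_2\times d_0},\ \Psi_2\succcurlyeq 0.$$ Then the maximum likelihood estimate of the parameters of this model, given the observed data on $(\mathbf{z}_1,\mathbf{z}_2)$, can be expressed in terms of the canonical directions $U_1,U_2$ as $$\hat W_1=\Sigma_{11}U_1M_1,\qquad \hat W_2=\Sigma_{22}U_2M_2,$$ $$\hat\Psi_1=\Sigma_{11}-\hat W_1\hat W_1^{\top},\qquad \hat\Psi_2=\Sigma_{22}-\hat W_2\hat W_2^{\top},$$ $$\hat{\boldsymbol{\mu}}_{\epsilon_1}=\boldsymbol{\mu}_1-\hat W_1\boldsymbol{\mu}_0,\qquad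 \hat{\boldsymbol{\mu}}_{\epsilon_2}=\boldsymbol{\mu}_2-\hat W_2\boldsymbol{\mu}_0,$$ where $M_1,M_2\in\mathbb{R}^{d_0\times d_0}$ are arbitrary matrices with spectral norms smaller than one that satisfy $M_1M_2^{\top}=P_{d_0}$. The model induces conditional independence of $\mathbf{z}_1$ and $\mathbf{z}_2$ given $\boldsymbol{\phi}$. The parameter $\boldsymbol{\mu}_0$ is not identifiable by maximum likelihood (the formulas above give a maximizer for any value of $\boldsymbol{\mu}_0$).
   Context: The data are $n$ i.i.d. observations of the pair $(\mathbf{z}_1,\mathbf{z}_2)$. $(\boldsymbol{\mu}_1,\Sigma_{11})$ and $(\boldsymbol{\mu}_2,\Sigma_{22})$ denote the (sample) mean and covariance matrix (normalized by $1/n$) of $\mathbf{z}_1$ and $\mathbf{z}_2$ respectively, and $\Sigma_{12}$ their (sample) cross-covariance; $\Sigma_{11}$ and $\Sigma_{22}$ are invertible. The likelihood is the marginal Gaussian likelihood of the observed pairs, $\boldsymbol{\phi}$ being integrated out; the joint vector $(\mathbf{z}_1,\mathbf{z}_2)$ is then Gaussian with mean $(W_1\boldsymbol{\mu}_0+\boldsymbol{\mu}_{\epsilon_1},\,W_2\boldsymbol{\mu}_0+\boldsymbol{\mu}_{\epsilon_2})$ and covariance $WW^\top+\Psi$, where $W$ is $W_1$ stacked on $W_2$ and $\Psi$ is block diagonal with blocks $\Psi_1,\Psi_2$. Canonical directions and correlations: let $p_1\ge\dots\ge p_{d_0}$ be the $d_0$ largest singular values of $\Sigma_{11}^{-1/2}\Sigma_{12}\Sigma_{22}^{-1/2}$,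 with corresponding pairs of (orthonormal) left and right singular vectors $(\boldsymbol{v}_{1i},\boldsymbol{v}_{2i})$, $i=1,\dots,d_0$. Then $U_1\in\mathbb{R}^{d_1\times d_0}$ and $U_2\in\mathbb{R}^{d_2\times d_0}$ are the matrices with $i$-th columns $\boldsymbol{u}_{1i}=\Sigma_{11}^{-1/2}\boldsymbol{v}_{1i}$ and $\boldsymbol{u}_{2i}=\Sigma_{22}^{-1/2}\boldsymbol{v}_{2i}$ (the canonical pairs of directions), and $P_{d_0}=\mathrm{diag}(p_1,\dots,p_{d_0})$ is the diagonal matrix of canonical correlations. The residual error terms of the model are defined as $\boldsymbol{\epsilon}_m:=\mathbf{z}_m-W_m\boldsymbol{\phi}$, $m=1,2$. $A\succcurlyeq 0$ means $A$ is symmetric positive semidefinite.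
   Formalization: Matrices M1, M2 with spectral norms smaller than one are shown to give maximizers; that every maximum likelihood estimate has this form is shown with spectral norms at most one, since e.g. M1 = I, M2 = P (largest correlation below one) is also a maximizer. *)

theory Defs
  imports "HOL-Probability.Probability"
begin

section \<open>Linear algebra\<close>

definition outer :: "real^'a \<Rightarrow> real^'b \<Rightarrow> real^'b^'a" where
  "outer u v = (\<chi> i j. u $ i * v $ j)"

definition psd :: "real^'n^'n \<Rightarrow> bool" where
  "psd A \<longleftrightarrow> transpose A = A \<and> (\<forall>x. 0 \<le> x \<bullet> (A *v x))"

text \<open>The principal square root; it exists and is unique whenever \<open>psd A\<close>.\<close>

definition psd_sqrt :: "real^'n^'n \<Rightarrow> real^'n^'n" where
  "psd_sqrt A = (THE B. psd B \<and> B ** B = A)"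

definition inv_sqrt :: "real^'n^'n \<Rightarrow> real^'n^'n" where
  "inv_sqrt A = matrix_inv (psd_sqrt A)"

definition spectral_norm :: "real^'n^'m \<Rightarrow> real" where
  "spectral_norm A = onorm ((*v) A)"

definition diag :: "('k \<Rightarrow> real) \<Rightarrow> real^'k^'k" where
  "diag p = (\<chi> i j. if i = j then p i else 0)"

text \<open>Stacking two vectors; on matrices (vectors of rows) this puts the first on top of
  the second.\<close>

definition stack :: "'c^'a \<Rightarrow> 'c^'b \<Rightarrow> 'c^('a + 'b)" where
  "stack x y = (\<chi> i. case i of Inl a \<Rightarrow> x $ a | Inr b \<Rightarrow> y $ b)"

definition block_diag :: "real^'a^'a \<Rightarrow> real^'b^'b \<Rightarrow> real^('a + 'b)^('a + 'b)" where
  "block_diag A B = stack (\<chi> a. stack (A $ a) 0) (\<chi> b. stack 0 (B $ b))"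

text \<open>A full singular value decomposition, with the \<open>min d\<^sub>1 d\<^sub>2\<close> singular values in
  decreasing order; indices are counted from \<open>0\<close>.\<close>

definition is_svd ::
  "real^'b^'a \<Rightarrow> (nat \<Rightarrow> real) \<Rightarrow> (nat \<Rightarrow> real^'a) \<Rightarrow> (nat \<Rightarrow> real^'b) \<Rightarrow> bool" where
  "is_svd T s v1 v2 \<longleftrightarrow>
     (let r = min CARD('a) CARD('b) in
       (\<forall>i<r. 0 \<le> s i) \<and>
       (\<forall>i<r. \<forall>j<r. i \<le> j \<longrightarrow> s j \<le> s i) \<and>
       (\<forall>i<r. \<forall>j<r. v1 i \<bullet> v1 j = (if i = j then 1 else 0)) \<and>
       (\<forall>i<r. \<forall>j<r. v2 i \<bullet> v2 j = (if i = j then 1 else 0)) \<and>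
       T = (\<Sum>i<r. s i *\<^sub>R outer (v1 i) (v2 i)))"


section \<open>Sample statistics and canonical directions\<close>

text \<open>The data are the realised values \<open>x 0, \<dots>, x (n - 1)\<close>.\<close>

definition sample_mean :: "nat \<Rightarrow> (nat \<Rightarrow> real^'a) \<Rightarrow> real^'a" where
  "sample_mean n x = (1 / real n) *\<^sub>R (\<Sum>i<n. x i)"

definition sample_cross_cov ::
  "nat \<Rightarrow> (nat \<Rightarrow> real^'a) \<Rightarrow> (nat \<Rightarrow> real^'b) \<Rightarrow> real^'b^'a" where
  "sample_cross_cov n x y =
     (1 / real n) *\<^sub>R (\<Sum>i<n. outer (x i - sample_mean n x) (y i - sample_mean n y))"

definition sample_cov :: "nat \<Rightarrow> (nat \<Rightarrow> real^'a) \<Rightarrow> real^'a^'a" where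
  "sample_cov n x = sample_cross_cov n x x"

text \<open>The columns of \<open>U1\<close>, \<open>U2\<close> are indexed by the type \<open>'k\<close>, with \<open>CARD('k) = d\<^sub>0\<close>. The
  function \<open>idx\<close>, meant to be a bijection onto \<open>{..<CARD('k)}\<close>, says which canonical pair
  column \<open>j\<close> holds. Singular vectors are not unique, so this is a relation: it holds for every
  admissible choice of them.\<close>

definition canonical_directions ::
  "real^'a^'a \<Rightarrow> real^'b^'a \<Rightarrow> real^'b^'b \<Rightarrow> ('k \<Rightarrow> nat) \<Rightarrow>
   real^'k^'a \<Rightarrow> real^'k^'b \<Rightarrow> real^'k^'k \<Rightarrow> bool" where
  "canonical_directions S11 S12 S22 idx U1 U2 P \<longleftrightarrow>
     (\<exists>s v1 v2. is_svd (inv_sqrt S11 ** S12 ** inv_sqrt S22) s v1 v2 \<and>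
        (\<forall>j. column j U1 = inv_sqrt S11 *v v1 (idx j)) \<and>
        (\<forall>j. column j U2 = inv_sqrt S22 *v v2 (idx j)) \<and>
        P = diag (\<lambda>j. s (idx j)))"


section \<open>Gaussian laws\<close>

text \<open>\<open>gaussian m C\<close> is the law of \<open>m + C\<^sup>1\<^sup>/\<^sup>2 g\<close> with \<open>g\<close> standard normal, so singular
  covariance matrices are allowed.\<close>

definition std_gaussian :: "(real^'n) measure" where
  "std_gaussian = density lborel (\<lambda>x. ennreal (\<Prod>i\<in>UNIV. std_normal_density (x $ i)))"

definition gaussian :: "real^'n \<Rightarrow> real^'n^'n \<Rightarrow> (real^'n) measure" where
  "gaussian m C = distr std_gaussian borel (\<lambda>x. m + psd_sqrt C *v x)"

text \<open>A Gaussian law with singular covariance has no Lebesgue density; the value \<open>0\<close> is used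
  then, so that such parameters never count as maximum likelihood estimates.\<close>

definition gaussian_density :: "real^'n \<Rightarrow> real^'n^'n \<Rightarrow> real^'n \<Rightarrow> real" where
  "gaussian_density m C x =
     (if invertible C
      then exp (- ((x - m) \<bullet> (matrix_inv C *v (x - m))) / 2) / sqrt ((2 * pi) ^ CARD('n) * det C)
      else 0)"


section \<open>The generative model\<close>

record ('a, 'b, 'k) cca_params =
  latent_mean :: "real^'k"
  load1 :: "real^'k^'a"
  load2 :: "real^'k^'b"
  noise_mean1 :: "real^'a"
  noise_mean2 :: "real^'b"
  noise_cov1 :: "real^'a^'a"
  noise_cov2 :: "real^'b^'b"

definition valid_params :: "('a::finite, 'b::finite, 'k::finite) cca_params \<Rightarrow> bool" where
  "valid_params \<theta> \<longleftrightarrow> psd (noise_cov1 \<theta>) \<and> psd (noise_cov2 \<theta>)"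

text \<open>The joint law of \<open>(\<phi>, z\<^sub>1, z\<^sub>2)\<close>: draw \<open>\<phi>\<close>, then draw \<open>z\<^sub>1\<close> and \<open>z\<^sub>2\<close> from their respective
  conditional laws given \<open>\<phi>\<close>.\<close>

definition model_law ::
  "('a::finite, 'b::finite, 'k::finite) cca_params \<Rightarrow> ((real^'k) \<times> (real^'a) \<times> (real^'b)) measure" where
  "model_law \<theta> =
     Giry_Monad.bind (gaussian (latent_mean \<theta>) (mat 1))
       (\<lambda>\<phi>. distr
          (gaussian (load1 \<theta> *v \<phi> + noise_mean1 \<theta>) (noise_cov1 \<theta>) \<Otimes>\<^sub>M
           gaussian (load2 \<theta> *v \<phi> + noise_mean2 \<theta>) (noise_cov2 \<theta>))
          borel (\<lambda>z. (\<phi>, z)))"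

definition cond_indep_given ::
  "'w measure \<Rightarrow> ('w \<Rightarrow> 'x::topological_space) \<Rightarrow> ('w \<Rightarrow> 'y::topological_space) \<Rightarrow>
   ('w \<Rightarrow> 'z::topological_space) \<Rightarrow> bool" where
  "cond_indep_given M X Y Z \<longleftrightarrow>
     (let F = vimage_algebra (space M) Z borel in
      \<forall>A\<in>sets borel. \<forall>B\<in>sets borel. AE w in M.
        real_cond_exp M F (\<lambda>w. indicator A (X w) * indicator B (Y w)) w =
        real_cond_exp M F (\<lambda>w. indicator A (X w)) w * real_cond_exp M F (\<lambda>w. indicator B (Y w)) w)"

text \<open>Integrating out \<open>\<phi>\<close>, the pair \<open>(z\<^sub>1, z\<^sub>2)\<close> is Gaussian with the following mean and
  covariance.\<close>

definition marginal_mean :: "('a::finite, 'b::finite, 'k::finite) cca_params \<Rightarrow> real^('a + 'b)" where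
  "marginal_mean \<theta> =
     stack (load1 \<theta> *v latent_mean \<theta> + noise_mean1 \<theta>) (load2 \<theta> *v latent_mean \<theta> + noise_mean2 \<theta>)"

definition marginal_cov ::
  "('a::finite, 'b::finite, 'k::finite) cca_params \<Rightarrow> real^('a + 'b)^('a + 'b)" where
  "marginal_cov \<theta> =
     (let W = stack (load1 \<theta>) (load2 \<theta>)
      in W ** transpose W + block_diag (noise_cov1 \<theta>) (noise_cov2 \<theta>))"

definition likelihood ::
  "nat \<Rightarrow> (nat \<Rightarrow> real^'a) \<Rightarrow> (nat \<Rightarrow> real^'b) \<Rightarrow>
   ('a::finite, 'b::finite, 'k::finite) cca_params \<Rightarrow> real" where
  "likelihood n x1 x2 \<theta> =
     (\<Prod>i<n. gaussian_density (marginal_mean \<theta>) (marginal_cov \<theta>) (stack (x1 i) (x2 i)))"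

definition is_mle ::
  "nat \<Rightarrow> (nat \<Rightarrow> real^'a) \<Rightarrow> (nat \<Rightarrow> real^'b) \<Rightarrow>
   ('a::finite, 'b::finite, 'k::finite) cca_params \<Rightarrow> bool" where
  "is_mle n x1 x2 \<theta> \<longleftrightarrow>
     valid_params \<theta> \<and>
     (\<forall>\<theta>' :: ('a, 'b, 'k) cca_params.
        valid_params \<theta>' \<longrightarrow> likelihood n x1 x2 \<theta>' \<le> likelihood n x1 x2 \<theta>)"

text \<open>For \<open>M1\<close>, \<open>M2\<close> of spectral norm smaller than one this is a maximizer. Conversely a maximizer
  is of this form, but one of the norms may then be equal to one, since the noise covariances
  may be singular: if all canonical correlations are smaller than one, \<open>M1 = mat 1\<close> and
  \<open>M2 = P\<close> also give a maximizer. If the largest one is equal to one, the likelihood is unbounded.\<close>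

definition cca_estimate ::
  "nat \<Rightarrow> (nat \<Rightarrow> real^'a) \<Rightarrow> (nat \<Rightarrow> real^'b) \<Rightarrow>
   real^'k^'a \<Rightarrow> real^'k^'b \<Rightarrow> real^'k^'k \<Rightarrow> real^'k^'k \<Rightarrow> real^'k \<Rightarrow>
   ('a::finite, 'b::finite, 'k::finite) cca_params" where
  "cca_estimate n x1 x2 U1 U2 M1 M2 m0 =
     (let W1 = sample_cov n x1 ** U1 ** M1;
          W2 = sample_cov n x2 ** U2 ** M2
      in \<lparr> latent_mean = m0,
           load1 = W1,
           load2 = W2,
           noise_mean1 = sample_mean n x1 - W1 *v m0,
           noise_mean2 = sample_mean n x2 - W2 *v m0,
           noise_cov1 = sample_cov n x1 - W1 ** transpose W1,
           noise_cov2 = sample_cov n x2 - W2 ** transpose W2 \<rparr>)"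

end

(*
  The deviance (-2/n times the log-likelihood) depends on the parameters only through the marginal
  mean and covariance C = [[A, K], [K^T, B]], and C is a model covariance only if rank K <= d0.
  Substituting G = A^-1 K and E = B - K^T A^-1 K splits the deviance into a Gaussian term in A and
  one for the regression of z2 on z1, namely  ln det E + tr (E^-1 Sigma(G)),  where Sigma(G) is the
  residual covariance. Gibbs' inequality gives A = S11 and E = Sigma(G), and it remains to minimize
  det Sigma(G) over rank G <= d0. After whitening, Sigma(G) becomes
      I - G^T T - T^T G + G^T G = I - T^T T + (T - G)^T (T - G),   T = S11^-1/2 S12 S22^-1/2.
  It has at most d0 eigenvalues below 1, because x . Sigma(G) x = x . x on the kernel of G; an
  eigenvalue below 1 with eigenvector u is at least 1 - |T u|^2. Jensen's inequality in an
  eigenbasis of T^T T then bounds the product of the eigenvalues from below by the product of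
  1 - p_i^2 over i <= d0. Tracing the equality cases back shows that G is T restricted to a span of
  d0 leading right singular vectors, from which the matrices M1 and M2 are read off.
*)

theory Submission
  imports Defs
begin

text \<open>Semidefiniteness of the noise is awkward to carry through a minimization. The upper
  bound keeps only what it implies for the marginal covariance; the optimum of this relaxed problem
  is admissible exactly when the whitened loadings \<open>S11^-1/2 W1\<close> and
  \<open>S22^-1/2 W2\<close> are contractions, which is where the norms of \<open>M1\<close> and
  \<open>M2\<close> come from.

  Two degeneracies shape the converse. If a canonical correlation equals one, the truncation of
  \<open>T\<close> containing it leads to a singular covariance, which by convention has likelihood
  0; shrinking that truncation by a factor \<open>t < 1\<close> gives valid models whose likelihood
  grows without bound as \<open>t\<close> tends to one, so that there is no maximizer. If singular
  values repeat or vanish, a maximizer singles out its own singular vectors, and its loadings may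
  even use directions that \<open>T\<close> does not see. Hence the eigenbasis and the singular
  value decomposition are built from the maximizer instead of being fixed beforehand.\<close>

declare transpose_matrix_vector [simp del]

section \<open>Orthonormal families\<close>

text \<open>A family rather than a set of vectors: eigenbases are indexed by the dimension type,
  singular vectors by numbers, and parts of either by subsets.\<close>

definition onf :: "'i set \<Rightarrow> ('i \<Rightarrow> 'v::real_inner) \<Rightarrow> bool" where
  "onf I v \<longleftrightarrow> (\<forall>i\<in>I. \<forall>j\<in>I. v i \<bullet> v j = (if i = j then 1 else 0))"

lemma onfD: "onf I v \<Longrightarrow> i \<in> I \<Longrightarrow> j \<in> I \<Longrightarrow> v i \<bullet> v j = (if i = j then 1 else 0)"
  by (simp add: onf_def)

lemma onf_self: "onf I v \<Longrightarrow> i \<in> I \<Longrightarrow> v i \<bullet> v i = 1"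
  by (simp add: onf_def)

lemma onf_subset: "onf I v \<Longrightarrow> J \<subseteq> I \<Longrightarrow> onf J v"
  unfolding onf_def by blast

lemma onf_inj_on: "onf I v \<Longrightarrow> inj_on v I"
  by (rule inj_onI) (metis onf_def zero_neq_one)

lemma onf_reindex: "onf I v \<Longrightarrow> inj_on f A \<Longrightarrow> f ` A \<subseteq> I \<Longrightarrow> onf A (\<lambda>x. v (f x))"
  unfolding onf_def by (smt (verit) image_subset_iff inj_onD)

lemma onf_independent:
  fixes v :: "'i \<Rightarrow> 'v::euclidean_space"
  assumes "onf I v" shows "independent (v ` I)"
proof (rule pairwise_orthogonal_independent)
  show "pairwise orthogonal (v ` I)"
    using assms by (auto simp: pairwise_def orthogonal_def onf_def)
  show "0 \<notin> v ` I"
    using assms by (auto simp: onf_def) (metis inner_zero_left zero_neq_one)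
qed

lemma onf_card_le_dim:
  fixes v :: "'i \<Rightarrow> 'v::euclidean_space"
  assumes "onf I v" "v ` I \<subseteq> X"
  shows "card I \<le> dim X" "finite I"
proof -
  have fin: "finite (v ` I)" using onf_independent[OF assms(1)] independent_bound by blast
  then show "finite I" using onf_inj_on[OF assms(1)] finite_imageD by blast
  have "card I = card (v ` I)" using onf_inj_on[OF assms(1)] by (simp add: card_image)
  also have "\<dots> \<le> dim X" using onf_independent[OF assms(1)] assms(2)
    by (metis dim_eq_card dim_subset span_eq_dim dim_span span_span dim_eq_card_independent)
  finally show "card I \<le> dim X" .
qed

lemma onf_span_eq:
  fixes v :: "'i \<Rightarrow> 'v::euclidean_space"
  assumes "onf I v" "v ` I \<subseteq> X" "subspace X" "dim X \<le> card I"
  shows "span (v ` I) = X"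
proof (rule subspace_dim_equal)
  show "subspace (span (v ` I))" by simp
  show "subspace X" by fact
  show "span (v ` I) \<subseteq> X" using assms by (simp add: span_minimal)
  have "dim (span (v ` I)) = card I"
    using onf_independent[OF assms(1)] onf_inj_on[OF assms(1)]
    by (simp add: card_image dim_eq_card_independent)
  then show "dim X \<le> dim (span (v ` I))" using assms by simp
qed

lemma onf_combine_inner:
  assumes "onf I v" "finite I" "i \<in> I"
  shows "(\<Sum>j\<in>I. c j *\<^sub>R v j) \<bullet> v i = c i"
proof -
  have "(\<Sum>j\<in>I. c j *\<^sub>R v j) \<bullet> v i = (\<Sum>j\<in>I. if i = j then c j else 0)"
    unfolding inner_sum_left
    by (rule sum.cong[OF refl]) (use assms in \<open>simp add: onfD\<close>)
  then show ?thesis using assms by simp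
qed

lemma onf_norm_combine:
  assumes "onf I v" "finite I"
  shows "(\<Sum>j\<in>I. c j *\<^sub>R v j) \<bullet> (\<Sum>j\<in>I. d j *\<^sub>R v j) = (\<Sum>j\<in>I. c j * d j)"
  by (subst inner_sum_right) (rule sum.cong[OF refl], simp add: onf_combine_inner[OF assms] mult.commute)

lemma onf_expand:
  fixes v :: "'i \<Rightarrow> 'v::euclidean_space"
  assumes "onf I v" "x \<in> span (v ` I)" "finite I"
  shows "x = (\<Sum>i\<in>I. (x \<bullet> v i) *\<^sub>R v i)"
proof -
  obtain c where "x = (\<Sum>y\<in>v ` I. c y *\<^sub>R y)"
    using assms(2,3) by (auto simp: span_finite)
  then have x: "x = (\<Sum>i\<in>I. c (v i) *\<^sub>R v i)"
    using onf_inj_on[OF assms(1)] by (simp add: sum.reindex)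
  have "x \<bullet> v i = c (v i)" if "i \<in> I" for i
    unfolding x using onf_combine_inner[OF assms(1,3) that, of "\<lambda>i. c (v i)"] .
  then show ?thesis using x by simp
qed

lemma onb_span:
  fixes v :: "'n::finite \<Rightarrow> real^'n"
  assumes "onf UNIV v" shows "span (range v) = UNIV"
  by (rule onf_span_eq[OF assms]) auto

lemma onb_expand:
  fixes v :: "'n::finite \<Rightarrow> real^'n"
  assumes "onf UNIV v" shows "x = (\<Sum>i\<in>UNIV. (x \<bullet> v i) *\<^sub>R v i)"
  by (rule onf_expand[OF assms]) (simp_all add: onb_span[OF assms])

lemma onb_parseval:
  fixes v :: "'n::finite \<Rightarrow> real^'n"
  assumes "onf UNIV v" shows "x \<bullet> y = (\<Sum>i\<in>UNIV. (x \<bullet> v i) * (y \<bullet> v i))"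
  by (subst onb_expand[OF assms, of x], subst inner_sum_left) (simp add: inner_commute)

text \<open>Each step adds a unit vector of \<open>X\<close> orthogonal to the span reached so far.
  The first \<open>m\<close> members are kept, so that singular vectors already chosen survive the
  completion.\<close>

lemma onf_extend:
  fixes v :: "nat \<Rightarrow> 'v::euclidean_space"
  assumes "onf {..<m} v" "subspace X" "v ` {..<m} \<subseteq> X" "m \<le> k" "k \<le> dim X"
  shows "\<exists>w. onf {..<k} w \<and> w ` {..<k} \<subseteq> X \<and> (\<forall>i<m. w i = v i)"
  using assms(4,5)
proof (induction k rule: dec_induct)
  case base
  then show ?case using assms by blast
next
  case (step k)
  then obtain w where w: "onf {..<k} w" "w ` {..<k} \<subseteq> X" "\<forall>i<m. w i = v i" by auto
  have "span (w ` {..<k}) \<subset> span X"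
  proof -
    have "dim (span (w ` {..<k})) = k"
      using onf_independent[OF w(1)] onf_inj_on[OF w(1)]
      by (simp add: card_image dim_eq_card_independent)
    moreover have "span (w ` {..<k}) \<subseteq> span X" using w(2) by (simp add: span_mono)
    moreover have "dim (span X) > k" using step by simp
    ultimately show ?thesis by (metis dim_span less_irrefl psubsetI)
  qed
  then obtain x where x: "x \<noteq> 0" "x \<in> span X" "\<And>y. y \<in> span (w ` {..<k}) \<Longrightarrow> orthogonal x y"
    using orthogonal_to_subspace_exists_gen by blast
  define z where "z = (1 / norm x) *\<^sub>R x"
  have zX: "z \<in> X" using x(2) assms(2) by (simp add: z_def span_eq_iff[THEN iffD2] subspace_scale)
  have zz: "z \<bullet> z = 1" using x(1) by (simp add: z_def norm_eq_sqrt_inner[symmetric] dot_square_norm power2_eq_square)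
  have zw: "z \<bullet> w i = 0" "w i \<bullet> z = 0" if "i < k" for i
    using x(3)[of "w i"] that by (auto simp: z_def orthogonal_def span_base inner_commute)
  have "onf {..<Suc k} (w(k := z))"
    using w(1) zz zw unfolding onf_def by (auto simp: less_Suc_eq)
  moreover have "(w(k := z)) ` {..<Suc k} \<subseteq> X" using w(2) zX by (auto simp: less_Suc_eq)
  moreover have "\<forall>i<m. (w(k := z)) i = v i" using w(3) step by auto
  ultimately show ?case by blast
qed

section \<open>Symmetric matrices\<close>

lemma inner_matrix_vector: "x \<bullet> (A *v y) = (transpose A *v x) \<bullet> (y :: real^'n)"
  by (simp add: transpose_matrix_vector dot_lmul_matrix)

lemma inner_matrix_vector': "(A *v y) \<bullet> x = (y :: real^'n) \<bullet> (transpose A *v x)"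
  by (metis inner_matrix_vector inner_commute)

lemma sym_inner: "transpose A = A \<Longrightarrow> x \<bullet> (A *v y) = (A *v x) \<bullet> (y :: real^'n)"
  by (metis inner_matrix_vector)

lemma mat_eqI: "(\<And>x. A *v x = B *v x) \<Longrightarrow> A = (B :: real^'n^'m)"
  by (simp add: matrix_eq)

text \<open>The first-order condition at a minimum, free of derivatives; it serves for the Rayleigh
  quotient and for kernels of semidefinite forms.\<close>

lemma quadratic_linear_coeff_zero:
  fixes a q :: real
  assumes "\<And>t. 0 \<le> 2 * t * a + t\<^sup>2 * q"
  shows "a = 0"
proof (rule ccontr)
  assume a: "a \<noteq> 0"
  \<comment> \<open>Here the quadratic term has at most half the size of the negative linear term;
    the \<open>+ 1\<close> covers \<open>q = 0\<close>.\<close>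
  define t where "t = - a / (\<bar>q\<bar> + 1)"
  have t2: "t\<^sup>2 * (\<bar>q\<bar> + 1) = - t * a"
    by (simp add: t_def power2_eq_square)
  have "t * a = - (a\<^sup>2 / (\<bar>q\<bar> + 1))" by (simp add: t_def power2_eq_square)
  moreover have "0 < a\<^sup>2 / (\<bar>q\<bar> + 1)" using a by (intro divide_pos_pos) auto
  ultimately have "t * a < 0" by simp
  moreover have "t\<^sup>2 * q \<le> t\<^sup>2 * (\<bar>q\<bar> + 1)" by (intro mult_left_mono) auto
  ultimately show False using assms[of t] t2 by (simp add: mult.assoc)
qed

text \<open>A maximizer of the quadratic form on the unit sphere of \<open>X\<close> is an
  eigenvector. Allowing an invariant subspace lets the next lemma pass to orthogonal
  complements.\<close>

lemma sym_eigenvector: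
  fixes A :: "real^'n^'n"
  assumes sym: "transpose A = A" and X: "subspace X" "\<And>x. x \<in> X \<Longrightarrow> A *v x \<in> X" "X \<noteq> {0}"
  obtains x c where "x \<in> X" "x \<bullet> x = 1" "A *v x = c *\<^sub>R x"
proof -
  let ?K = "X \<inter> sphere 0 1"
  obtain y where y: "y \<in> X" "y \<noteq> 0" using X(1,3) subspace_0 by blast
  have "(1 / norm y) *\<^sub>R y \<in> ?K" using y X(1) by (simp add: subspace_scale)
  then have ne: "?K \<noteq> {}" by blast
  have "compact ?K" using X(1) by (simp add: closed_subspace closed_Int_compact)
  moreover have "continuous_on ?K (\<lambda>x. x \<bullet> (A *v x))"
    by (intro continuous_intros linear_continuous_on matrix_vector_mul_bounded_linear)
  ultimately obtain x where x: "x \<in> ?K" "\<And>z. z \<in> ?K \<Longrightarrow> z \<bullet> (A *v z) \<le> x \<bullet> (A *v x)"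
    using continuous_attains_sup[OF _ ne] by blast
  define c where "c = x \<bullet> (A *v x)"
  have xx: "x \<bullet> x = 1" "x \<in> X" using x(1) by (auto simp: norm_eq_1)
  have Q: "0 \<le> c * (z \<bullet> z) - z \<bullet> (A *v z)" if "z \<in> X" for z
  proof (cases "z = 0")
    case False
    have "(1 / norm z) *\<^sub>R z \<in> ?K" using that X(1) False by (simp add: subspace_scale)
    from x(2)[OF this] have "(z \<bullet> (A *v z)) / (norm z)\<^sup>2 \<le> c"
      by (simp add: c_def matrix_vector_mult_scaleR power2_eq_square)
    then show ?thesis using False by (simp add: field_simps dot_square_norm)
  qed simp
  \<comment> \<open>The nonnegative form in \<open>Q\<close> vanishes at \<open>x\<close>, and its
    derivative there in direction \<open>w\<close> is \<open>2 * (w \<bullet> w)\<close>.\<close>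
  define w where "w = c *\<^sub>R x - A *v x"
  have wX: "w \<in> X" using xx X(1,2) by (simp add: w_def subspace_diff subspace_scale)
  have "w \<bullet> w = 0"
  proof (rule quadratic_linear_coeff_zero)
    fix t
    have "0 \<le> c * ((x + t *\<^sub>R w) \<bullet> (x + t *\<^sub>R w)) - (x + t *\<^sub>R w) \<bullet> (A *v (x + t *\<^sub>R w))"
      by (rule Q) (use xx wX X(1) in \<open>simp add: subspace_add subspace_scale\<close>)
    also have "\<dots> = 2 * t * (c * (x \<bullet> w) - (A *v x) \<bullet> w) + t\<^sup>2 * (c * (w \<bullet> w) - w \<bullet> (A *v w))"
      using xx sym_inner[OF sym, of x w] inner_commute[of w "A *v x"] inner_commute[of w x]
      by (simp add: matrix_vector_mult_scaleR matrix_vector_right_distrib inner_add_left inner_add_right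
         power2_eq_square algebra_simps c_def)
    also have "c * (x \<bullet> w) - (A *v x) \<bullet> w = w \<bullet> w"
      by (simp add: w_def inner_diff_left)
    finally show "0 \<le> 2 * t * (w \<bullet> w) + t\<^sup>2 * (c * (w \<bullet> w) - w \<bullet> (A *v w))" .
  qed
  then have "A *v x = c *\<^sub>R x" by (simp add: w_def)
  then show ?thesis using that xx by blast
qed

text \<open>The orthogonal complement of eigenvectors of a symmetric matrix is invariant, so it
  contains a further eigenvector as long as \<open>B\<close> is too small.\<close>

lemma sym_eigenbasis_set:
  fixes A :: "real^'n^'n"
  assumes sym: "transpose A = A"
    and "finite B" "onf B (\<lambda>x. x)" "\<And>b. b \<in> B \<Longrightarrow> \<exists>c. A *v b = c *\<^sub>R b"
  shows "\<exists>B'. B \<subseteq> B' \<and> finite B' \<and> card B' = CARD('n) \<and> onf B' (\<lambda>x. x) \<and> (\<forall>b\<in>B'. \<exists>c. A *v b = c *\<^sub>R b)"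
  using assms(2-4)
proof (induction "CARD('n) - card B" arbitrary: B)
  case 0
  then show ?case using onf_card_le_dim[of B "\<lambda>x. x" UNIV] by (auto intro!: exI[of _ B])
next
  case (Suc k)
  define X where "X = {x. \<forall>b\<in>B. x \<bullet> b = 0}"
  have X: "subspace X" unfolding subspace_def X_def by (auto simp: inner_add_left)
  have AX: "A *v x \<in> X" if "x \<in> X" for x
    unfolding X_def
  proof safe
    fix b assume b: "b \<in> B"
    then obtain c where "A *v b = c *\<^sub>R b" using Suc by blast
    then have "(A *v x) \<bullet> b = c * (x \<bullet> b)" using sym_inner[OF sym, of x b] by simp
    then show "(A *v x) \<bullet> b = 0" using that b by (simp add: X_def)
  qed
  have "dim B < DIM(real^'n)"
    using Suc.hyps(2) dim_le_card'[of B] Suc.prems(1) by simp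
  then obtain x where "x \<noteq> 0" "\<And>y. y \<in> span B \<Longrightarrow> orthogonal x y"
    using orthogonal_to_subspace_exists by blast
  then have "x \<in> X" by (auto simp: X_def orthogonal_def span_base)
  then have "X \<noteq> {0}" using \<open>x \<noteq> 0\<close> by blast
  then obtain z c where z: "z \<in> X" "z \<bullet> z = 1" "A *v z = c *\<^sub>R z"
    using sym_eigenvector[OF sym X AX] by metis
  have zB: "z \<notin> B" using z by (auto simp: X_def)
  have "onf (insert z B) (\<lambda>x. x)"
    using z Suc.prems(2) zB unfolding onf_def X_def by (auto simp: inner_commute)
  moreover have "k = CARD('n) - card (insert z B)" using Suc zB by simp
  ultimately obtain B' where "insert z B \<subseteq> B' \<and> finite B' \<and> card B' = CARD('n) \<and> onf B' (\<lambda>x. x) \<and> (\<forall>b\<in>B'. \<exists>c. A *v b = c *\<^sub>R b)"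
    using Suc.hyps(1)[of "insert z B"] Suc.prems z(3) by auto
  then show ?case by blast
qed

text \<open>With repeated eigenvalues an arbitrary eigenbasis may miss given eigenvectors; the later
  comparisons need one that contains them.\<close>

lemma sym_eigenbasis_extend:
  fixes A :: "real^'n^'n"
  assumes "transpose A = A" "onf I u" "\<And>i. i \<in> I \<Longrightarrow> \<exists>c. A *v u i = c *\<^sub>R u i"
  obtains v :: "'n \<Rightarrow> real^'n" and \<kappa> where
    "onf UNIV v" "\<And>i. A *v v i = \<kappa> i *\<^sub>R v i" "u ` I \<subseteq> range v"
proof -
  have "finite (u ` I)" using onf_independent[OF assms(2)] independent_bound by blast
  moreover have "onf (u ` I) (\<lambda>x. x)"
    using assms(2) onf_inj_on[OF assms(2)] unfolding onf_def by (auto simp: inj_on_eq_iff)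
  ultimately obtain B' where B': "u ` I \<subseteq> B'" "finite B'" "card B' = CARD('n)" "onf B' (\<lambda>x. x)"
    "\<forall>b\<in>B'. \<exists>c. A *v b = c *\<^sub>R b"
    using sym_eigenbasis_set[OF assms(1), of "u ` I"] assms(3) by auto
  obtain v where v: "bij_betw v (UNIV :: 'n set) B'"
    using B'(2,3) finite_same_card_bij[of "UNIV :: 'n set" B'] by auto
  have "onf UNIV v" using onf_reindex[OF B'(4), of v UNIV] v by (auto simp: bij_betw_def)
  moreover have "\<forall>i. \<exists>c. A *v v i = c *\<^sub>R v i" using B'(5) v by (auto simp: bij_betw_def)
  then obtain \<kappa> where "\<And>i. A *v v i = \<kappa> i *\<^sub>R v i" by metis
  ultimately show ?thesis using that B'(1) v by (auto simp: bij_betw_def)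
qed

lemma sym_eigenbasis:
  fixes A :: "real^'n^'n"
  assumes "transpose A = A"
  obtains v :: "'n \<Rightarrow> real^'n" and \<kappa> where "onf UNIV v" "\<And>i. A *v v i = \<kappa> i *\<^sub>R v i"
  using sym_eigenbasis_extend[OF assms, of "{}" "\<lambda>_. 0"] by (auto simp: onf_def)

text \<open>With the basis as the columns of \<open>Q\<close>, the matrix is
  \<open>Q ** L ** transpose Q\<close> and \<open>det Q\<close> squares to one. This takes the place
  of the characteristic polynomial.\<close>

lemma trace_det_eigenbasis:
  fixes A :: "real^'n^'n"
  assumes "onf UNIV (v :: 'n \<Rightarrow> real^'n)" "\<And>i. A *v v i = \<kappa> i *\<^sub>R v i"
  shows "trace A = (\<Sum>i\<in>UNIV. \<kappa> i)" "det A = (\<Prod>i\<in>UNIV. \<kappa> i)"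
proof -
  define Q :: "real^'n^'n" where "Q = (\<chi> i j. v j $ i)"
  define L :: "real^'n^'n" where "L = diag \<kappa>"
  have col: "column j Q = v j" for j by (simp add: Q_def column_def)
  have QQ: "transpose Q ** Q = mat 1"
    using assms(1) by (simp add: vec_eq_iff matrix_matrix_mult_def transpose_def mat_def Q_def
      onf_def inner_vec_def)
  then have QQ': "Q ** transpose Q = mat 1" by (simp add: matrix_left_right_inverse)
  have AQ: "A ** Q = Q ** L"
  proof -
    have "(A ** Q) $ i $ j = (A *v v j) $ i" for i j
      by (simp add: matrix_matrix_mult_def matrix_vector_mult_def Q_def)
    moreover have "(Q ** L) $ i $ j = \<kappa> j * v j $ i" for i j
      by (simp add: matrix_matrix_mult_def Q_def L_def diag_def if_distrib cong: if_cong)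
    ultimately show ?thesis by (simp add: vec_eq_iff assms(2))
  qed
  have A: "A = Q ** L ** transpose Q"
    using AQ QQ' by (metis matrix_mul_assoc matrix_mul_rid)
  have "trace A = trace (transpose Q ** (Q ** L))" unfolding A by (rule trace_mul_sym)
  also have "\<dots> = trace L" by (simp add: matrix_mul_assoc QQ)
  finally show "trace A = (\<Sum>i\<in>UNIV. \<kappa> i)" by (simp add: trace_def L_def diag_def)
  have d: "det Q * det Q = 1" using QQ by (metis det_I det_mul det_transpose)
  have "det A = (det Q * det Q) * det L" unfolding A by (simp add: det_mul det_transpose)
  also have "\<dots> = det L" using d by simp
  also have "\<dots> = (\<Prod>i\<in>UNIV. L $ i $ i)"
    by (rule det_diagonal) (simp add: L_def diag_def)
  finally show "det A = (\<Prod>i\<in>UNIV. \<kappa> i)" by (simp add: L_def diag_def)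
qed

lemma onb_matrix_eqI:
  fixes A B :: "real^'n^'m"
  assumes "onf UNIV (v :: 'n \<Rightarrow> real^'n)" "\<And>i. A *v v i = B *v v i"
  shows "A = B"
proof (rule mat_eqI)
  fix x
  show "A *v x = B *v x"
    by (subst (1 2) onb_expand[OF assms(1), of x])
       (simp add: linear_sum[OF matrix_vector_mul_linear] matrix_vector_mult_scaleR assms(2))
qed

section \<open>Positive definite matrices\<close>

lemma invertible_inv:
  fixes A :: "real^'n^'n"
  assumes "invertible A"
  shows "A ** matrix_inv A = mat 1" "matrix_inv A ** A = mat 1"
  using someI_ex[of "\<lambda>A'. A ** A' = mat 1 \<and> A' ** A = mat 1"] assms
  by (auto simp: matrix_inv_def invertible_def)

lemma matrix_inv_eqI:
  fixes A B :: "real^'n^'n"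
  assumes "A ** B = mat 1"
  shows "invertible A" "matrix_inv A = B"
proof -
  have BA: "B ** A = mat 1" using assms by (simp add: matrix_left_right_inverse)
  show inv: "invertible A" using assms BA by (auto simp: invertible_def)
  show "matrix_inv A = B"
    using invertible_inv(1)[OF inv] BA by (metis matrix_mul_assoc matrix_mul_lid matrix_mul_rid)
qed

lemma transpose_matrix_inv:
  fixes A :: "real^'n^'n"
  assumes "invertible A" "transpose A = A"
  shows "transpose (matrix_inv A) = matrix_inv A"
  using matrix_inv_eqI(2)[of A "transpose (matrix_inv A)"] invertible_inv(2)[OF assms(1)] assms(2)
  by (metis matrix_transpose_mul transpose_mat)

lemma inv_vec_cancel:
  fixes A :: "real^'n^'n"
  assumes "invertible A"
  shows "A *v (matrix_inv A *v x) = x" "matrix_inv A *v (A *v x) = x"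
  by (simp_all add: matrix_vector_mul_assoc invertible_inv[OF assms])

definition pd :: "real^'n^'n \<Rightarrow> bool" where
  "pd A \<longleftrightarrow> transpose A = A \<and> (\<forall>x. x \<noteq> 0 \<longrightarrow> 0 < x \<bullet> (A *v x))"

lemma pd_imp_psd: "pd A \<Longrightarrow> psd A"
  unfolding pd_def psd_def by (metis inner_zero_left less_imp_le order_refl)

lemma pd_sym: "pd A \<Longrightarrow> transpose A = A" by (simp add: pd_def)
lemma psd_sym: "psd A \<Longrightarrow> transpose A = A" by (simp add: psd_def)

text \<open>The form attains its minimum 0 at \<open>x\<close>, so its derivative in the direction
  \<open>A *v x\<close> vanishes there.\<close>

lemma psd_kernel:
  assumes "psd A" "x \<bullet> (A *v x) = 0" shows "A *v x = 0"
proof -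
  have "(A *v x) \<bullet> (A *v x) = 0"
  proof (rule quadratic_linear_coeff_zero)
    fix t
    let ?w = "A *v x"
    have "0 \<le> (x + t *\<^sub>R ?w) \<bullet> (A *v (x + t *\<^sub>R ?w))" using assms(1) by (simp add: psd_def)
    also have "\<dots> = 2 * t * (?w \<bullet> ?w) + t\<^sup>2 * (?w \<bullet> (A *v ?w))"
      using assms(2) sym_inner[OF psd_sym[OF assms(1)], of x ?w]
      by (simp add: matrix_vector_mult_scaleR matrix_vector_right_distrib inner_add_left inner_add_right
         power2_eq_square algebra_simps)
    finally show "0 \<le> 2 * t * (?w \<bullet> ?w) + t\<^sup>2 * (?w \<bullet> (A *v ?w))" .
  qed
  then show ?thesis by simp
qed

lemma inj_matrix_invertible:
  fixes A :: "real^'n^'n"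
  assumes "\<And>x. A *v x = 0 \<Longrightarrow> x = 0"
  shows "invertible A"
  using assms by (metis invertible_def matrix_left_invertible_ker matrix_left_right_inverse)

lemma invertible_inj:
  fixes A :: "real^'n^'n"
  shows "invertible A \<Longrightarrow> A *v x = 0 \<Longrightarrow> x = 0"
  by (metis inv_vec_cancel(2) matrix_vector_mult_0_right)

lemma pd_invertible:
  assumes "pd A" shows "invertible A"
  by (rule inj_matrix_invertible) (use assms in \<open>metis pd_def inner_zero_right less_irrefl\<close>)

lemma psd_invertible_pd:
  assumes "psd A" "invertible A" shows "pd A"
proof -
  have "0 < x \<bullet> (A *v x)" if "x \<noteq> 0" for x
  proof -
    have "x \<bullet> (A *v x) \<noteq> 0" using psd_kernel[OF assms(1)] invertible_inj[OF assms(2)] that by blast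
    moreover have "0 \<le> x \<bullet> (A *v x)" using assms(1) by (simp add: psd_def)
    ultimately show ?thesis by simp
  qed
  then show ?thesis using assms(1) by (simp add: pd_def psd_def)
qed

lemma pd_inverse:
  assumes "pd A" shows "pd (matrix_inv A)"
proof -
  note inv = pd_invertible[OF assms]
  have "0 < x \<bullet> (matrix_inv A *v x)" if "x \<noteq> 0" for x
  proof -
    let ?y = "matrix_inv A *v x"
    have x: "A *v ?y = x" by (rule inv_vec_cancel[OF inv])
    then have "?y \<noteq> 0" using that by auto
    then have "0 < ?y \<bullet> (A *v ?y)" using assms by (simp add: pd_def)
    then show ?thesis by (simp add: x inner_commute)
  qed
  then show ?thesis using transpose_matrix_inv[OF inv pd_sym[OF assms]] by (simp add: pd_def)
qed

lemma congruence_form: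
  fixes A :: "real^'n^'n" and L :: "real^'m^'n"
  shows "x \<bullet> ((transpose L ** A ** L) *v y) = (L *v x) \<bullet> (A *v (L *v y))"
  by (simp add: matrix_vector_mul_assoc[symmetric] inner_matrix_vector[of x "transpose L"])

lemma congruence_sym:
  fixes A :: "real^'n^'n" and L :: "real^'m^'n"
  shows "transpose A = A \<Longrightarrow> transpose (transpose L ** A ** L) = transpose L ** A ** L"
  by (simp add: matrix_transpose_mul matrix_mul_assoc)

lemma pd_congruence:
  fixes A L :: "real^'n^'n"
  shows "pd A \<Longrightarrow> invertible L \<Longrightarrow> pd (transpose L ** A ** L)"
  using congruence_sym[of A L] invertible_inj[of L] by (auto simp: pd_def congruence_form)

lemma outer_mult_vec: "outer u v *v x = (v \<bullet> x) *\<^sub>R u"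
  by (simp add: vec_eq_iff outer_def matrix_vector_mult_def inner_vec_def sum_distrib_left
      mult.assoc mult.commute mult.left_commute)

lemma transpose_outer: "transpose (outer u v) = outer v u"
  by (simp add: outer_def transpose_def vec_eq_iff)

lemma transpose_add: "transpose (A + B) = transpose A + transpose (B :: real^'n^'m)"
  by (simp add: transpose_def vec_eq_iff)

lemma transpose_diff: "transpose (A - B) = transpose A - transpose (B :: real^'n^'m)"
  by (simp add: transpose_def vec_eq_iff)

lemma transpose_sum: "transpose (\<Sum>i\<in>I. f i :: real^'n^'m) = (\<Sum>i\<in>I. transpose (f i))"
  by (simp add: transpose_def vec_eq_iff)

lemma sum_matrix_vec: "(\<Sum>i\<in>I. f i :: real^'n^'m) *v x = (\<Sum>i\<in>I. f i *v x)"
  by (induction I rule: infinite_finite_induct) (simp_all add: matrix_vector_mult_add_rdistrib)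

lemma scaleR_matrix_vec: "(c *\<^sub>R A) *v x = c *\<^sub>R (A *v (x :: real^'n))"
  by (simp add: scaleR_matrix_vector_assoc)

lemma matrix_vec_sum: "(A :: real^'n^'m) *v (\<Sum>i\<in>I. f i) = (\<Sum>i\<in>I. A *v f i)"
  by (rule linear_sum) (rule matrix_vector_mul_linear)

lemma eigen_form:
  fixes A :: "real^'n^'n" and v :: "'n \<Rightarrow> real^'n"
  assumes "onf UNIV v" "\<And>i. A *v v i = \<kappa> i *\<^sub>R v i"
  shows "A *v x = (\<Sum>i\<in>UNIV. (\<kappa> i * (x \<bullet> v i)) *\<^sub>R v i)"
    and "y \<bullet> (A *v x) = (\<Sum>i\<in>UNIV. \<kappa> i * (x \<bullet> v i) * (y \<bullet> v i))"
proof -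
  show *: "A *v x = (\<Sum>i\<in>UNIV. (\<kappa> i * (x \<bullet> v i)) *\<^sub>R v i)"
    by (subst onb_expand[OF assms(1), of x])
       (simp add: matrix_vec_sum matrix_vector_mult_scaleR assms(2) mult.commute)
  show "y \<bullet> (A *v x) = (\<Sum>i\<in>UNIV. \<kappa> i * (x \<bullet> v i) * (y \<bullet> v i))"
    unfolding * by (simp add: inner_sum_right)
qed

lemma eigen_value:
  fixes A :: "real^'n^'n" and v :: "'n \<Rightarrow> real^'n"
  assumes "onf UNIV v" "\<And>i. A *v v i = \<kappa> i *\<^sub>R v i"
  shows "v i \<bullet> (A *v v i) = \<kappa> i"
  using assms by (simp add: onf_self)

lemma psd_eigenvalue:
  fixes v :: "'n::finite \<Rightarrow> real^'n"
  assumes "psd A" "onf UNIV v" "\<And>i. A *v v i = \<kappa> i *\<^sub>R v i" shows "0 \<le> \<kappa> i"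
  using assms(1) eigen_value[OF assms(2,3), of i] by (metis psd_def)

lemma pd_eigenvalue:
  fixes v :: "'n::finite \<Rightarrow> real^'n"
  assumes "pd A" "onf UNIV v" "\<And>i. A *v v i = \<kappa> i *\<^sub>R v i" shows "0 < \<kappa> i"
proof -
  have "v i \<noteq> 0" using onf_self[OF assms(2), of i] by auto
  then show ?thesis using assms(1) eigen_value[OF assms(2,3), of i] by (metis pd_def)
qed

section \<open>Matrices with prescribed spectrum, square roots and Gibbs' inequality\<close>

definition spec :: "('n \<Rightarrow> real^'n) \<Rightarrow> ('n \<Rightarrow> real) \<Rightarrow> real^'n^'n" where
  "spec v \<kappa> = (\<Sum>i\<in>UNIV. \<kappa> i *\<^sub>R outer (v i) (v i))"

lemma spec_eigen:
  assumes "onf UNIV v" shows "spec v \<kappa> *v v i = \<kappa> i *\<^sub>R v i"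
proof -
  have "spec v \<kappa> *v v i = (\<Sum>j\<in>UNIV. (if i = j then \<kappa> j *\<^sub>R v j else 0))"
    unfolding spec_def sum_matrix_vec
    by (rule sum.cong) (use assms in \<open>auto simp: scaleR_matrix_vec outer_mult_vec onf_def\<close>)
  then show ?thesis by simp
qed

lemma spec_sym: "transpose (spec v \<kappa>) = spec v \<kappa>"
  unfolding spec_def transpose_sum
  by (rule sum.cong) (simp_all add: outer_def transpose_def vec_eq_iff)

lemma spec_psd:
  assumes "onf UNIV v" "\<And>i. 0 \<le> \<kappa> i" shows "psd (spec v \<kappa>)"
  unfolding psd_def using spec_sym eigen_form(2)[OF assms(1) spec_eigen[OF assms(1)]] assms(2)
  by (auto intro!: sum_nonneg simp: mult.assoc)

lemma pd_det_pos:
  fixes A :: "real^'n^'n"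
  assumes "pd A" shows "0 < det A"
proof -
  obtain v \<kappa> where v: "onf UNIV (v :: 'n \<Rightarrow> real^'n)" "\<And>i. A *v v i = \<kappa> i *\<^sub>R v i"
    using sym_eigenbasis[OF pd_sym[OF assms]] by metis
  show ?thesis unfolding trace_det_eigenbasis(2)[OF v]
    by (rule prod_pos) (use pd_eigenvalue[OF assms v] in blast)
qed

text \<open>For an eigenvector of \<open>B\<close> with value \<open>\<beta>\<close>, the
  discrepancy \<open>?w\<close> satisfies \<open>B' *v ?w = - (\<beta> *\<^sub>R ?w)\<close>. A
  semidefinite \<open>B'\<close> has no negative eigenvalue, so \<open>?w\<close> vanishes if
  \<open>\<beta>\<close> is positive; if \<open>\<beta> = 0\<close>, then \<open>B'\<close>
  annihilates the vector because its square does.\<close>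

lemma psd_sqrt_unique:
  fixes A B B' :: "real^'n^'n"
  assumes "psd B" "B ** B = A" "psd B'" "B' ** B' = A"
  shows "B' = B"
proof -
  obtain v \<beta> where v: "onf UNIV (v :: 'n \<Rightarrow> real^'n)" "\<And>i. B *v v i = \<beta> i *\<^sub>R v i"
    using sym_eigenbasis[OF psd_sym[OF assms(1)]] by metis
  have "B' *v v i = B *v v i" for i
  proof -
    let ?w = "B' *v v i - \<beta> i *\<^sub>R v i"
    have b: "0 \<le> \<beta> i" by (rule psd_eigenvalue[OF assms(1) v])
    have A: "B' *v (B' *v v i) = \<beta> i *\<^sub>R (\<beta> i *\<^sub>R v i)"
      using assms(2,4) v(2)[of i] by (metis matrix_vector_mul_assoc matrix_vector_mult_scaleR)
    have w: "B' *v ?w = - (\<beta> i *\<^sub>R ?w)"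
      by (simp add: matrix_vector_mult_diff_distrib matrix_vector_mult_scaleR A algebra_simps)
    have "0 \<le> ?w \<bullet> (B' *v ?w)" using assms(3) by (simp add: psd_def)
    then have le: "\<beta> i * (?w \<bullet> ?w) \<le> 0" unfolding w by simp
    have "?w = 0"
    proof (cases "\<beta> i = 0")
      case True
      have "v i \<bullet> (B' *v (B' *v v i)) = (B' *v v i) \<bullet> (B' *v v i)"
        using sym_inner[OF psd_sym[OF assms(3)]] by blast
      then show ?thesis using A True by simp
    next
      case False
      then have "0 < \<beta> i" using b by simp
      then have "?w \<bullet> ?w \<le> 0" using le by (metis mult_le_0_iff not_le)
      then show ?thesis by (metis antisym inner_ge_zero inner_eq_zero_iff)
    qed
    then show ?thesis using v(2) by simp
  qed
  then show ?thesis using onb_matrix_eqI[OF v(1)] by blast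
qed

lemma psd_sqrt:
  fixes A :: "real^'n^'n"
  assumes "psd A" shows "psd (psd_sqrt A)" "psd_sqrt A ** psd_sqrt A = A"
proof -
  obtain v \<kappa> where v: "onf UNIV (v :: 'n \<Rightarrow> real^'n)" "\<And>i. A *v v i = \<kappa> i *\<^sub>R v i"
    using sym_eigenbasis[OF psd_sym[OF assms]] by metis
  let ?B = "spec v (\<lambda>i. sqrt (\<kappa> i))"
  have k: "0 \<le> \<kappa> i" for i by (rule psd_eigenvalue[OF assms v])
  have 1: "psd ?B" by (rule spec_psd[OF v(1)]) (simp add: k)
  have "?B ** ?B = A"
    by (rule onb_matrix_eqI[OF v(1)])
       (simp add: matrix_vector_mul_assoc[symmetric] spec_eigen[OF v(1)] matrix_vector_mult_scaleR v(2) k)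
  then have "\<exists>!B. psd B \<and> B ** B = A" using 1 psd_sqrt_unique by blast
  from theI'[OF this] show "psd (psd_sqrt A)" "psd_sqrt A ** psd_sqrt A = A"
    by (simp_all add: psd_sqrt_def)
qed

lemma pd_sqrt:
  assumes "pd A" shows "pd (psd_sqrt A)"
proof (rule psd_invertible_pd)
  show "psd (psd_sqrt A)" using assms by (simp add: psd_sqrt pd_imp_psd)
  show "invertible (psd_sqrt A)"
    using pd_invertible[OF assms] psd_sqrt(2)[OF pd_imp_psd[OF assms]]
    by (metis det_mul invertible_det_nz mult_eq_0_iff)
qed

text \<open>The gap is twice the Kullback-Leibler divergence of the centered Gaussian with
  covariance \<open>Y\<close> from the one with covariance \<open>X\<close>. It equals the sum of
  \<open>\<mu> - 1 - ln \<mu>\<close> over the eigenvalues of \<open>R ** matrix_inv X ** R\<close>,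
  a symmetric matrix with the determinant and trace of \<open>matrix_inv X ** Y\<close>; each
  summand is nonnegative and vanishes only at one.\<close>

lemma gibbs:
  fixes X Y :: "real^'n^'n"
  assumes "pd X" "pd Y"
  shows "ln (det Y) + real CARD('n) \<le> ln (det X) + trace (matrix_inv X ** Y)"
    and "ln (det X) + trace (matrix_inv X ** Y) \<le> ln (det Y) + real CARD('n) \<Longrightarrow> X = Y"
proof -
  define R where "R = psd_sqrt Y"
  have R: "pd R" "R ** R = Y" "transpose R = R" "invertible R"
    using pd_sqrt[OF assms(2)] psd_sqrt(2)[OF pd_imp_psd[OF assms(2)]] pd_sym pd_invertible
    by (auto simp: R_def)
  let ?B = "R ** matrix_inv X ** R"
  have B: "pd ?B" using pd_congruence[OF pd_inverse[OF assms(1)] R(4)] R(3) by simp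
  obtain v \<mu> where v: "onf UNIV (v :: 'n \<Rightarrow> real^'n)" "\<And>i. ?B *v v i = \<mu> i *\<^sub>R v i"
    using sym_eigenbasis[OF pd_sym[OF B]] by metis
  have mu: "0 < \<mu> i" for i by (rule pd_eigenvalue[OF B v])
  have "det (matrix_inv X) * det X = 1"
    by (metis det_I det_mul invertible_inv(2) pd_invertible[OF assms(1)])
  then have dX: "det (matrix_inv X) = 1 / det X"
    using pd_det_pos[OF assms(1)] by (simp add: field_simps)
  have "det ?B = det Y / det X"
    unfolding R(2)[symmetric] by (simp add: det_mul dX)
  then have "ln (det Y) - ln (det X) = ln (\<Prod>i\<in>UNIV. \<mu> i)"
    using pd_det_pos[OF assms(1)] pd_det_pos[OF assms(2)] trace_det_eigenbasis(2)[OF v]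
    by (simp add: ln_div)
  also have "\<dots> = (\<Sum>i\<in>UNIV. ln (\<mu> i))" by (rule ln_prod) (use mu in \<open>auto simp: less_imp_neq[symmetric]\<close>)
  finally have l: "ln (det Y) - ln (det X) = (\<Sum>i\<in>UNIV. ln (\<mu> i))" .
  have "trace ?B = trace (matrix_inv X ** Y)"
    using trace_mul_sym[of R "matrix_inv X ** R"] R(2) by (simp add: matrix_mul_assoc[symmetric])
  then have t: "trace (matrix_inv X ** Y) = (\<Sum>i\<in>UNIV. \<mu> i)"
    using trace_det_eigenbasis(1)[OF v] by simp
  have gap: "ln (det X) + trace (matrix_inv X ** Y) - (ln (det Y) + real CARD('n))
    = (\<Sum>i\<in>UNIV. \<mu> i - 1 - ln (\<mu> i))"
    using l t by (simp add: sum_subtractf)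
  have nn: "0 \<le> \<mu> i - 1 - ln (\<mu> i)" for i using ln_le_minus_one[OF mu, of i] by simp
  show "ln (det Y) + real CARD('n) \<le> ln (det X) + trace (matrix_inv X ** Y)"
    using gap sum_nonneg[of UNIV "\<lambda>i. \<mu> i - 1 - ln (\<mu> i)"] nn by simp
  assume "ln (det X) + trace (matrix_inv X ** Y) \<le> ln (det Y) + real CARD('n)"
  then have "(\<Sum>i\<in>UNIV. \<mu> i - 1 - ln (\<mu> i)) = 0"
    using gap sum_nonneg[of UNIV "\<lambda>i. \<mu> i - 1 - ln (\<mu> i)"] nn by simp
  then have "\<mu> i = 1" for i
    using nn ln_eq_minus_one[OF mu, of i] sum_nonneg_eq_0_iff[of UNIV "\<lambda>i. \<mu> i - 1 - ln (\<mu> i)"] by simp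
  then have B1: "?B = mat 1" by (intro onb_matrix_eqI[OF v(1)]) (simp add: v(2))
  have "R ** (matrix_inv X ** R) = mat 1" using B1 by (simp add: matrix_mul_assoc)
  then have "matrix_inv X ** R ** R = mat 1" by (simp add: matrix_left_right_inverse)
  then have "matrix_inv X ** Y = mat 1" using R(2) by (simp add: matrix_mul_assoc[symmetric])
  then have "X ** (matrix_inv X ** Y) = X" by simp
  then show "X = Y" by (simp add: matrix_mul_assoc invertible_inv pd_invertible[OF assms(1)])
qed

section \<open>Reduced-rank regression\<close>

text \<open>Jensen's inequality for \<open>ln\<close>, by the tangent at the mean \<open>m\<close>:
  the gap is the \<open>w\<close>-average of \<open>z - 1 - ln z\<close> at
  \<open>z = y i / m\<close>. This exact form of the gap also yields the equality case.\<close>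

lemma weighted_ln_le:
  fixes w y :: "'i \<Rightarrow> real"
  assumes "finite I" "\<And>i. i \<in> I \<Longrightarrow> 0 \<le> w i" "(\<Sum>i\<in>I. w i) = 1" "\<And>i. i \<in> I \<Longrightarrow> 0 < y i"
    and m: "m = (\<Sum>i\<in>I. w i * y i)"
  shows "0 < m" "(\<Sum>i\<in>I. w i * ln (y i)) \<le> ln m"
    and "ln m \<le> (\<Sum>i\<in>I. w i * ln (y i)) \<Longrightarrow> i \<in> I \<Longrightarrow> w i = 0 \<or> y i = m"
proof -
  obtain k where k: "k \<in> I" "w k \<noteq> 0" using assms(3) by (metis sum.neutral zero_neq_one)
  show m0: "0 < m" unfolding m
    by (rule sum_pos2[OF assms(1) k(1)])
       (use assms k in \<open>auto intro!: mult_pos_pos mult_nonneg_nonneg simp: less_le\<close>)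
  have gap: "ln m - (\<Sum>i\<in>I. w i * ln (y i)) = (\<Sum>i\<in>I. w i * (y i / m - 1 - ln (y i / m)))"
  proof -
    have "(\<Sum>i\<in>I. w i * (y i / m - 1 - ln (y i / m)))
      = (\<Sum>i\<in>I. w i * y i / m - w i - (w i * ln (y i) - w i * ln m))"
    proof (rule sum.cong)
      fix i assume "i \<in> I"
      then have "0 < y i" using assms(4) by blast
      then show "w i * (y i / m - 1 - ln (y i / m)) = w i * y i / m - w i - (w i * ln (y i) - w i * ln m)"
        using m0 by (simp add: ln_div algebra_simps)
    qed simp
    also have "\<dots> = m / m - 1 - ((\<Sum>i\<in>I. w i * ln (y i)) - ln m)"
      unfolding sum_subtractf sum_divide_distrib[symmetric] sum_distrib_right[symmetric] assms(3) m[symmetric]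
      by simp
    finally show ?thesis using m0 by simp
  qed
  have nn: "0 \<le> w i * (y i / m - 1 - ln (y i / m))" if "i \<in> I" for i
    using assms that m0 ln_le_minus_one[of "y i / m"] by (intro mult_nonneg_nonneg) auto
  have gap0: "0 \<le> (\<Sum>i\<in>I. w i * (y i / m - 1 - ln (y i / m)))" by (rule sum_nonneg) (rule nn)
  then show "(\<Sum>i\<in>I. w i * ln (y i)) \<le> ln m" using gap by simp
  assume "ln m \<le> (\<Sum>i\<in>I. w i * ln (y i))" and i: "i \<in> I"
  then have "(\<Sum>i\<in>I. w i * (y i / m - 1 - ln (y i / m))) = 0"
    using gap gap0 by simp
  then have "w i * (y i / m - 1 - ln (y i / m)) = 0"
    by (subst (asm) sum_nonneg_eq_0_iff) (use assms(1) nn i in auto)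
  then show "w i = 0 \<or> y i = m"
    using ln_eq_minus_one[of "y i / m"] assms(4)[OF i] m0 by auto
qed

lemma top_weighted_sum_le:
  fixes w c :: "'i::finite \<Rightarrow> real"
  assumes "\<And>i. 0 \<le> w i" "\<And>i. w i \<le> 1" "(\<Sum>i\<in>UNIV. w i) \<le> real (card D)"
    and "\<And>i. 0 \<le> c i" "\<And>i j. i \<in> D \<Longrightarrow> j \<notin> D \<Longrightarrow> c j \<le> c i"
  shows "(\<Sum>i\<in>UNIV. w i * c i) \<le> (\<Sum>i\<in>D. c i)"
proof (cases "D = {}")
  case True
  then have "(\<Sum>i\<in>UNIV. w i) = 0" using assms(1,3) by (simp add: antisym sum_nonneg)
  then have "w i = 0" for i using sum_nonneg_eq_0_iff[of UNIV w] assms(1) by simp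
  then show ?thesis using True by simp
next
  case False
  define m where "m = Min (c ` D)"
  have m: "m \<le> c i" if "i \<in> D" for i using that by (simp add: m_def)
  have "m \<in> c ` D" unfolding m_def using False by (intro Min_in) auto
  then obtain k where k: "k \<in> D" "m = c k" by blast
  have split: "(\<Sum>i\<in>UNIV. f i) = (\<Sum>i\<in>D. f i) + (\<Sum>i\<in>-D. f i)" for f :: "'i \<Rightarrow> real"
    using sum.union_disjoint[of D "-D" f] by simp
  have "(\<Sum>i\<in>UNIV. w i * c i) \<le> (\<Sum>i\<in>D. w i * c i) + (\<Sum>i\<in>-D. w i * m)"
    unfolding split using assms k by (intro add_left_mono sum_mono mult_left_mono) auto
  also have "(\<Sum>i\<in>-D. w i * m) = m * (\<Sum>i\<in>-D. w i)" by (simp add: sum_distrib_left mult.commute)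
  also have "\<dots> \<le> m * (\<Sum>i\<in>D. 1 - w i)"
    using assms(3) k assms(4)[of k] split[of w] by (intro mult_left_mono) (auto simp: sum_subtractf)
  also have "\<dots> = (\<Sum>i\<in>D. (1 - w i) * m)" by (simp add: sum_distrib_left mult.commute)
  also have "(\<Sum>i\<in>D. w i * c i) + \<dots> \<le> (\<Sum>i\<in>D. w i * c i) + (\<Sum>i\<in>D. (1 - w i) * c i)"
    using m assms(2) by (intro add_left_mono sum_mono mult_left_mono) auto
  also have "\<dots> = (\<Sum>i\<in>D. c i)" by (simp add: sum.distrib[symmetric] algebra_simps)
  finally show ?thesis by simp
qed

section \<open>The residual covariance in whitened coordinates\<close>

definition resid :: "real^'b^'a \<Rightarrow> real^'b^'a \<Rightarrow> real^'b^'b" where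
  "resid T G = mat 1 - transpose G ** T - transpose T ** G + transpose G ** G"

lemma resid_sym: "transpose (resid T G) = resid T G"
  by (simp add: resid_def transpose_add transpose_diff matrix_transpose_mul transpose_mat)

lemma resid_form:
  "x \<bullet> (resid T G *v x) = x \<bullet> x - 2 * ((T *v x) \<bullet> (G *v x)) + (G *v x) \<bullet> (G *v x)"
  by (simp add: resid_def matrix_vector_mult_add_rdistrib matrix_vector_mult_diff_rdistrib
     matrix_vector_mul_assoc[symmetric] inner_add_right inner_diff_right
     inner_matrix_vector[of x "transpose T"] inner_matrix_vector[of x "transpose G"]
     inner_commute[of "G *v x" "T *v x"])

text \<open>The completed square: it bounds the form from below by what full regression on
  \<open>T\<close> leaves, whereas \<open>resid_form\<close> shows its value on the kernel of
  \<open>G\<close>.\<close>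

lemma resid_form':
  "x \<bullet> (resid T G *v x) = x \<bullet> x - (T *v x) \<bullet> (T *v x) + ((T - G) *v x) \<bullet> ((T - G) *v x)"
  unfolding resid_form
  by (simp add: matrix_vector_mult_diff_rdistrib inner_diff_left inner_diff_right
      inner_commute[of "G *v x" "T *v x"])

lemma gram_form: "x \<bullet> ((transpose T ** T) *v y) = (T *v x) \<bullet> (T *v (y :: real^'n))"
  by (simp add: matrix_vector_mul_assoc[symmetric] inner_matrix_vector[of x "transpose T"])

lemma gram_sym: "transpose (transpose T ** T) = transpose T ** (T :: real^'n^'m)"
  by (simp add: matrix_transpose_mul)

text \<open>Nonzero vectors in the span of the eigenvectors in \<open>?J\<close> have a form
  strictly below \<open>x \<bullet> x\<close>, while on the kernel of \<open>Y\<close> the form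
  equals \<open>x \<bullet> x\<close>. So \<open>Y\<close> is injective on that span, and its target
  has dimension \<open>CARD('k)\<close>.\<close>

lemma rank_card_bound:
  fixes G :: "real^'b^'a" and X :: "real^'k^'a" and Y :: "real^'b^'k"
    and u :: "'b \<Rightarrow> real^'b"
  assumes "G = X ** Y" "onf UNIV u" "\<And>j. resid T G *v u j = \<sigma> j *\<^sub>R u j"
  shows "card {j. \<sigma> j < 1} \<le> CARD('k)"
proof -
  let ?J = "{j. \<sigma> j < 1}"
  have J: "onf ?J u" using onf_subset[OF assms(2)] by simp
  have ker: "x = 0" if x: "x \<in> span (u ` ?J)" and "Y *v x = 0" for x
  proof -
    have "G *v x = 0" using that by (simp add: assms(1) matrix_vector_mul_assoc[symmetric])
    then have "x \<bullet> (resid T G *v x) = x \<bullet> x" by (simp add: resid_form)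
    then have "(\<Sum>j\<in>UNIV. \<sigma> j * (x \<bullet> u j) * (x \<bullet> u j)) = (\<Sum>j\<in>UNIV. (x \<bullet> u j) * (x \<bullet> u j))"
      using eigen_form(2)[OF assms(2,3)] onb_parseval[OF assms(2)] by metis
    then have s0: "(\<Sum>j\<in>UNIV. (1 - \<sigma> j) * (x \<bullet> u j)\<^sup>2) = 0"
      by (simp add: sum_subtractf algebra_simps power2_eq_square)
    have off: "x \<bullet> u j = 0" if "j \<notin> ?J" for j
    proof -
      have "x = (\<Sum>i\<in>?J. (x \<bullet> u i) *\<^sub>R u i)" by (rule onf_expand[OF J x]) simp
      then have "x \<bullet> u j = (\<Sum>i\<in>?J. (x \<bullet> u i) *\<^sub>R u i) \<bullet> u j" by (rule arg_cong)
      also have "\<dots> = (\<Sum>i\<in>?J. (x \<bullet> u i) * (u i \<bullet> u j))" by (simp add: inner_sum_left)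
      also have "\<dots> = 0" by (rule sum.neutral) (use that assms(2) in \<open>auto simp: onf_def\<close>)
      finally show ?thesis .
    qed
    have "\<forall>j\<in>UNIV. (1 - \<sigma> j) * (x \<bullet> u j)\<^sup>2 = 0"
    proof (subst sum_nonneg_eq_0_iff[symmetric])
      show "0 \<le> (1 - \<sigma> j) * (x \<bullet> u j)\<^sup>2" for j using off[of j] by (cases "j \<in> ?J") auto
    qed (use s0 in auto)
    then have z: "(1 - \<sigma> j) * (x \<bullet> u j)\<^sup>2 = 0" for j by blast
    have "x \<bullet> u j = 0" for j
    proof (cases "\<sigma> j < 1")
      case True
      then show ?thesis using z[of j] by auto
    qed (use off[of j] in simp)
    then show "x = 0" by (subst onb_expand[OF assms(2), of x]) simp
  qed
  have "card ?J = dim (span (u ` ?J))"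
    using onf_independent[OF J] onf_inj_on[OF J] by (simp add: card_image dim_eq_card_independent)
  also have "\<dots> = dim ((*v) Y ` span (u ` ?J))"
  proof (rule dim_image_eq[symmetric])
    show "linear ((*v) Y)" by (rule matrix_vector_mul_linear)
    show "inj_on ((*v) Y) (span (span (u ` ?J)))"
      unfolding span_span using ker
      by (subst linear_inj_on_iff_eq_0) auto
  qed
  also have "\<dots> \<le> DIM(real^'k)" by (rule dim_subset_UNIV)
  finally show ?thesis by simp
qed

text \<open>The difference of the two sides is a sum of three nonnegative slacks: eigenvalues above
  their individual lower bounds, Jensen gaps, and the loss from weights not concentrated on
  \<open>D\<close>. The equality statements come from the vanishing of the first two.\<close>

lemma reduced_rank_bound:
  fixes T G :: "real^'b^'a" and X :: "real^'k^'a" and Y :: "real^'b^'k"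
    and u v :: "'b \<Rightarrow> real^'b"
  assumes G: "G = X ** Y"
    and v: "onf UNIV v" "\<And>l. (transpose T ** T) *v v l = \<kappa> l *\<^sub>R v l" and \<kappa>1: "\<And>l. \<kappa> l < 1"
    and u: "onf UNIV u" "\<And>j. resid T G *v u j = \<sigma> j *\<^sub>R u j"
    and D: "card D = CARD('k)" "\<forall>i\<in>D. \<forall>j\<in>- D. \<kappa> j \<le> \<kappa> i"
  shows "(\<Sum>l\<in>D. ln (1 - \<kappa> l)) \<le> (\<Sum>j\<in>UNIV. ln (\<sigma> j))"
    and "(\<Sum>j\<in>UNIV. ln (\<sigma> j)) \<le> (\<Sum>l\<in>D. ln (1 - \<kappa> l)) \<Longrightarrow> 1 \<le> \<sigma> j \<Longrightarrow> \<sigma> j = 1"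
    and "(\<Sum>j\<in>UNIV. ln (\<sigma> j)) \<le> (\<Sum>l\<in>D. ln (1 - \<kappa> l)) \<Longrightarrow> \<sigma> j < 1 \<Longrightarrow> G *v u j = T *v u j"
    and "(\<Sum>j\<in>UNIV. ln (\<sigma> j)) \<le> (\<Sum>l\<in>D. ln (1 - \<kappa> l)) \<Longrightarrow> \<sigma> j < 1 \<Longrightarrow>
      (transpose T ** T) *v u j = (1 - \<sigma> j) *\<^sub>R u j"
proof -
  let ?J = "{j. \<sigma> j < 1}"
  \<comment> \<open>Squared overlaps of two orthonormal bases form a doubly stochastic array, and
    \<open>t j\<close> is the average of the \<open>\<kappa> l\<close> with weights
    \<open>w j l\<close>.\<close>
  define w where "w j l = (u j \<bullet> v l)\<^sup>2" for j l
  define t where "t j = (T *v u j) \<bullet> (T *v u j)" for j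
  have w0: "0 \<le> w j l" for j l by (simp add: w_def)
  have w1: "(\<Sum>l\<in>UNIV. w j l) = 1" for j
    using onb_parseval[OF v(1), of "u j" "u j"] onf_self[OF u(1), of j] by (simp add: w_def power2_eq_square)
  have w1': "(\<Sum>j\<in>UNIV. w j l) = 1" for l
    using onb_parseval[OF u(1), of "v l" "v l"] onf_self[OF v(1), of l]
    by (simp add: w_def power2_eq_square inner_commute)
  have \<kappa>0: "0 \<le> \<kappa> l" for l
    using eigen_value[OF v, of l] gram_form[of "v l" T "v l"] by (metis inner_ge_zero)
  have t: "t j = (\<Sum>l\<in>UNIV. w j l * \<kappa> l)" for j
    using eigen_form(2)[OF v, of "u j" "u j"]
    by (simp add: t_def gram_form w_def power2_eq_square mult.commute mult.left_commute)
  have m: "1 - t j = (\<Sum>l\<in>UNIV. w j l * (1 - \<kappa> l))" for j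
    using w1[of j] by (simp add: t algebra_simps sum_subtractf)
  note jensen = weighted_ln_le[OF finite w0 w1 _ m]
  have t1: "0 < 1 - t j" for j by (rule jensen(1)) (use \<kappa>1 in \<open>simp add: less_diff_eq\<close>)
  have b: "(\<Sum>l\<in>UNIV. w j l * ln (1 - \<kappa> l)) \<le> ln (1 - t j)" for j
    by (rule jensen(2)) (use \<kappa>1 in \<open>simp add: less_diff_eq\<close>)
  have \<sigma>: "\<sigma> j = 1 - t j + ((T - G) *v u j) \<bullet> ((T - G) *v u j)" for j
    using eigen_value[OF u, of j] resid_form'[of "u j" T G] onf_self[OF u(1), of j]
    by (simp add: t_def)
  then have \<sigma>t: "1 - t j \<le> \<sigma> j" for j by (metis inner_ge_zero le_add_same_cancel1)
  \<comment> \<open>\<open>a\<close> compares \<open>\<sigma> j\<close> with \<open>1 - t j\<close>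
    inside \<open>?J\<close> and with one outside; \<open>g\<close> is the Jensen gap.\<close>
  define a where "a j = (if \<sigma> j < 1 then ln (\<sigma> j) - ln (1 - t j) else ln (\<sigma> j))" for j
  define g where "g j = ln (1 - t j) - (\<Sum>l\<in>UNIV. w j l * ln (1 - \<kappa> l))" for j
  have a0: "0 \<le> a j" for j using t1[of j] \<sigma>t[of j] by (auto simp: a_def)
  have g0: "0 \<le> g j" for j using b by (simp add: g_def)
  have split: "(\<Sum>j\<in>UNIV. f j) = (\<Sum>j\<in>?J. f j) + (\<Sum>j\<in>-?J. f j)" for f :: "'b \<Rightarrow> real"
    using sum.union_disjoint[of ?J "-?J" f] by simp
  have "(\<Sum>j\<in>UNIV. ln (\<sigma> j)) = (\<Sum>j\<in>UNIV. a j) + (\<Sum>j\<in>?J. ln (1 - t j))"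
    unfolding split by (simp add: a_def sum_subtractf)
  also have "(\<Sum>j\<in>?J. ln (1 - t j)) = (\<Sum>j\<in>?J. g j) + (\<Sum>j\<in>?J. \<Sum>l\<in>UNIV. w j l * ln (1 - \<kappa> l))"
    by (simp add: g_def sum_subtractf)
  also have "(\<Sum>j\<in>?J. \<Sum>l\<in>UNIV. w j l * ln (1 - \<kappa> l)) = - (\<Sum>l\<in>UNIV. (\<Sum>j\<in>?J. w j l) * (- ln (1 - \<kappa> l)))"
    by (subst sum.swap) (simp add: sum_distrib_right sum_negf)
  finally have eq: "(\<Sum>j\<in>UNIV. ln (\<sigma> j)) = (\<Sum>j\<in>UNIV. a j) + ((\<Sum>j\<in>?J. g j)
    - (\<Sum>l\<in>UNIV. (\<Sum>j\<in>?J. w j l) * (- ln (1 - \<kappa> l))))" by simp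
  \<comment> \<open>Column sums bound the weight that each \<open>l\<close> receives from
    \<open>?J\<close> by one; row sums make the total weight \<open>card ?J\<close>, which the rank
    bounds.\<close>
  have top: "(\<Sum>l\<in>UNIV. (\<Sum>j\<in>?J. w j l) * (- ln (1 - \<kappa> l))) \<le> (\<Sum>l\<in>D. - ln (1 - \<kappa> l))"
  proof (rule top_weighted_sum_le)
    show "0 \<le> (\<Sum>j\<in>?J. w j l)" for l by (simp add: sum_nonneg w0)
    show "(\<Sum>j\<in>?J. w j l) \<le> 1" for l
      unfolding w1'[of l, symmetric] by (rule sum_mono2) (use w0 in auto)
    have "(\<Sum>l\<in>UNIV. \<Sum>j\<in>?J. w j l) = real (card ?J)"
      by (subst sum.swap) (simp add: w1)
    also have "\<dots> \<le> real (card D)" using rank_card_bound[OF G u] D(1) by simp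
    finally show "(\<Sum>l\<in>UNIV. \<Sum>j\<in>?J. w j l) \<le> real (card D)" .
    show "0 \<le> - ln (1 - \<kappa> l)" for l using \<kappa>0[of l] \<kappa>1[of l] by simp
    show "- ln (1 - \<kappa> j) \<le> - ln (1 - \<kappa> i)" if "i \<in> D" "j \<notin> D" for i j
      using D(2) that \<kappa>1[of i] \<kappa>1[of j] by simp
  qed
  have A0: "0 \<le> (\<Sum>j\<in>UNIV. a j)" "0 \<le> (\<Sum>j\<in>?J. g j)" by (simp_all add: sum_nonneg a0 g0)
  show "(\<Sum>l\<in>D. ln (1 - \<kappa> l)) \<le> (\<Sum>j\<in>UNIV. ln (\<sigma> j))"
    using eq top A0 by (simp add: sum_negf)
  { assume "(\<Sum>j\<in>UNIV. ln (\<sigma> j)) \<le> (\<Sum>l\<in>D. ln (1 - \<kappa> l))"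
    then have "(\<Sum>j\<in>UNIV. a j) = 0" "(\<Sum>j\<in>?J. g j) = 0"
      using eq top A0 by (simp_all add: sum_negf)
    then have az: "a j = 0" and gz: "\<sigma> j < 1 \<Longrightarrow> g j = 0" for j
      using sum_nonneg_eq_0_iff[of UNIV a] sum_nonneg_eq_0_iff[of ?J g] a0 g0 by auto
    show "\<sigma> j = 1" if "1 \<le> \<sigma> j"
      using az[of j] that by (simp add: a_def)
    have st: "\<sigma> j = 1 - t j" if "\<sigma> j < 1"
      using az[of j] that t1[of j] \<sigma>t[of j] by (simp add: a_def)
    show "G *v u j = T *v u j" if "\<sigma> j < 1"
      using st[OF that] \<sigma>[of j] by (simp add: matrix_vector_mult_diff_rdistrib)
    show "(transpose T ** T) *v u j = (1 - \<sigma> j) *\<^sub>R u j" if j: "\<sigma> j < 1"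
    proof -
      have "ln (1 - t j) \<le> (\<Sum>l\<in>UNIV. w j l * ln (1 - \<kappa> l))" using gz[OF j] by (simp add: g_def)
      then have "w j l = 0 \<or> 1 - \<kappa> l = 1 - t j" for l
        using jensen(3)[of j l] \<kappa>1 by (simp add: less_diff_eq)
      \<comment> \<open>Equality in Jensen lets \<open>u j\<close> overlap only with eigenvectors of
        the single value \<open>t j\<close>, so it is an eigenvector itself.\<close>
      then have *: "\<kappa> l * (u j \<bullet> v l) = t j * (u j \<bullet> v l)" for l by (cases "u j \<bullet> v l = 0") (auto simp: w_def)
      have "(transpose T ** T) *v u j = (\<Sum>l\<in>UNIV. (t j * (u j \<bullet> v l)) *\<^sub>R v l)"
        unfolding eigen_form(1)[OF v, of "u j"] * ..
      also have "\<dots> = t j *\<^sub>R (\<Sum>l\<in>UNIV. (u j \<bullet> v l) *\<^sub>R v l)"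
        by (simp add: scaleR_sum_right)
      also have "\<dots> = t j *\<^sub>R u j" by (simp only: onb_expand[OF v(1), of "u j", symmetric])
      finally show ?thesis using st[OF j] by simp
    qed }
qed

lemma exists_top_set:
  fixes \<kappa> :: "'b::finite \<Rightarrow> real"
  assumes "k \<le> CARD('b)"
  shows "\<exists>D. card D = k \<and> (\<forall>i\<in>D. \<forall>j\<in>- D. \<kappa> j \<le> \<kappa> i)"
  using assms
proof (induction k)
  case 0
  then show ?case by (intro exI[of _ "{}"]) simp
next
  case (Suc k)
  then obtain D where D: "card D = k" "\<forall>i\<in>D. \<forall>j\<in>- D. \<kappa> j \<le> \<kappa> i" by auto
  have "- D \<noteq> {}"
  proof
    assume "- D = {}"
    then have "D = UNIV" by auto
    then show False using D(1) Suc.prems by simp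
  qed
  then have "Max (\<kappa> ` (- D)) \<in> \<kappa> ` (- D)" by (intro Max_in) auto
  then obtain m where m: "m \<notin> D" "\<kappa> m = Max (\<kappa> ` (- D))" by auto
  have "\<kappa> j \<le> \<kappa> m" if "j \<notin> D" for j using that m(2) by simp
  then show ?case using D m(1) by (intro exI[of _ "insert m D"]) auto
qed

text \<open>The bound's equality case gives agreement of \<open>G\<close> with \<open>T\<close> on
  residual eigenvectors below one; it remains that \<open>G\<close> vanishes on the others. The
  hypothesis \<open>least\<close> ranges over all eigenbases because the one used here depends on
  \<open>G\<close>, and over smaller \<open>D\<close> because the rank of \<open>T\<close> may be
  below \<open>CARD('k)\<close>.\<close>

lemma reduced_rank_optimum:
  fixes T G :: "real^'b^'a" and X :: "real^'k^'a" and Y :: "real^'b^'k"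
  assumes G: "G = X ** Y" and k: "CARD('k) \<le> CARD('b)"
    and strict: "\<forall>x. x \<noteq> 0 \<longrightarrow> (T *v x) \<bullet> (T *v x) < x \<bullet> x"
    and least: "\<forall>(v :: 'b \<Rightarrow> real^'b) \<kappa> D.
      onf UNIV v \<and> (\<forall>l. (transpose T ** T) *v v l = \<kappa> l *\<^sub>R v l) \<and> card D \<le> CARD('k) \<longrightarrow>
      ln (det (resid T G)) \<le> (\<Sum>l\<in>D. ln (1 - \<kappa> l))"
  shows "\<exists>(v :: 'b \<Rightarrow> real^'b) \<kappa> D. onf UNIV v \<and> (\<forall>l. (transpose T ** T) *v v l = \<kappa> l *\<^sub>R v l) \<and>
    card D \<le> CARD('k) \<and> (\<forall>l\<in>D. 0 < \<kappa> l) \<and> (\<forall>i\<in>D. \<forall>j\<in>- D. \<kappa> j \<le> \<kappa> i) \<and>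
    (card D < CARD('k) \<longrightarrow> (\<forall>l\<in>- D. \<kappa> l = 0)) \<and>
    (\<forall>l. G *v v l = (if l \<in> D then T *v v l else 0)) \<and>
    ln (det (resid T G)) = (\<Sum>l\<in>D. ln (1 - \<kappa> l))"
proof -
  note contr = strict[rule_format]
  have opt: "ln (det (resid T G)) \<le> (\<Sum>l\<in>D. ln (1 - \<kappa> l))"
    if "onf UNIV (v :: 'b \<Rightarrow> real^'b)" "\<And>l. (transpose T ** T) *v v l = \<kappa> l *\<^sub>R v l" "card D \<le> CARD('k)"
    for v \<kappa> D using least that by blast
  have R: "pd (resid T G)"
    unfolding pd_def using resid_sym contr
    by (auto simp: resid_form' intro!: add_pos_nonneg)
  obtain u \<sigma> where u: "onf UNIV (u :: 'b \<Rightarrow> real^'b)" "\<And>j. resid T G *v u j = \<sigma> j *\<^sub>R u j"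
    using sym_eigenbasis[OF resid_sym] by metis
  have \<sigma>0: "0 < \<sigma> j" for j by (rule pd_eigenvalue[OF R u])
  have ldet: "ln (det (resid T G)) = (\<Sum>j\<in>UNIV. ln (\<sigma> j))"
    unfolding trace_det_eigenbasis(2)[OF u]
    by (rule ln_prod) (use \<sigma>0 in \<open>auto simp: less_imp_neq[symmetric]\<close>)
  let ?J = "{j. \<sigma> j < 1}"
  have \<kappa>1: "0 \<le> \<kappa> l" "\<kappa> l < 1" if v: "onf UNIV (v :: 'b \<Rightarrow> real^'b)" "\<And>l. (transpose T ** T) *v v l = \<kappa> l *\<^sub>R v l"
    for v \<kappa> l
  proof -
    have *: "\<kappa> l = (T *v v l) \<bullet> (T *v v l)" using eigen_value[OF v, of l] gram_form by metis
    then show "0 \<le> \<kappa> l" by simp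
    have "v l \<noteq> 0" using onf_self[OF v(1), of l] by auto
    then show "\<kappa> l < 1" using contr[of "v l"] onf_self[OF v(1), of l] * by simp
  qed
  obtain v0 \<kappa>0 where v0: "onf UNIV (v0 :: 'b \<Rightarrow> real^'b)" "\<And>l. (transpose T ** T) *v v0 l = \<kappa>0 l *\<^sub>R v0 l"
    using sym_eigenbasis[OF gram_sym] by metis
  obtain D0 where D0: "card D0 = CARD('k)" "\<forall>i\<in>D0. \<forall>j\<in>- D0. \<kappa>0 j \<le> \<kappa>0 i"
    using exists_top_set[OF k, of \<kappa>0] by blast
  have "(\<Sum>j\<in>UNIV. ln (\<sigma> j)) \<le> (\<Sum>l\<in>D0. ln (1 - \<kappa>0 l))"
    using opt[OF v0, of D0] D0(1) ldet by simp
  note eq = reduced_rank_bound(2-4)[OF G v0 \<kappa>1(2)[OF v0] u D0 this]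
  \<comment> \<open>The basis \<open>v0\<close> served only for the equality case; this one contains
    the residual eigenvectors below one.\<close>
  obtain v \<kappa> where v: "onf UNIV (v :: 'b \<Rightarrow> real^'b)" "\<And>l. (transpose T ** T) *v v l = \<kappa> l *\<^sub>R v l"
    and uv: "u ` ?J \<subseteq> range v"
    using sym_eigenbasis_extend[OF gram_sym, of ?J u T] onf_subset[OF u(1)] eq(3) by blast
  define D where "D = {l. v l \<in> u ` ?J}"
  have bij: "bij_betw v D (u ` ?J)"
  proof -
    have "inj_on v D" using onf_inj_on[OF v(1)] by (rule inj_on_subset) simp
    moreover have "v ` D = u ` ?J"
    proof
      show "v ` D \<subseteq> u ` ?J" by (auto simp: D_def)
      show "u ` ?J \<subseteq> v ` D"
      proof
        fix x assume x: "x \<in> u ` ?J"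
        then obtain l where l: "x = v l" using uv by blast
        then have "l \<in> D" using x by (simp add: D_def)
        then show "x \<in> v ` D" using l by blast
      qed
    qed
    ultimately show ?thesis by (simp add: bij_betw_def)
  qed
  have cardD: "card D = card ?J"
    using bij_betw_same_card[OF bij] onf_inj_on[OF u(1)] by (metis card_image inj_on_subset subset_UNIV)
  have cardk: "card D \<le> CARD('k)" using cardD rank_card_bound[OF G u] by simp
  have \<kappa>\<sigma>: "\<kappa> l = 1 - \<sigma> j" if "v l = u j" "\<sigma> j < 1" for l j
    using eq(3)[OF that(2)] v(2)[of l] that(1) onf_self[OF u(1), of j]
    by (metis UNIV_I inner_scaleR_left mult.right_neutral)
  have pos: "0 < \<kappa> l" if "l \<in> D" for l
    using that \<kappa>\<sigma>[of l] by (auto simp: D_def)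
  have sumD: "(\<Sum>j\<in>UNIV. ln (\<sigma> j)) = (\<Sum>l\<in>D. ln (1 - \<kappa> l))"
  proof -
    have "(\<Sum>j\<in>UNIV. ln (\<sigma> j)) = (\<Sum>j\<in>?J. ln (\<sigma> j))"
      by (rule sum.mono_neutral_right) (use eq(1) in \<open>auto simp: not_less\<close>)
    also have "\<dots> = (\<Sum>j\<in>?J. ln (1 - u j \<bullet> ((transpose T ** T) *v u j)))"
      by (rule sum.cong) (simp_all add: eq(3) onf_self[OF u(1)])
    also have "\<dots> = (\<Sum>y\<in>u ` ?J. ln (1 - y \<bullet> ((transpose T ** T) *v y)))"
      by (subst sum.reindex[OF onf_inj_on[OF onf_subset[OF u(1)]]]) simp_all
    also have "\<dots> = (\<Sum>l\<in>D. ln (1 - v l \<bullet> ((transpose T ** T) *v v l)))"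
      by (rule sum.reindex_bij_betw[OF bij, symmetric])
    also have "\<dots> = (\<Sum>l\<in>D. ln (1 - \<kappa> l))"
      by (simp add: eigen_value[OF v])
    finally show ?thesis .
  qed
  have opt': "(\<Sum>l\<in>D. ln (1 - \<kappa> l)) \<le> (\<Sum>l\<in>D'. ln (1 - \<kappa> l))" if "card D' \<le> CARD('k)" for D'
    using opt[OF v that] ldet sumD by simp
  \<comment> \<open>Exchange \<open>i\<close> for \<open>j\<close> in \<open>D\<close>: the
    truncation obtained cannot be better.\<close>
  have top: "\<kappa> j \<le> \<kappa> i" if "i \<in> D" "j \<notin> D" for i j
  proof -
    have "card (insert j (D - {i})) \<le> CARD('k)" using that cardk card_Suc_Diff1[of D i] by simp
    from opt'[OF this] have "ln (1 - \<kappa> i) \<le> ln (1 - \<kappa> j)"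
      using that sum.remove[of D i "\<lambda>l. ln (1 - \<kappa> l)"] by simp
    then show ?thesis using \<kappa>1[OF v, of i] \<kappa>1[OF v, of j] by simp
  qed
  \<comment> \<open>If there is room for another index, adding a positive \<open>\<kappa> l\<close>
    would be an improvement.\<close>
  have zero: "\<kappa> l = 0" if "card D < CARD('k)" "l \<notin> D" for l
  proof -
    have "card (insert l D) \<le> CARD('k)" using that by simp
    from opt'[OF this] have "0 \<le> ln (1 - \<kappa> l)" using that by simp
    then show ?thesis using \<kappa>1[OF v, of l] by simp
  qed
  have inD: "G *v v l = T *v v l" if "l \<in> D" for l
    using that eq(2) by (auto simp: D_def)
  have offJ: "G *v u j = 0" if j: "\<not> \<sigma> j < 1" for j
  proof -
    have orth: "u j \<bullet> v l = 0" if "l \<in> D" for l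
      using that j u(1) by (auto simp: D_def onf_def)
    \<comment> \<open>Eigenvalue one equates the squared length of \<open>G *v u j\<close> with
      twice its product with \<open>T *v u j\<close>, so orthogonality of these two vectors
      suffices.\<close>
    have "u j \<bullet> u j = u j \<bullet> (resid T G *v u j)" using eq(1)[of j] j by (simp add: u(2) not_less)
    then have s: "(G *v u j) \<bullet> (G *v u j) = 2 * ((T *v u j) \<bullet> (G *v u j))"
      by (simp add: resid_form)
    have "(T *v u j) \<bullet> (G *v u j) = 0"
    \<comment> \<open>If \<open>D\<close> is short, \<open>T *v u j\<close> is zero. Otherwise
      \<open>Y\<close> maps the span of the \<open>v l\<close> with \<open>l \<in> D\<close> onto
      the whole latent space, so the range of \<open>G\<close> is spanned by the
      \<open>T *v v l\<close>, all orthogonal to \<open>T *v u j\<close>.\<close>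
    proof (cases "card D < CARD('k)")
      case True
      have *: "\<kappa> l * (u j \<bullet> v l) = 0" for l using zero[OF True, of l] orth[of l] by (cases "l \<in> D") auto
      have "(T *v u j) \<bullet> (T *v u j) = 0"
        unfolding gram_form[symmetric] eigen_form(2)[OF v] * by simp
      then show ?thesis by simp
    next
      case False
      have "span ((\<lambda>l. Y *v v l) ` D) = UNIV"
      proof -
        have inj: "x = 0" if x: "x \<in> span (v ` D)" "Y *v x = 0" for x
        proof -
          have D: "onf D v" using onf_subset[OF v(1)] by simp
          have e: "x = (\<Sum>i\<in>D. (x \<bullet> v i) *\<^sub>R v i)" by (rule onf_expand[OF D x(1)]) simp
          have "T *v x = G *v x"
            by (subst (1 2) e) (simp add: matrix_vec_sum matrix_vector_mult_scaleR inD)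
          also have "\<dots> = 0" using x(2) by (simp add: G matrix_vector_mul_assoc[symmetric])
          finally have "x \<bullet> ((transpose T ** T) *v x) = 0" by (simp add: gram_form)
          then have s0: "(\<Sum>l\<in>UNIV. \<kappa> l * (x \<bullet> v l) * (x \<bullet> v l)) = 0"
            using eigen_form(2)[OF v, of x x] by simp
          have "\<forall>l\<in>UNIV. \<kappa> l * (x \<bullet> v l) * (x \<bullet> v l) = 0"
            by (subst sum_nonneg_eq_0_iff[symmetric]) (use s0 \<kappa>1[OF v] in \<open>auto simp: mult.assoc\<close>)
          then have "x \<bullet> v l = 0" if "l \<in> D" for l
            using pos[OF that] by (metis UNIV_I less_irrefl mult_eq_0_iff)
          then show "x = 0" by (subst e) simp
        qed
        have "dim ((*v) Y ` span (v ` D)) = dim (span (v ` D))"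
        proof (rule dim_image_eq)
          show "inj_on ((*v) Y) (span (span (v ` D)))"
            unfolding span_span using inj by (subst linear_inj_on_iff_eq_0) auto
        qed simp
        also have "\<dots> = card D"
          using onf_independent[OF onf_subset[OF v(1), of D]] onf_inj_on[OF onf_subset[OF v(1), of D]]
          by (simp add: card_image dim_eq_card_independent)
        finally have "dim (span ((*v) Y ` v ` D)) = DIM(real^'k)"
          using False cardk by (simp add: linear_span_image[symmetric])
        then show ?thesis by (metis dim_eq_full dim_span image_image span_span)
      qed
      then have "Y *v u j \<in> span ((\<lambda>l. Y *v v l) ` D)" by simp
      then have "X *v (Y *v u j) \<in> span ((*v) X ` (\<lambda>l. Y *v v l) ` D)"
        by (subst linear_span_image) auto
      also have "(*v) X ` (\<lambda>l. Y *v v l) ` D = (\<lambda>l. T *v v l) ` D"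
        unfolding image_image by (rule image_cong) (simp_all add: inD[symmetric] G matrix_vector_mul_assoc)
      finally have "G *v u j \<in> span ((\<lambda>l. T *v v l) ` D)" by (simp add: G matrix_vector_mul_assoc)
      moreover have "(T *v u j) \<bullet> y = 0" if "y \<in> (\<lambda>l. T *v v l) ` D" for y
        using that orth by (auto simp: gram_form[symmetric] v(2))
      ultimately show ?thesis
        by (metis orthogonal_def orthogonal_to_span)
    qed
    then show ?thesis using s by simp
  qed
  have outD: "G *v v l = 0" if "l \<notin> D" for l
  proof -
    have z: "(v l \<bullet> u j) *\<^sub>R (G *v u j) = 0" for j
    proof (cases "\<sigma> j < 1")
      case True
      then have "u j \<in> u ` ?J" by blast
      then obtain l' where "u j = v l'" "l' \<in> D" using bij by (auto simp: bij_betw_def)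
      then show ?thesis using that v(1) by (auto simp: onf_def)
    qed (simp add: offJ)
    show ?thesis
      by (subst onb_expand[OF u(1), of "v l"])
         (simp only: matrix_vec_sum matrix_vector_mult_scaleR z sum.neutral_const)
  qed
  show ?thesis
    by (rule exI[of _ v], rule exI[of _ \<kappa>], rule exI[of _ D])
       (use v cardk pos top zero inD outD ldet sumD in auto)
qed

section \<open>Block matrices\<close>

lemma stack_nth [simp]: "stack x y $ Inl a = x $ a" "stack x y $ Inr b = y $ b"
  by (simp_all add: stack_def)

lemma sum_UNIV_Plus: "(\<Sum>i\<in>UNIV. f i) = (\<Sum>a\<in>UNIV. f (Inl a)) + (\<Sum>b\<in>UNIV. f (Inr b))"
  for f :: "'a::finite + 'b::finite \<Rightarrow> 'c::comm_monoid_add"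
  unfolding UNIV_Plus_UNIV[symmetric] by (subst sum.Plus) auto

lemma prod_UNIV_Plus: "(\<Prod>i\<in>UNIV. f i) = (\<Prod>a\<in>UNIV. f (Inl a)) * (\<Prod>b\<in>UNIV. f (Inr b))"
  for f :: "'a::finite + 'b::finite \<Rightarrow> 'c::comm_monoid_mult"
  unfolding UNIV_Plus_UNIV[symmetric] by (subst prod.Plus) auto

lemma vec_sum_eqI: "(\<And>a. x $ Inl a = y $ Inl a) \<Longrightarrow> (\<And>b. x $ Inr b = y $ Inr b) \<Longrightarrow> x = y"
  for x y :: "'c^('a::finite + 'b::finite)"
  unfolding vec_eq_iff by (metis sum.exhaust)

lemma stack_cases:
  fixes z :: "'c^('a::finite + 'b::finite)"
  obtains x y where "z = stack x y"
  using that[of "\<chi> a. z $ Inl a" "\<chi> b. z $ Inr b"] by (simp add: vec_sum_eqI)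

lemma inner_stack [simp]: "stack x y \<bullet> stack x' y' = x \<bullet> x' + y \<bullet> (y' :: real^'b)"
  for x :: "real^'a"
  by (simp add: inner_vec_def sum_UNIV_Plus)

lemma stack_diff [simp]: "stack x y - stack x' y' = stack (x - x') (y - (y' :: real^'b))"
  by (rule vec_sum_eqI) simp_all

lemma stack_scaleR [simp]: "c *\<^sub>R stack x y = stack (c *\<^sub>R x) (c *\<^sub>R (y :: real^'b))"
  by (rule vec_sum_eqI) simp_all

lemma stack_eq_iff [simp]: "stack x y = stack x' y' \<longleftrightarrow> x = x' \<and> y = y'"
  by (metis stack_nth vec_eq_iff)

lemma stack_zero [simp]: "stack x y = 0 \<longleftrightarrow> x = 0 \<and> y = (0 :: real^'b)"
  for x :: "real^'a"
proof -
  have "stack 0 0 = (0 :: real^('a + 'b))" by (rule vec_sum_eqI) simp_all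
  then show ?thesis by (metis stack_eq_iff)
qed

section \<open>Two-by-two block matrices and Schur complements\<close>

definition blk :: "real^'a^'a \<Rightarrow> real^'b^'a \<Rightarrow> real^'a^'b \<Rightarrow> real^'b^'b \<Rightarrow> real^('a + 'b)^('a + 'b)" where
  "blk A K K' B = stack (\<chi> a. stack (A $ a) (K $ a)) (\<chi> b. stack (K' $ b) (B $ b))"

lemma blk_vec [simp]: "blk A K K' B *v stack x y = stack (A *v x + K *v y) (K' *v x + B *v y)"
  by (rule vec_sum_eqI) (simp_all add: blk_def matrix_vector_mult_def sum_UNIV_Plus)

lemma blk_eqI:
  fixes M :: "real^('a::finite + 'b::finite)^('a + 'b)"
  assumes "\<And>x y. M *v stack x y = stack (A *v x + K *v y) (K' *v x + B *v y)"
  shows "M = blk A K K' B"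
  by (rule mat_eqI) (metis assms blk_vec stack_cases)

lemma transpose_blk: "transpose (blk A K K' B) = blk (transpose A) (transpose K') (transpose K) (transpose B)"
  by (intro vec_sum_eqI) (simp_all add: blk_def transpose_def)

lemma blk_eq_iff: "blk A K K' B = blk C L L' D \<longleftrightarrow> A = C \<and> K = L \<and> K' = L' \<and> B = D"
proof
  assume eq: "blk A K K' B = blk C L L' D"
  have "stack (A *v x + K *v y) (K' *v x + B *v y) = stack (C *v x + L *v y) (L' *v x + D *v y)" for x y
    unfolding blk_vec[symmetric] eq ..
  from this[of _ 0] this[of 0] show "A = C \<and> K = L \<and> K' = L' \<and> B = D"
    by (auto intro!: mat_eqI)
qed simp

lemma blk_one: "mat 1 = blk (mat 1) 0 0 (mat 1)"
  by (rule blk_eqI) simp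

lemma matrix_mult_eqI:
  assumes "\<And>x. A *v (B *v x) = C *v x" shows "A ** B = (C :: real^'n^'m)"
  by (rule mat_eqI) (simp add: matrix_vector_mul_assoc[symmetric] assms)

lemma marginal_cov_blk:
  "marginal_cov \<theta> = blk (load1 \<theta> ** transpose (load1 \<theta>) + noise_cov1 \<theta>) (load1 \<theta> ** transpose (load2 \<theta>))
     (load2 \<theta> ** transpose (load1 \<theta>)) (load2 \<theta> ** transpose (load2 \<theta>) + noise_cov2 \<theta>)"
  by (intro vec_sum_eqI)
     (simp_all add: marginal_cov_def Let_def block_diag_def blk_def matrix_matrix_mult_def transpose_def)

lemma matrix_vector_mult_uminus: "A *v (- x) = - (A *v (x :: real^'n))"
  by (metis scaleR_minus1_left matrix_vector_mult_scaleR)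

lemma transpose_zero: "transpose (0 :: real^'n^'m) = 0"
  by (simp add: transpose_def vec_eq_iff)

lemma transpose_scaleR: "transpose (c *\<^sub>R A) = c *\<^sub>R transpose (A :: real^'n^'m)"
  by (simp add: transpose_def vec_eq_iff)

text \<open>Eigenbases of the blocks, padded with zeros, form an eigenbasis of the whole; symmetry
  of the blocks provides them.\<close>

lemma det_blk_diag:
  fixes A :: "real^'a^'a" and B :: "real^'b^'b"
  assumes "transpose A = A" "transpose B = B"
  shows "det (blk A 0 0 B) = det A * det B"
proof -
  obtain v \<kappa> where v: "onf UNIV (v :: 'a \<Rightarrow> real^'a)" "\<And>i. A *v v i = \<kappa> i *\<^sub>R v i"
    using sym_eigenbasis[OF assms(1)] by metis
  obtain w \<mu> where w: "onf UNIV (w :: 'b \<Rightarrow> real^'b)" "\<And>i. B *v w i = \<mu> i *\<^sub>R w i"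
    using sym_eigenbasis[OF assms(2)] by metis
  define u :: "'a + 'b \<Rightarrow> real^('a + 'b)" where
    "u = case_sum (\<lambda>i. stack (v i) 0) (\<lambda>j. stack 0 (w j))"
  define \<nu> where "\<nu> = case_sum \<kappa> \<mu>"
  have u: "onf UNIV u"
    using v(1) w(1) by (auto simp: onf_def u_def split: sum.split)
  have "blk A 0 0 B *v u i = \<nu> i *\<^sub>R u i" for i
    by (cases i) (simp_all add: u_def \<nu>_def v(2) w(2))
  from trace_det_eigenbasis(2)[OF u this] show ?thesis
    by (simp add: prod_UNIV_Plus \<nu>_def trace_det_eigenbasis(2)[OF v] trace_det_eigenbasis(2)[OF w])
qed

text \<open>Conjugation by the involution \<open>diag(1, -1)\<close> inverts a unitriangular block matrix.\<close>

lemma det_blk_unitriangular: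
  fixes G :: "real^'a^'b"
  shows "(det (blk (mat 1) 0 G (mat 1 :: real^'b^'b)))\<^sup>2 = 1"
proof -
  let ?L = "blk (mat 1) 0 G (mat 1)" and ?J = "blk (mat 1) 0 0 (- mat 1 :: real^'b^'b) :: real^('a + 'b)^('a + 'b)"
  have neg: "(- mat 1) *v (y :: real^'b) = - y" for y
    by (metis matrix_vector_mul_lid scaleR_matrix_vec scaleR_minus1_left)
  have m: "(?J ** ?L) ** (?J ** ?L) = mat 1" "?J ** ?J = mat 1"
    unfolding blk_one by (rule blk_eqI, simp add: matrix_vector_mul_assoc[symmetric] neg matrix_vector_right_distrib
      matrix_vector_mult_uminus)+
  then have "det ((?J ** ?L) ** (?J ** ?L)) = 1" "det (?J ** ?J) = 1" by simp_all
  then have "(det ?J * det ?J) * (det ?L * det ?L) = 1" "det ?J * det ?J = 1"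
    by (simp_all only: det_mul mult_ac)
  then show ?thesis by (simp only: power2_eq_square mult_1)
qed

text \<open>The block matrix is a unitriangular congruence of \<open>blk A 0 0 E\<close>. The
  determinant of the triangular factor enters squared, so its sign is immaterial.\<close>

lemma det_blk_schur:
  fixes A :: "real^'a^'a" and B :: "real^'b^'b" and G :: "real^'b^'a"
  assumes A: "transpose A = A" and E: "transpose E = E" "B = E + transpose G ** A ** G"
  shows "det (blk A (A ** G) (transpose G ** A) B) = det A * det E"
proof -
  let ?L = "blk (mat 1) 0 (transpose G) (mat 1)"
  have "blk A (A ** G) (transpose G ** A) B = ?L ** blk A 0 0 E ** transpose ?L"
    by (rule blk_eqI[symmetric])
       (simp add: transpose_blk transpose_zero transpose_mat matrix_vector_mul_assoc[symmetric] E
         matrix_vector_right_distrib matrix_vector_mult_add_rdistrib algebra_simps)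
  then have "det (blk A (A ** G) (transpose G ** A) B) = (det ?L)\<^sup>2 * det (blk A 0 0 E)"
    by (simp add: det_mul det_transpose power2_eq_square)
  then show ?thesis using det_blk_diag[OF A E(1)] det_blk_unitriangular[of "transpose G"] by simp
qed

lemma pd_blk_schur:
  fixes A :: "real^'a^'a" and B :: "real^'b^'b" and K :: "real^'b^'a"
  assumes C: "pd (blk A K (transpose K) B)"
  shows "pd A" "pd (B - transpose K ** matrix_inv A ** K)"
proof -
  let ?C = "blk A K (transpose K) B"
  have sym: "transpose A = A" "transpose B = B"
    using pd_sym[OF C] by (auto simp: transpose_blk blk_eq_iff)
  have pos: "0 < z \<bullet> (?C *v z)" if "z \<noteq> 0" for z using C that by (simp add: pd_def)
  have "0 < x \<bullet> (A *v x)" if "x \<noteq> 0" for x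
    using pos[of "stack x 0"] that by simp
  then show A: "pd A" using sym by (simp add: pd_def)
  note inv = pd_invertible[OF A]
  have "0 < y \<bullet> ((B - transpose K ** matrix_inv A ** K) *v y)" if "y \<noteq> 0" for y
  proof -
    \<comment> \<open>The minimizer of the block form for fixed \<open>y\<close>: it annihilates the
      first block and leaves the Schur complement.\<close>
    let ?x = "- (matrix_inv A *v (K *v y))"
    have "A *v ?x + K *v y = 0"
      by (simp add: matrix_vector_mult_uminus inv_vec_cancel[OF inv])
    moreover have "transpose K *v ?x + B *v y = (B - transpose K ** matrix_inv A ** K) *v y"
      by (simp add: matrix_vector_mult_uminus matrix_vector_mult_diff_rdistrib matrix_vector_mul_assoc
        matrix_mul_assoc)
    ultimately show ?thesis using pos[of "stack ?x y"] that by simp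
  qed
  then show "pd (B - transpose K ** matrix_inv A ** K)"
    using sym transpose_matrix_inv[OF inv sym(1)]
    by (simp add: pd_def transpose_diff matrix_transpose_mul matrix_mul_assoc)
qed

text \<open>The exponent of a joint Gaussian density as that of the marginal of \<open>x\<close>
  plus that of \<open>y\<close> given \<open>x\<close>, where \<open>transpose G\<close> is the
  regression matrix and \<open>E\<close> the conditional covariance. The vector \<open>?w\<close>
  solves the block system explicitly.\<close>

lemma inverse_form_blk:
  fixes A :: "real^'a^'a" and B :: "real^'b^'b" and G :: "real^'b^'a"
  assumes "invertible A" "transpose A = A" "invertible E" "B = E + transpose G ** A ** G"
    and C: "C = blk A (A ** G) (transpose G ** A) B" "invertible C"
  shows "stack x y \<bullet> (matrix_inv C *v stack x y) =
    x \<bullet> (matrix_inv A *v x) + (y - transpose G *v x) \<bullet> (matrix_inv E *v (y - transpose G *v x))"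
proof -
  let ?e = "matrix_inv E *v (y - transpose G *v x)"
  let ?w = "stack (matrix_inv A *v x - G *v ?e) ?e"
  have "C *v ?w = stack x y"
    by (simp add: C(1) assms(4) matrix_vector_mul_assoc[symmetric] matrix_vector_mult_diff_distrib
      matrix_vector_mult_add_rdistrib inv_vec_cancel[OF assms(1)] inv_vec_cancel[OF assms(3)])
  then have "matrix_inv C *v stack x y = ?w" using inv_vec_cancel(2)[OF C(2)] by metis
  then show ?thesis
    by (simp add: inner_diff_left inner_diff_right inner_matrix_vector[of x G])
qed

section \<open>Sample statistics\<close>

lemma trace_mult_outer: "trace (M ** outer u v) = v \<bullet> (M *v (u :: real^'n))"
proof -
  have "trace (M ** outer u v) = (\<Sum>i\<in>UNIV. (\<Sum>k\<in>UNIV. M $ i $ k * u $ k) * v $ i)"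
    by (simp add: trace_def matrix_matrix_mult_def outer_def sum_distrib_right mult.assoc)
  also have "\<dots> = v \<bullet> (M *v u)" by (simp add: inner_vec_def matrix_vector_mult_def mult.commute)
  finally show ?thesis .
qed

lemma matrix_mult_sum: "M ** (\<Sum>i\<in>I. f i) = (\<Sum>i\<in>I. M ** (f i :: real^'n^'m))"
  by (rule matrix_mult_eqI) (simp add: sum_matrix_vec matrix_vec_sum matrix_vector_mul_assoc)

lemma matrix_mult_scaleR: "M ** (c *\<^sub>R A) = c *\<^sub>R (M ** (A :: real^'n^'m))"
  by (rule matrix_mult_eqI) (simp add: scaleR_matrix_vec matrix_vector_mult_scaleR matrix_vector_mul_assoc)

lemma trace_sum: "trace (\<Sum>i\<in>I. f i :: real^'n^'n) = (\<Sum>i\<in>I. trace (f i))"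
  by (simp add: trace_def, rule sum.swap)

lemma trace_scaleR: "trace (c *\<^sub>R A :: real^'n^'n) = c * trace A"
  by (simp add: trace_def sum_distrib_left)

lemma sum_centered:
  assumes "0 < n" shows "(\<Sum>i<n. x i - sample_mean n x) = 0"
  using assms by (simp add: sum_subtractf sample_mean_def sum_constant_scaleR del: sum_constant)

text \<open>The cross terms around the sample mean sum to zero; hence the data enter a Gaussian
  likelihood only through sample mean and covariance.\<close>

lemma sum_quadratic_sample:
  fixes x :: "nat \<Rightarrow> real^'n"
  assumes n: "0 < n" and M: "transpose M = M"
  shows "(\<Sum>i<n. (x i - m) \<bullet> (M *v (x i - m))) =
    real n * (trace (M ** sample_cov n x) + (sample_mean n x - m) \<bullet> (M *v (sample_mean n x - m)))"
proof -
  let ?c = "sample_mean n x" and ?d = "sample_mean n x - m"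
  have t: "real n * trace (M ** sample_cov n x) = (\<Sum>i<n. (x i - ?c) \<bullet> (M *v (x i - ?c)))"
    using n by (simp add: sample_cov_def sample_cross_cov_def matrix_mult_scaleR matrix_mult_sum trace_scaleR
       trace_sum trace_mult_outer)
  have e: "(x i - m) \<bullet> (M *v (x i - m)) = (x i - ?c) \<bullet> (M *v (x i - ?c)) + 2 * ((x i - ?c) \<bullet> (M *v ?d))
    + ?d \<bullet> (M *v ?d)" for i
  proof -
    have "x i - m = (x i - ?c) + ?d" by simp
    moreover have "(p + q) \<bullet> (M *v (p + q)) = p \<bullet> (M *v p) + 2 * (p \<bullet> (M *v q)) + q \<bullet> (M *v q)" for p q
      using sym_inner[OF M, of q p]
      by (simp add: matrix_vector_right_distrib inner_add_left inner_add_right inner_commute)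
    ultimately show ?thesis by metis
  qed
  have "(\<Sum>i<n. (x i - ?c) \<bullet> (M *v ?d)) = 0"
    using sum_centered[OF n, of x] by (simp add: inner_sum_left[symmetric])
  then show ?thesis
    by (simp add: e sum.distrib t sum_distrib_left[symmetric] distrib_left)
qed

lemma sample_mean_linear:
  fixes x :: "nat \<Rightarrow> real^'a" and y :: "nat \<Rightarrow> real^'b"
  shows "sample_mean n (\<lambda>i. y i - H *v x i) = sample_mean n y - H *v sample_mean n x"
  by (simp add: sample_mean_def sum_subtractf matrix_vec_sum matrix_vector_mult_scaleR scaleR_diff_right)

lemma sample_cross_cov_vec:
  "sample_cross_cov n x y *v z =
    (1 / real n) *\<^sub>R (\<Sum>i<n. ((y i - sample_mean n y) \<bullet> z) *\<^sub>R (x i - sample_mean n x))"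
  by (simp add: sample_cross_cov_def scaleR_matrix_vec sum_matrix_vec outer_mult_vec)

lemma transpose_sample_cross_cov: "transpose (sample_cross_cov n x y) = sample_cross_cov n y x"
  by (simp add: sample_cross_cov_def transpose_scaleR transpose_sum transpose_outer)

lemma sample_cov_psd: "psd (sample_cov n x)"
  unfolding psd_def sample_cov_def transpose_sample_cross_cov sample_cross_cov_vec
  by (auto simp: inner_sum_right inner_commute intro!: sum_nonneg divide_nonneg_nonneg)

lemma sample_cov_residual:
  fixes x :: "nat \<Rightarrow> real^'a" and y :: "nat \<Rightarrow> real^'b"
  shows "sample_cov n (\<lambda>i. y i - transpose G *v x i) =
    sample_cov n y - transpose G ** sample_cross_cov n x y - transpose (sample_cross_cov n x y) ** G
      + transpose G ** sample_cov n x ** G"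
proof (rule mat_eqI)
  fix z
  have r: "y i - transpose G *v x i - (sample_mean n y - transpose G *v sample_mean n x) =
     (y i - sample_mean n y) - transpose G *v (x i - sample_mean n x)" for i
    by (simp add: matrix_vector_mult_diff_distrib)
  show "sample_cov n (\<lambda>i. y i - transpose G *v x i) *v z =
    (sample_cov n y - transpose G ** sample_cross_cov n x y - transpose (sample_cross_cov n x y) ** G
      + transpose G ** sample_cov n x ** G) *v z"
    unfolding transpose_sample_cross_cov sample_cov_def
    by (simp add: matrix_vector_mult_add_rdistrib matrix_vector_mult_diff_rdistrib
       matrix_vector_mul_assoc[symmetric] sample_cross_cov_vec sample_mean_linear r matrix_vector_mult_scaleR
       matrix_vec_sum inner_diff_left inner_matrix_vector'[of "transpose G"] transpose_transpose
       algebra_simps sum_subtractf sum.distrib sum_constant_scaleR del: sum_constant)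
qed

section \<open>The Gaussian likelihood\<close>

text \<open>The likelihood factors into that of the \<open>x i\<close> and that of the residuals
  \<open>y i - transpose G *v x i\<close>, a sample tested against mean
  \<open>m2 - transpose G *v m1\<close> and covariance \<open>E\<close>.\<close>

lemma gaussian_likelihood_blk:
  fixes A :: "real^'a^'a" and E B :: "real^'b^'b" and G :: "real^'b^'a"
    and x :: "nat \<Rightarrow> real^'a" and y :: "nat \<Rightarrow> real^'b"
  assumes n: "0 < n" and A: "pd A" and E: "pd E" "B = E + transpose G ** A ** G"
  shows "(\<Prod>i<n. gaussian_density (stack m1 m2) (blk A (A ** G) (transpose G ** A) B) (stack (x i) (y i))) =
    exp (- (real n / 2) * (real CARD('a + 'b) * ln (2 * pi)
      + (ln (det A) + trace (matrix_inv A ** sample_cov n x)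
        + (sample_mean n x - m1) \<bullet> (matrix_inv A *v (sample_mean n x - m1)))
      + (ln (det E) + trace (matrix_inv E ** sample_cov n (\<lambda>i. y i - transpose G *v x i))
        + ((sample_mean n y - m2) - transpose G *v (sample_mean n x - m1))
          \<bullet> (matrix_inv E *v ((sample_mean n y - m2) - transpose G *v (sample_mean n x - m1))))))"
proof -
  let ?c = "real CARD('a + 'b) * ln (2 * pi)"
  let ?ta = "trace (matrix_inv A ** sample_cov n x)"
    and ?ma = "(sample_mean n x - m1) \<bullet> (matrix_inv A *v (sample_mean n x - m1))"
  let ?te = "trace (matrix_inv E ** sample_cov n (\<lambda>i. y i - transpose G *v x i))"
    and ?me = "((sample_mean n y - m2) - transpose G *v (sample_mean n x - m1))
          \<bullet> (matrix_inv E *v ((sample_mean n y - m2) - transpose G *v (sample_mean n x - m1)))"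
  let ?C = "blk A (A ** G) (transpose G ** A) B"
  have dC: "det ?C = det A * det E" by (rule det_blk_schur) (use A E in \<open>auto simp: pd_sym\<close>)
  have dpos: "0 < det A" "0 < det E" using pd_det_pos A E by auto
  then have "0 < det ?C" using dC by simp
  then have invC: "invertible ?C" by (simp add: invertible_det_nz)
  let ?m = "m2 - transpose G *v m1"
  let ?r = "\<lambda>i. y i - transpose G *v x i"
  have q: "(stack (x i) (y i) - stack m1 m2) \<bullet> (matrix_inv ?C *v (stack (x i) (y i) - stack m1 m2)) =
     (x i - m1) \<bullet> (matrix_inv A *v (x i - m1)) + (?r i - ?m) \<bullet> (matrix_inv E *v (?r i - ?m))" for i
  proof -
    have r: "(y i - m2) - transpose G *v (x i - m1) = ?r i - ?m"
      by (simp add: matrix_vector_mult_diff_distrib)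
    show ?thesis
      unfolding stack_diff
        inverse_form_blk[OF pd_invertible[OF A] pd_sym[OF A] pd_invertible[OF E(1)] E(2) refl invC] r ..
  qed
  define l where "l = ?c + ln (det A) + ln (det E)"
  have norm: "1 / sqrt ((2 * pi) ^ CARD('a + 'b) * det ?C) = exp (- l / 2)"
  proof -
    have "exp l = (2 * pi) ^ CARD('a + 'b) * det ?C"
    proof -
      have "exp (real N * ln (2 * pi)) = (2 * pi) ^ N" for N by (simp add: exp_of_nat_mult)
      then show ?thesis unfolding l_def dC exp_add using dpos by (simp only: exp_ln mult.assoc)
    qed
    then have "sqrt ((2 * pi) ^ CARD('a + 'b) * det ?C) = exp (l / 2)"
      by (metis exp_ge_zero exp_half_le2 real_sqrt_unique exp_double power2_eq_square field_sum_of_halves exp_add)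
    then show ?thesis by (simp add: exp_minus field_simps)
  qed
  have dens: "gaussian_density (stack m1 m2) ?C (stack (x i) (y i)) =
    exp (- (l + ((x i - m1) \<bullet> (matrix_inv A *v (x i - m1)) + (?r i - ?m) \<bullet> (matrix_inv E *v (?r i - ?m)))) / 2)" for i
  proof -
    have "gaussian_density (stack m1 m2) ?C (stack (x i) (y i)) =
      exp (- ((x i - m1) \<bullet> (matrix_inv A *v (x i - m1)) + (?r i - ?m) \<bullet> (matrix_inv E *v (?r i - ?m))) / 2)
       * (1 / sqrt ((2 * pi) ^ CARD('a + 'b) * det ?C))"
      unfolding gaussian_density_def q using invC by simp
    then show ?thesis unfolding norm exp_add[symmetric] by (simp add: field_simps)
  qed
  have sE: "transpose (matrix_inv E) = matrix_inv E" and sA: "transpose (matrix_inv A) = matrix_inv A"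
    using transpose_matrix_inv A E(1) pd_invertible pd_sym by auto
  have mr: "sample_mean n ?r - ?m = (sample_mean n y - m2) - transpose G *v (sample_mean n x - m1)"
    by (simp add: sample_mean_linear matrix_vector_mult_diff_distrib)
  have "(\<Sum>i<n. (?r i - ?m) \<bullet> (matrix_inv E *v (?r i - ?m))) = real n * (?te + ?me)"
    unfolding sum_quadratic_sample[OF n sE, of ?r ?m] mr ..
  moreover have "(\<Sum>i<n. (x i - m1) \<bullet> (matrix_inv A *v (x i - m1))) = real n * (?ta + ?ma)"
    using sum_quadratic_sample[OF n sA, of x m1] by simp
  ultimately have "(\<Sum>i<n. - (l + ((x i - m1) \<bullet> (matrix_inv A *v (x i - m1)) + (?r i - ?m) \<bullet> (matrix_inv E *v (?r i - ?m)))) / 2)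
    = - (real n / 2) * (l + (?ta + ?ma) + (?te + ?me))"
    by (simp only: sum_divide_distrib[symmetric] sum_negf sum.distrib sum_constant) (simp add: field_simps)
  then show ?thesis
    unfolding dens exp_sum[OF finite_lessThan, symmetric] by (simp add: l_def algebra_simps)
qed

section \<open>Whitened data\<close>

text \<open>Spectral norm at most one, without square roots, so that it combines directly with
  quadratic forms.\<close>

definition contraction :: "real^'n^'m \<Rightarrow> bool" where
  "contraction X \<longleftrightarrow> (\<forall>z. (X *v z) \<bullet> (X *v z) \<le> z \<bullet> z)"

text \<open>The squared length of \<open>?w = transpose X *v y\<close> is
  \<open>y \<bullet> (X *v ?w)\<close>, at most \<open>norm y * norm ?w\<close> by Cauchy-Schwarz;
  one factor cancels.\<close>

lemma contraction_transpose:
  assumes "contraction X" shows "contraction (transpose X)"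
  unfolding contraction_def
proof
  fix y
  let ?w = "transpose X *v y"
  have "?w \<bullet> ?w = y \<bullet> (X *v ?w)" using inner_matrix_vector[of y X ?w] by simp
  also have "\<dots> \<le> norm y * norm (X *v ?w)" by (rule norm_cauchy_schwarz)
  also have "norm (X *v ?w) \<le> norm ?w"
    using assms unfolding contraction_def by (simp add: norm_le)
  finally have "norm ?w * norm ?w \<le> norm y * norm ?w"
    by (simp add: mult_left_mono dot_square_norm power2_eq_square)
  then have "norm ?w \<le> norm y" by (cases "norm ?w = 0") (auto simp: mult_le_cancel_right)
  then show "?w \<bullet> ?w \<le> y \<bullet> y" by (simp add: norm_le)
qed

lemma contraction_transpose_iff: "contraction (transpose X) \<longleftrightarrow> contraction X"
  using contraction_transpose[of X] contraction_transpose[of "transpose X"] by (auto simp: transpose_transpose)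

lemma contraction_mult: "contraction X \<Longrightarrow> contraction Y \<Longrightarrow> contraction (X ** Y)"
  unfolding contraction_def matrix_vector_mul_assoc[symmetric] by (meson order_trans)

lemma contraction_spectral_norm: "contraction X \<longleftrightarrow> spectral_norm X \<le> 1"
proof
  assume "contraction X"
  then show "spectral_norm X \<le> 1"
    unfolding spectral_norm_def contraction_def by (intro onorm_le) (simp add: norm_le)
next
  assume le: "spectral_norm X \<le> 1"
  have "norm (X *v z) \<le> norm z" for z
  proof -
    have "norm (X *v z) \<le> spectral_norm X * norm z"
      unfolding spectral_norm_def by (rule onorm) (rule matrix_vector_mul_bounded_linear)
    also have "\<dots> \<le> norm z" using mult_right_mono[OF le norm_ge_zero[of z]] by simp
    finally show ?thesis .
  qed
  then show "contraction X" by (simp add: contraction_def norm_le)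
qed

text \<open>The matrix is \<open>R (I - X X^T) R\<close>. This turns a norm bound on whitened
  loadings into admissibility of the noise covariance.\<close>

lemma psd_minus_gram:
  fixes X :: "real^'k^'a"
  assumes R: "transpose R = R" and X: "contraction X"
  shows "psd (R ** R - (R ** X) ** transpose (R ** X))"
proof -
  have "0 \<le> x \<bullet> ((R ** R - (R ** X) ** transpose (R ** X)) *v x)" for x
  proof -
    have "x \<bullet> ((R ** R - (R ** X) ** transpose (R ** X)) *v x) =
      (R *v x) \<bullet> (R *v x) - (transpose X *v (R *v x)) \<bullet> (transpose X *v (R *v x))"
      by (simp add: matrix_vector_mult_diff_rdistrib inner_diff_right matrix_vector_mul_assoc[symmetric]
          matrix_transpose_mul R inner_matrix_vector[of x R] inner_matrix_vector[of _ X])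
    then show ?thesis using contraction_transpose[OF X] by (simp add: contraction_def)
  qed
  then show ?thesis
    by (simp add: psd_def transpose_diff matrix_transpose_mul R transpose_transpose matrix_mul_assoc)
qed

section \<open>The sample in whitened coordinates and its deviance\<close>

locale cca_sample =
  fixes n :: nat and x1 :: "nat \<Rightarrow> real^'a" and x2 :: "nat \<Rightarrow> real^'b"
  assumes n: "0 < n" and inv1: "invertible (sample_cov n x1)" and inv2: "invertible (sample_cov n x2)"
begin

abbreviation "S11 \<equiv> sample_cov n x1"
abbreviation "S12 \<equiv> sample_cross_cov n x1 x2"
abbreviation "S22 \<equiv> sample_cov n x2"
abbreviation "R1 \<equiv> psd_sqrt S11"
abbreviation "R2 \<equiv> psd_sqrt S22"
definition "T = inv_sqrt S11 ** S12 ** inv_sqrt S22"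

lemma pd_S: "pd S11" "pd S22"
  using psd_invertible_pd[OF sample_cov_psd] inv1 inv2 by auto

lemma R: "R1 ** R1 = S11" "R2 ** R2 = S22" "transpose R1 = R1" "transpose R2 = R2"
  "invertible R1" "invertible R2"
  using psd_sqrt(2)[OF sample_cov_psd] pd_sqrt[OF pd_S(1)] pd_sqrt[OF pd_S(2)] pd_sym pd_invertible by auto

lemma R_inv: "R1 ** inv_sqrt S11 = mat 1" "inv_sqrt S11 ** R1 = mat 1"
  "R2 ** inv_sqrt S22 = mat 1" "inv_sqrt S22 ** R2 = mat 1"
  "transpose (inv_sqrt S11) = inv_sqrt S11" "transpose (inv_sqrt S22) = inv_sqrt S22"
  unfolding inv_sqrt_def using invertible_inv R transpose_matrix_inv by auto

lemma R_cancel: "R1 *v (inv_sqrt S11 *v x) = x" "inv_sqrt S11 *v (R1 *v x) = x"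
  "R2 *v (inv_sqrt S22 *v y) = y" "inv_sqrt S22 *v (R2 *v y) = y"
  by (simp_all add: matrix_vector_mul_assoc R_inv)


lemma S11_vec: "S11 *v x = R1 *v (R1 *v x)" by (simp add: R matrix_vector_mul_assoc)
lemma S22_vec: "S22 *v x = R2 *v (R2 *v x)" by (simp add: R matrix_vector_mul_assoc)
lemma T_vec: "T *v x = inv_sqrt S11 *v (S12 *v (inv_sqrt S22 *v x))"
  by (simp add: T_def matrix_vector_mul_assoc matrix_mul_assoc)

lemma ln_det_congruence:
  fixes M :: "real^'b^'b"
  assumes "0 < det M" shows "ln (det (R2 ** M ** R2)) = ln (det S22) + ln (det M)"
proof -
  have "det (R2 ** M ** R2) = det S22 * det M"
    using arg_cong[OF R(2), of det] by (simp add: det_mul)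
  then show ?thesis using assms pd_det_pos[OF pd_S(2)] by (simp add: ln_mult)
qed

definition resid_cov :: "real^'b^'a \<Rightarrow> real^'b^'b" where
  "resid_cov G = sample_cov n (\<lambda>i. x2 i - transpose G *v x1 i)"

text \<open>\<open>R1 ** G ** inv_sqrt S22\<close> is the regression matrix \<open>G\<close>
  expressed in whitened coordinates of both variables.\<close>

lemma resid_cov_whiten: "resid_cov G = R2 ** resid T (R1 ** G ** inv_sqrt S22) ** R2"
proof (rule mat_eqI)
  fix x
  have tT: "transpose T *v y = inv_sqrt S22 *v (transpose S12 *v (inv_sqrt S11 *v y))" for y
    by (simp add: T_def matrix_transpose_mul R_inv matrix_vector_mul_assoc matrix_mul_assoc)
  have tG: "transpose (R1 ** G ** inv_sqrt S22) *v y = inv_sqrt S22 *v (transpose G *v (R1 *v y))" for y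
    by (simp add: matrix_transpose_mul R R_inv matrix_vector_mul_assoc matrix_mul_assoc)
  show "resid_cov G *v x = (R2 ** resid T (R1 ** G ** inv_sqrt S22) ** R2) *v x"
    unfolding resid_cov_def sample_cov_residual resid_def
    by (simp only: matrix_vector_mul_assoc[symmetric] matrix_vector_mult_add_rdistrib
       matrix_vector_mult_diff_rdistrib tT tG T_vec R_cancel matrix_vector_mul_lid
       matrix_vector_right_distrib matrix_vector_mult_diff_distrib S11_vec S22_vec)
qed

text \<open>The regression whose whitened matrix is \<open>T\<close> itself leaves the whitened
  residual covariance \<open>I - T^T T\<close>, semidefinite because it comes from a sample
  covariance.\<close>

lemma T_contraction: "contraction T"
proof -
  have psd: "psd (resid_cov G)" for G unfolding resid_cov_def by (rule sample_cov_psd)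
  let ?G = "inv_sqrt S11 ** T ** R2"
  have G: "R1 ** ?G ** inv_sqrt S22 = T"
    by (rule mat_eqI) (simp add: matrix_vector_mul_assoc[symmetric] R_cancel)
  have "(T *v z) \<bullet> (T *v z) \<le> z \<bullet> z" for z
  proof -
    let ?y = "inv_sqrt S22 *v z"
    have "0 \<le> ?y \<bullet> (resid_cov ?G *v ?y)" using psd by (simp add: psd_def)
    also have "\<dots> = z \<bullet> (resid T T *v z)"
      unfolding resid_cov_whiten G
      by (simp add: matrix_vector_mul_assoc[symmetric] R_cancel inner_matrix_vector[of _ R2] R)
    finally show ?thesis by (simp add: resid_form')
  qed
  then show ?thesis by (simp add: contraction_def)
qed

text \<open>Up to the factor \<open>-n/2\<close> and an additive constant, this is the log-likelihood of a nondegenerate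
  Gaussian, parametrized by the law of \<open>z\<^sub>1\<close> and the regression of \<open>z\<^sub>2\<close> on \<open>z\<^sub>1\<close>.\<close>

definition deviance :: "real^'a \<Rightarrow> real^'b \<Rightarrow> real^'a^'a \<Rightarrow> real^'b^'a \<Rightarrow> real^'b^'b \<Rightarrow> real" where
  "deviance m1 m2 A G E =
    (ln (det A) + trace (matrix_inv A ** S11) + (sample_mean n x1 - m1) \<bullet> (matrix_inv A *v (sample_mean n x1 - m1)))
    + (ln (det E) + trace (matrix_inv E ** resid_cov G)
      + ((sample_mean n x2 - m2) - transpose G *v (sample_mean n x1 - m1))
        \<bullet> (matrix_inv E *v ((sample_mean n x2 - m2) - transpose G *v (sample_mean n x1 - m1))))"

text \<open>The deviance of the best fit without cross-covariance (\<open>G = 0\<close>); the gain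
  from shared structure is measured against it.\<close>

definition base :: real where
  "base = ln (det S11) + ln (det S22) + real CARD('a) + real CARD('b)"

definition lik_of :: "real \<Rightarrow> real" where
  "lik_of d = exp (- (real n / 2) * (real CARD('a + 'b) * ln (2 * pi) + d))"

lemma lik_of_pos: "0 < lik_of d" by (simp add: lik_of_def)

lemma lik_of_le: "lik_of d \<le> lik_of d' \<longleftrightarrow> d' \<le> d"
  using n by (simp add: lik_of_def)

text \<open>Gibbs' inequality applies separately to \<open>A\<close> against \<open>S11\<close> and
  to \<open>E\<close> against \<open>resid_cov G\<close>, and the two terms in the means are
  nonnegative. Equality in the total forces equality in all four.\<close>

lemma deviance_lower:
  assumes A: "pd A" and E: "pd E" and P: "pd (resid T (R1 ** G ** inv_sqrt S22))"
  shows "base + ln (det (resid T (R1 ** G ** inv_sqrt S22))) \<le> deviance m1 m2 A G E"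
    and "deviance m1 m2 A G E \<le> base + ln (det (resid T (R1 ** G ** inv_sqrt S22))) \<Longrightarrow>
      A = S11 \<and> E = resid_cov G \<and> m1 = sample_mean n x1 \<and> m2 = sample_mean n x2"
proof -
  let ?d1 = "sample_mean n x1 - m1"
  let ?d2 = "(sample_mean n x2 - m2) - transpose G *v ?d1"
  have Sg: "pd (resid_cov G)"
    using pd_congruence[OF P R(6)] R(4) by (simp add: resid_cov_whiten)
  have d: "ln (det (resid_cov G)) = ln (det S22) + ln (det (resid T (R1 ** G ** inv_sqrt S22)))"
    unfolding resid_cov_whiten by (rule ln_det_congruence[OF pd_det_pos[OF P]])
  note g1 = gibbs[OF A pd_S(1)] and g2 = gibbs[OF E Sg]
  note iA = pd_inverse[OF A] and iE = pd_inverse[OF E]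
  have q: "0 \<le> ?d1 \<bullet> (matrix_inv A *v ?d1)" "0 \<le> ?d2 \<bullet> (matrix_inv E *v ?d2)"
    using pd_imp_psd[OF iA] pd_imp_psd[OF iE] by (auto simp: psd_def)
  show "base + ln (det (resid T (R1 ** G ** inv_sqrt S22))) \<le> deviance m1 m2 A G E"
    unfolding deviance_def base_def using g1(1) g2(1) q d by linarith
  assume le: "deviance m1 m2 A G E \<le> base + ln (det (resid T (R1 ** G ** inv_sqrt S22)))"
  then have "ln (det A) + trace (matrix_inv A ** S11) \<le> ln (det S11) + real CARD('a)"
    "ln (det E) + trace (matrix_inv E ** resid_cov G) \<le> ln (det (resid_cov G)) + real CARD('b)"
    and z: "?d1 \<bullet> (matrix_inv A *v ?d1) = 0" "?d2 \<bullet> (matrix_inv E *v ?d2) = 0"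
    unfolding deviance_def base_def using g1(1) g2(1) q d by linarith+
  then have "A = S11" "E = resid_cov G" using g1(2) g2(2) by auto
  moreover have "?d1 = 0" using z(1) iA unfolding pd_def by (metis less_irrefl)
  moreover have "?d2 = 0" using z(2) iE unfolding pd_def by (metis less_irrefl)
  ultimately show "A = S11 \<and> E = resid_cov G \<and> m1 = sample_mean n x1 \<and> m2 = sample_mean n x2" by simp
qed

text \<open>\<open>H\<close> is \<open>T\<close> cut down to the directions in \<open>D\<close> and
  shrunk by \<open>t\<close>. The value \<open>t = 1\<close> yields the optimum;
  \<open>t < 1\<close> keeps the covariance nonsingular when a correlation equals one.\<close>

lemma truncation_eigen:
  fixes v :: "'b \<Rightarrow> real^'b"
  assumes v: "onf UNIV v" "\<And>l. (transpose T ** T) *v v l = \<kappa> l *\<^sub>R v l"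
    and H: "\<And>l. H *v v l = (if l \<in> D then t *\<^sub>R (T *v v l) else 0)"
  shows "(transpose H ** H) *v v l = (if l \<in> D then t\<^sup>2 * \<kappa> l else 0) *\<^sub>R v l"
    and "resid T H *v v l = (if l \<in> D then 1 - 2 * t * \<kappa> l + t\<^sup>2 * \<kappa> l else 1) *\<^sub>R v l"
proof -
  have HT: "transpose H *v (T *v v l) = (if l \<in> D then t * \<kappa> l else 0) *\<^sub>R v l" for l
  proof -
    have "(transpose H *v (T *v v l)) \<bullet> v k = (if k = l then (if l \<in> D then t * \<kappa> l else 0) else 0)" for k
    proof -
      have "(transpose H *v (T *v v l)) \<bullet> v k = (H *v v k) \<bullet> (T *v v l)"
        by (simp add: inner_matrix_vector' transpose_transpose inner_commute)
      also have "\<dots> = (if k \<in> D then t * (v k \<bullet> ((transpose T ** T) *v v l)) else 0)"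
        by (simp add: H gram_form)
      also have "\<dots> = (if k = l then (if l \<in> D then t * \<kappa> l else 0) else 0)"
        using v(1) by (simp add: v(2) onf_def)
      finally show ?thesis .
    qed
    then show ?thesis
      by (subst onb_expand[OF v(1), of "transpose H *v (T *v v l)"]) (simp add: if_distrib[of "\<lambda>c. c *\<^sub>R _"] cong: if_cong)
  qed
  show HH: "(transpose H ** H) *v v l = (if l \<in> D then t\<^sup>2 * \<kappa> l else 0) *\<^sub>R v l"
    by (simp add: matrix_vector_mul_assoc[symmetric] H matrix_vector_mult_scaleR HT power2_eq_square)
  have TH: "transpose T *v (H *v v l) = (if l \<in> D then t * \<kappa> l else 0) *\<^sub>R v l"
    using v(2)[of l] by (simp add: H matrix_vector_mult_scaleR matrix_vector_mul_assoc)
  have "resid T H *v v l = v l - transpose H *v (T *v v l) - transpose T *v (H *v v l) + (transpose H ** H) *v v l"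
    unfolding resid_def
    by (simp add: matrix_vector_mult_add_rdistrib matrix_vector_mult_diff_rdistrib matrix_vector_mul_assoc)
  moreover have "(2 * t * \<kappa> l) *\<^sub>R v l = (t * \<kappa> l) *\<^sub>R v l + (t * \<kappa> l) *\<^sub>R v l"
    by (simp add: scaleR_left_distrib[symmetric])
  ultimately show "resid T H *v v l = (if l \<in> D then 1 - 2 * t * \<kappa> l + t\<^sup>2 * \<kappa> l else 1) *\<^sub>R v l"
    by (simp add: HT TH HH scaleR_left_distrib scaleR_left_diff_distrib)
qed

text \<open>\<open>E\<close> is chosen so that the marginal covariance of the second variable is
  \<open>S22\<close>. For \<open>t < 1\<close> it need not be the residual covariance, hence only an
  inequality: in the basis \<open>v\<close> the trace is a sum of ratios \<open>?r l / p l\<close>,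
  each at most one.\<close>

lemma deviance_truncation:
  fixes v :: "'b \<Rightarrow> real^'b"
  assumes v: "onf UNIV v" "\<And>l. (transpose T ** T) *v v l = \<kappa> l *\<^sub>R v l"
    and H: "\<And>l. H *v v l = (if l \<in> D then t *\<^sub>R (T *v v l) else 0)"
    and t: "0 \<le> t" "t \<le> 1" "\<And>l. l \<in> D \<Longrightarrow> t\<^sup>2 * \<kappa> l < 1"
  defines "E \<equiv> R2 ** (mat 1 - transpose H ** H) ** R2"
  shows "pd E"
    and "deviance (sample_mean n x1) (sample_mean n x2) S11 (inv_sqrt S11 ** H ** R2) E
      \<le> base + (\<Sum>l\<in>D. ln (1 - t\<^sup>2 * \<kappa> l))"
proof -
  let ?P = "mat 1 - transpose H ** H"
  define p where "p l = (if l \<in> D then 1 - t\<^sup>2 * \<kappa> l else 1)" for l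
  let ?r = "\<lambda>l. if l \<in> D then 1 - 2 * t * \<kappa> l + t\<^sup>2 * \<kappa> l else 1"
  have \<kappa>0: "0 \<le> \<kappa> l" for l
    using eigen_value[OF v, of l] gram_form[of "v l" T "v l"] by (metis inner_ge_zero)
  have p0: "0 < p l" for l using t(3) by (simp add: p_def)
  have Pv: "?P *v v l = p l *\<^sub>R v l" for l
    by (simp add: matrix_vector_mult_diff_rdistrib truncation_eigen(1)[OF v H] p_def algebra_simps)
  have "0 \<le> x \<bullet> (?P *v x)" for x
    unfolding eigen_form(2)[OF v(1) Pv] mult.assoc
    by (intro sum_nonneg mult_nonneg_nonneg[OF less_imp_le[OF p0]]) simp
  then have "psd ?P" by (simp add: psd_def transpose_diff gram_sym transpose_mat)
  moreover have dP: "det ?P = (\<Prod>l\<in>UNIV. p l)" by (rule trace_det_eigenbasis(2)[OF v(1) Pv])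
  moreover have "(\<Prod>l\<in>UNIV. p l) \<noteq> 0" using p0 by (simp add: less_imp_neq[symmetric])
  ultimately have P: "pd ?P" by (simp add: psd_invertible_pd invertible_det_nz)
  show E: "pd E" unfolding E_def using pd_congruence[OF P R(6)] R(4) by simp
  have lnP: "ln (det ?P) = (\<Sum>l\<in>D. ln (1 - t\<^sup>2 * \<kappa> l))"
  proof -
    have "ln (det ?P) = (\<Sum>l\<in>UNIV. ln (p l))"
      unfolding dP by (rule ln_prod) (use p0 in \<open>simp_all add: less_imp_neq[symmetric]\<close>)
    also have "\<dots> = (\<Sum>l\<in>UNIV. if l \<in> D then ln (1 - t\<^sup>2 * \<kappa> l) else 0)" by (rule sum.cong) (auto simp: p_def)
    finally show ?thesis by (simp add: sum.If_cases)
  qed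
  have G: "R1 ** (inv_sqrt S11 ** H ** R2) ** inv_sqrt S22 = H"
    by (rule mat_eqI) (simp add: matrix_vector_mul_assoc[symmetric] R_cancel)
  let ?Q = "matrix_inv ?P ** resid T H"
  have Qv: "?Q *v v l = (?r l / p l) *\<^sub>R v l" for l
  proof -
    have "matrix_inv ?P *v v l = (1 / p l) *\<^sub>R v l"
    proof -
      have "v l = ?P *v ((1 / p l) *\<^sub>R v l)"
        unfolding matrix_vector_mult_scaleR Pv using p0[of l] by (simp del: if_split)
      then show ?thesis using inv_vec_cancel(2)[OF pd_invertible[OF P]] by metis
    qed
    then show ?thesis
      unfolding matrix_vector_mul_assoc[symmetric] truncation_eigen(2)[OF v H] matrix_vector_mult_scaleR
      by (simp del: if_split)
  qed
  have "trace (matrix_inv E ** resid_cov (inv_sqrt S11 ** H ** R2)) = trace ?Q"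
  proof -
    have "matrix_inv E = inv_sqrt S22 ** matrix_inv ?P ** inv_sqrt S22"
    proof (rule matrix_inv_eqI(2), rule matrix_mult_eqI)
      fix x
      show "E *v ((inv_sqrt S22 ** matrix_inv ?P ** inv_sqrt S22) *v x) = mat 1 *v x"
        unfolding E_def
        by (simp only: matrix_vector_mul_assoc[symmetric] R_cancel inv_vec_cancel(1)[OF pd_invertible[OF P]] matrix_vector_mul_lid)
    qed
    then have "matrix_inv E ** resid_cov (inv_sqrt S11 ** H ** R2) = inv_sqrt S22 ** (?Q ** R2)"
      unfolding resid_cov_whiten G
      by (intro mat_eqI) (simp only: matrix_vector_mul_assoc[symmetric] R_cancel)
    then have "trace (matrix_inv E ** resid_cov (inv_sqrt S11 ** H ** R2)) = trace ((?Q ** R2) ** inv_sqrt S22)"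
      by (simp add: trace_mul_sym[of "inv_sqrt S22"])
    then show ?thesis by (simp add: matrix_mul_assoc[symmetric] R_inv)
  qed
  also have "\<dots> = (\<Sum>l\<in>UNIV. ?r l / p l)" by (rule trace_det_eigenbasis(1)[OF v(1) Qv])
  also have "\<dots> \<le> (\<Sum>l\<in>(UNIV :: 'b set). 1)"
  proof (rule sum_mono)
    fix l
    \<comment> \<open>The difference \<open>p l - ?r l\<close> on \<open>D\<close> is
      \<open>2 * t * (1 - t) * \<kappa> l\<close>.\<close>
    have "2 * t\<^sup>2 * \<kappa> l \<le> 2 * t * \<kappa> l"
      using t(1,2) \<kappa>0[of l] by (intro mult_right_mono) (auto simp: power2_eq_square mult_left_le)
    then have "?r l \<le> p l" by (auto simp: p_def algebra_simps)
    then show "?r l / p l \<le> 1" using p0[of l] by (simp del: if_split)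
  qed
  finally have tr: "trace (matrix_inv E ** resid_cov (inv_sqrt S11 ** H ** R2)) \<le> real CARD('b)" by simp
  have "trace (matrix_inv S11 ** S11) = real CARD('a)" by (simp add: invertible_inv[OF inv1] trace_I)
  moreover have "ln (det E) = ln (det S22) + ln (det ?P)"
    unfolding E_def by (rule ln_det_congruence[OF pd_det_pos[OF P]])
  ultimately show "deviance (sample_mean n x1) (sample_mean n x2) S11 (inv_sqrt S11 ** H ** R2) E
      \<le> base + (\<Sum>l\<in>D. ln (1 - t\<^sup>2 * \<kappa> l))"
    unfolding deviance_def base_def using tr lnP by simp
qed

section \<open>From model parameters to deviances\<close>

lemma likelihood_deviance:
  assumes "marginal_mean \<theta> = stack m1 m2" "pd A" "pd E"
    "marginal_cov \<theta> = blk A (A ** G) (transpose G ** A) (E + transpose G ** A ** G)"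
  shows "likelihood n x1 x2 \<theta> = lik_of (deviance m1 m2 A G E)"
  unfolding likelihood_def assms(1,4) gaussian_likelihood_blk[OF n assms(2,3) refl] lik_of_def
    deviance_def resid_cov_def by (simp only: add.assoc)

text \<open>A singular marginal covariance has density 0 by convention, and the sample is nonempty.
  Otherwise that covariance is positive definite and its Schur complement provides \<open>E\<close>;
  the factorization of \<open>A ** G\<close> through the loadings preserves the rank
  constraint.\<close>

lemma likelihood_cases:
  fixes \<theta> :: "('a, 'b, 'k::finite) cca_params"
  assumes "valid_params \<theta>"
  obtains "likelihood n x1 x2 \<theta> = 0"
  | m1 m2 A E G where "marginal_mean \<theta> = stack m1 m2" "pd A" "pd E" "A = load1 \<theta> ** transpose (load1 \<theta>) + noise_cov1 \<theta>"
    "load1 \<theta> ** transpose (load2 \<theta>) = A ** G"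
    "load2 \<theta> ** transpose (load2 \<theta>) + noise_cov2 \<theta> = E + transpose G ** A ** G"
    "likelihood n x1 x2 \<theta> = lik_of (deviance m1 m2 A G E)"
proof (cases "invertible (marginal_cov \<theta>)")
  case False
  then have "likelihood n x1 x2 \<theta> = 0"
    using n by (simp add: likelihood_def gaussian_density_def)
  then show ?thesis by (rule that(1))
next
  case True
  let ?W1 = "load1 \<theta>" and ?W2 = "load2 \<theta>"
  let ?A = "?W1 ** transpose ?W1 + noise_cov1 \<theta>" and ?B = "?W2 ** transpose ?W2 + noise_cov2 \<theta>"
  let ?K = "?W1 ** transpose ?W2"
  have N: "psd (noise_cov1 \<theta>)" "psd (noise_cov2 \<theta>)" using assms by (auto simp: valid_params_def)
  have tK: "?W2 ** transpose ?W1 = transpose ?K" by (simp add: matrix_transpose_mul)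
  have C: "marginal_cov \<theta> = blk ?A ?K (transpose ?K) ?B" by (simp add: marginal_cov_blk tK)
  have "0 \<le> z \<bullet> (marginal_cov \<theta> *v z)" for z
  proof -
    obtain x y where z: "z = stack x y" by (rule stack_cases)
    have "z \<bullet> (marginal_cov \<theta> *v z) = (transpose ?W1 *v x + transpose ?W2 *v y) \<bullet> (transpose ?W1 *v x + transpose ?W2 *v y)
      + x \<bullet> (noise_cov1 \<theta> *v x) + y \<bullet> (noise_cov2 \<theta> *v y)"
      unfolding z C tK[symmetric]
      by (simp add: matrix_vector_mult_add_rdistrib matrix_vector_mul_assoc[symmetric] inner_add_left inner_add_right
        inner_matrix_vector[of _ ?W1] inner_matrix_vector[of _ ?W2])
    then show ?thesis using N by (simp add: psd_def)
  qed
  moreover have "transpose (marginal_cov \<theta>) = marginal_cov \<theta>"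
    unfolding C using N
    by (simp add: transpose_blk transpose_add matrix_transpose_mul transpose_transpose psd_sym)
  ultimately have "psd (marginal_cov \<theta>)" by (simp add: psd_def)
  then have pd: "pd (blk ?A ?K (transpose ?K) ?B)" using psd_invertible_pd True C by simp
  note AE = pd_blk_schur[OF pd]
  let ?G = "matrix_inv ?A ** ?K"
  have AG: "?A ** ?G = ?K" by (simp add: matrix_mul_assoc invertible_inv[OF pd_invertible[OF AE(1)]])
  have GA: "transpose ?G ** ?A = transpose ?K"
    using AG pd_sym[OF AE(1)] by (metis matrix_transpose_mul)
  let ?E = "?B - transpose ?K ** matrix_inv ?A ** ?K"
  have B: "?B = ?E + transpose ?G ** ?A ** ?G" unfolding GA by (simp add: matrix_mul_assoc)
  obtain m1 m2 where m: "marginal_mean \<theta> = stack m1 m2" by (rule stack_cases)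
  show ?thesis
  proof (rule that(2)[OF m AE refl AG[symmetric] B])
    show "likelihood n x1 x2 \<theta> = lik_of (deviance m1 m2 ?A ?G ?E)"
      by (rule likelihood_deviance[OF m AE]) (unfold B[symmetric], unfold AG GA, rule C)
  qed
qed

text \<open>The noise covariances fill the diagonal blocks up to \<open>S11\<close> and
  \<open>S22\<close>, so the whitened loadings affect the marginal covariance only through
  \<open>X1 ** transpose X2\<close>.\<close>

lemma likelihood_truncation:
  fixes v :: "'b \<Rightarrow> real^'b" and X1 :: "real^'k^'a" and X2 :: "real^'k^'b"
    and \<theta> :: "('a, 'b, 'k::finite) cca_params"
  assumes v: "onf UNIV v" "\<And>l. (transpose T ** T) *v v l = \<kappa> l *\<^sub>R v l"
    and H: "\<And>l. (X1 ** transpose X2) *v v l = (if l \<in> D then t *\<^sub>R (T *v v l) else 0)"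
    and t: "0 \<le> t" "t \<le> 1" "\<And>l. l \<in> D \<Longrightarrow> t\<^sup>2 * \<kappa> l < 1"
    and X: "contraction X1" "contraction X2"
    and \<theta>: "load1 \<theta> = R1 ** X1" "load2 \<theta> = R2 ** X2"
      "noise_cov1 \<theta> = S11 - load1 \<theta> ** transpose (load1 \<theta>)"
      "noise_cov2 \<theta> = S22 - load2 \<theta> ** transpose (load2 \<theta>)"
      "marginal_mean \<theta> = stack (sample_mean n x1) (sample_mean n x2)"
  shows "valid_params \<theta>" "lik_of (base + (\<Sum>l\<in>D. ln (1 - t\<^sup>2 * \<kappa> l))) \<le> likelihood n x1 x2 \<theta>"
proof -
  show "valid_params \<theta>"
    unfolding valid_params_def \<theta>(3,4) \<theta>(1,2)
    using psd_minus_gram[OF R(3) X(1)] psd_minus_gram[OF R(4) X(2)] by (simp add: R)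
  let ?H = "X1 ** transpose X2"
  let ?G = "inv_sqrt S11 ** ?H ** R2" and ?E = "R2 ** (mat 1 - transpose ?H ** ?H) ** R2"
  note dt = deviance_truncation[OF v H t, simplified]
  have K: "load1 \<theta> ** transpose (load2 \<theta>) = S11 ** ?G"
    unfolding \<theta>
    by (rule mat_eqI) (simp add: matrix_transpose_mul R(4) matrix_vector_mul_assoc[symmetric] S11_vec R_cancel)
  have K': "load2 \<theta> ** transpose (load1 \<theta>) = transpose ?G ** S11"
    using arg_cong[OF K, of transpose] pd_sym[OF pd_S(1)]
    by (simp add: matrix_transpose_mul transpose_transpose)
  have B: "?E + transpose ?G ** S11 ** ?G = S22"
    by (rule mat_eqI)
       (simp add: matrix_transpose_mul R R_inv transpose_transpose matrix_vector_mult_add_rdistrib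
        matrix_vector_mul_assoc[symmetric] matrix_vector_mult_diff_rdistrib S11_vec S22_vec R_cancel
        matrix_vector_mult_diff_distrib)
  have "likelihood n x1 x2 \<theta> = lik_of (deviance (sample_mean n x1) (sample_mean n x2) S11 ?G ?E)"
    by (rule likelihood_deviance[OF \<theta>(5) pd_S(1) dt(1)]) (unfold marginal_cov_blk K K' B \<theta>(3,4), simp)
  then show "lik_of (base + (\<Sum>l\<in>D. ln (1 - t\<^sup>2 * \<kappa> l))) \<le> likelihood n x1 x2 \<theta>"
    using dt(2) by (simp add: lik_of_le)
qed

end

section \<open>Adapted singular value decompositions\<close>

text \<open>If \<open>m \<le> k\<close>, the family is completed first inside \<open>X\<close> and
  then in the whole space, so a basis of \<open>X\<close> sits among the first \<open>k\<close>
  members. If \<open>m > k\<close>, the first \<open>k\<close> members already span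
  \<open>X\<close>, whose dimension is at most \<open>k\<close>.\<close>

lemma onf_extend_covering:
  fixes a :: "nat \<Rightarrow> 'v::euclidean_space"
  assumes a: "onf {..<m} a" and r: "m \<le> r" "r \<le> DIM('v)" "k \<le> r"
    and X: "subspace X" "dim X \<le> k" "a ` {..<min m k} \<subseteq> X"
  shows "\<exists>w. onf {..<r} w \<and> (\<forall>i<m. w i = a i) \<and> X \<subseteq> span (w ` {..<k})"
proof (cases "m \<le> k")
  case True
  then have aX: "a ` {..<m} \<subseteq> X" using X(3) by (simp add: min_absorb1)
  have mX: "m \<le> dim X" using onf_card_le_dim(1)[OF a aX] by simp
  obtain w where w: "onf {..<dim X} w" "w ` {..<dim X} \<subseteq> X" "\<forall>i<m. w i = a i"
    using onf_extend[OF a X(1) aX mX order_refl] by blast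
  have sp: "span (w ` {..<dim X}) = X" by (rule onf_span_eq[OF w(1,2) X(1)]) simp
  obtain w' where w': "onf {..<r} w'" "\<forall>i<dim X. w' i = w i"
    using onf_extend[OF w(1) subspace_UNIV _ _ , of r] X(2) r by auto
  have "X \<subseteq> span (w' ` {..<k})"
  proof -
    have "w ` {..<dim X} \<subseteq> w' ` {..<k}"
    proof
      fix x assume "x \<in> w ` {..<dim X}"
      then obtain i where "x = w i" "i < dim X" by blast
      then have "x = w' i" "i < k" using w'(2) X(2) by auto
      then show "x \<in> w' ` {..<k}" by blast
    qed
    then show ?thesis using sp span_mono by blast
  qed
  moreover have "\<forall>i<m. w' i = a i" using w'(2) w(3) mX by auto
  ultimately show ?thesis using w'(1) by blast
next
  case False
  then have aX: "a ` {..<k} \<subseteq> X" using X(3) by (simp add: min_absorb2)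
  have "onf {..<k} a" using onf_subset[OF a] False by auto
  then have sp: "span (a ` {..<k}) = X" by (rule onf_span_eq[OF _ aX X(1)]) (use X(2) in simp)
  obtain w where w: "onf {..<r} w" "\<forall>i<m. w i = a i"
    using onf_extend[OF a subspace_UNIV _ r(1)] r(2) by auto
  have "w ` {..<k} = a ` {..<k}" using w(2) False by (intro image_cong) auto
  then show ?thesis using w sp by auto
qed

lemma exists_decreasing_enumeration:
  fixes f :: "'i \<Rightarrow> real"
  assumes "finite A" shows "\<exists>xs. distinct xs \<and> set xs = A \<and> sorted_wrt (\<lambda>x y. f y \<le> f x) xs"
proof -
  obtain ys where ys: "distinct ys" "set ys = A" using finite_distinct_list[OF assms] by blast
  let ?xs = "sort_key (\<lambda>x. - f x) ys"
  have "sorted (map (\<lambda>x. - f x) ?xs)" by simp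
  then have "sorted_wrt (\<lambda>x y. f y \<le> f x) ?xs" by (simp add: sorted_map)
  then show ?thesis using ys by (intro exI[of _ ?xs]) simp
qed

lemma svd_apply:
  fixes T :: "real^'b^'a"
  assumes "is_svd T s w1 w2" "i < min CARD('a) CARD('b)"
  shows "T *v w2 i = s i *\<^sub>R w1 i" "transpose T *v w1 i = s i *\<^sub>R (w2 i)"
proof -
  let ?r = "min CARD('a) CARD('b)"
  have T: "T = (\<Sum>i<?r. s i *\<^sub>R outer (w1 i) (w2 i))"
    and o: "\<And>j. j < ?r \<Longrightarrow> w1 j \<bullet> w1 i = (if j = i then 1 else 0)" "\<And>j. j < ?r \<Longrightarrow> w2 j \<bullet> w2 i = (if j = i then 1 else 0)"
    using assms by (auto simp: is_svd_def Let_def)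
  have "T *v w2 i = (\<Sum>j<?r. if j = i then s j *\<^sub>R w1 j else 0)"
    unfolding T sum_matrix_vec scaleR_matrix_vec outer_mult_vec by (rule sum.cong) (auto simp: o)
  then show "T *v w2 i = s i *\<^sub>R w1 i" using assms(2) by simp
  have "transpose T *v w1 i = (\<Sum>j<?r. if j = i then s j *\<^sub>R w2 j else 0)"
    unfolding T transpose_sum transpose_scaleR transpose_outer sum_matrix_vec scaleR_matrix_vec outer_mult_vec
    by (rule sum.cong) (auto simp: o)
  then show "transpose T *v w1 i = s i *\<^sub>R (w2 i)" using assms(2) by simp
qed

lemma svd_vec:
  fixes T :: "real^'b^'a"
  assumes "is_svd T s w1 w2"
  shows "T *v z = (\<Sum>i<min CARD('a) CARD('b). (s i * (w2 i \<bullet> z)) *\<^sub>R w1 i)"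
proof -
  have "T = (\<Sum>i<min CARD('a) CARD('b). s i *\<^sub>R outer (w1 i) (w2 i))"
    using assms by (simp add: is_svd_def Let_def)
  then show ?thesis by (simp add: sum_matrix_vec scaleR_matrix_vec outer_mult_vec)
qed

text \<open>Tailors the decomposition to a maximizer: \<open>X1\<close> and \<open>X2\<close> will
  be the ranges of its whitened loadings, which may leave the range and row space of
  \<open>T\<close> when fewer than \<open>k\<close> singular values are positive. The leading
  singular vectors that this leaves open are chosen inside \<open>X1\<close> and
  \<open>X2\<close>.\<close>

lemma svd_covering:
  fixes T :: "real^'b^'a" and v :: "'b \<Rightarrow> real^'b"
  assumes v: "onf UNIV v" "\<And>l. (transpose T ** T) *v v l = \<kappa> l *\<^sub>R v l"
    and k: "k \<le> min CARD('a) CARD('b)"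
    and D: "card D \<le> k" "\<forall>l\<in>D. 0 < \<kappa> l" "\<forall>i\<in>D. \<forall>j\<in>- D. \<kappa> j \<le> \<kappa> i"
      "card D < k \<longrightarrow> (\<forall>l\<in>- D. \<kappa> l = 0)"
    and X1: "subspace X1" "dim X1 \<le> k" "\<forall>l\<in>D. T *v v l \<in> X1"
    and X2: "subspace X2" "dim X2 \<le> k" "\<forall>l\<in>D. v l \<in> X2"
  obtains s w1 w2 where "is_svd T s w1 w2" "X1 \<subseteq> span (w1 ` {..<k})" "X2 \<subseteq> span (w2 ` {..<k})"
    "\<forall>i<k. w2 i \<in> v ` D \<or> s i = 0 \<and> (\<forall>l\<in>D. w2 i \<bullet> v l = 0)"
proof -
  let ?r = "min CARD('a) CARD('b)"
  define P where "P = {l. 0 < \<kappa> l}"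
  have DP: "D \<subseteq> P" using D(2) by (auto simp: P_def)
  have \<kappa>T: "(T *v v i) \<bullet> (T *v v j) = (if i = j then \<kappa> i else 0)" for i j
    using v by (simp add: gram_form[symmetric] onf_def)
  have \<kappa>0: "0 \<le> \<kappa> l" for l using \<kappa>T[of l l] by (metis inner_ge_zero)
  obtain xs where xs: "distinct xs" "set xs = D" "sorted_wrt (\<lambda>x y. \<kappa> y \<le> \<kappa> x) xs"
    using exists_decreasing_enumeration[of D \<kappa>] by auto
  obtain ys where ys: "distinct ys" "set ys = P - D" "sorted_wrt (\<lambda>x y. \<kappa> y \<le> \<kappa> x) ys"
    using exists_decreasing_enumeration[of "P - D" \<kappa>] by auto
  \<comment> \<open>\<open>D\<close> comes first; since its values dominate all others, the
    concatenation is still decreasing.\<close>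
  define zs where "zs = xs @ ys"
  define m where "m = length zs"
  define e where "e i = zs ! i" for i
  have zs: "distinct zs" "set zs = P" "sorted_wrt (\<lambda>x y. \<kappa> y \<le> \<kappa> x) zs"
    using xs ys DP D(3) by (auto simp: zs_def sorted_wrt_append)
  have e_inj: "inj_on e {..<m}" using zs(1) by (auto simp: inj_on_def e_def m_def nth_eq_iff_index_eq)
  have e_img: "e ` {..<m} = P" using zs(2) by (auto simp: e_def m_def set_conv_nth)
  have eP: "0 < \<kappa> (e i)" if "i < m" for i using e_img that by (auto simp: P_def)
  have e_dec: "\<kappa> (e j) \<le> \<kappa> (e i)" if "i \<le> j" "j < m" for i j
    using zs(3) that by (cases "i = j") (auto simp: sorted_wrt_iff_nth_less e_def m_def)
  have lxs: "length xs = card D" using xs distinct_card by fastforce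
  have eD: "e i \<in> D" if "i < card D" for i
    using that lxs xs(2) by (metis e_def nth_append nth_mem zs_def)
  have mP: "m = card P" using zs distinct_card m_def by metis
  \<comment> \<open>A leading position with positive singular value belongs to \<open>D\<close>: if
    \<open>D\<close> has fewer than \<open>k\<close> members, it contains all positive
    eigenvalues.\<close>
  have minmk: "i < card D" if "i < m" "i < k" for i
  proof (cases "card D < k")
    case True
    then have "P \<subseteq> D" using D(4) by (force simp: P_def)
    then show ?thesis using that mP DP by (metis subset_antisym)
  qed (use that in simp)
  define a where "a i = (1 / sqrt (\<kappa> (e i))) *\<^sub>R (T *v v (e i))" for i
  define b where "b i = v (e i)" for i
  have ob: "onf {..<m} b" unfolding b_def by (rule onf_reindex[OF v(1) e_inj]) simp
  have oa: "onf {..<m} a"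
    unfolding onf_def
  proof (intro ballI)
    fix i j assume "i \<in> {..<m}" "j \<in> {..<m}"
    then show "a i \<bullet> a j = (if i = j then 1 else 0)"
      using e_inj eP[of i] by (auto simp: a_def \<kappa>T inj_on_def)
  qed
  have mr: "m \<le> ?r" using onf_card_le_dim(1)[OF oa, of UNIV] onf_card_le_dim(1)[OF ob, of UNIV] by simp
  have "a ` {..<min m k} \<subseteq> X1"
    using minmk eD X1(1,3) by (auto simp: a_def intro!: subspace_scale)
  then obtain w1 where w1: "onf {..<?r} w1" "\<forall>i<m. w1 i = a i" "X1 \<subseteq> span (w1 ` {..<k})"
    using onf_extend_covering[OF oa mr _ k X1(1,2)] by auto
  have "b ` {..<min m k} \<subseteq> X2" using minmk eD X2(3) by (auto simp: b_def)
  then obtain w2 where w2: "onf {..<?r} w2" "\<forall>i<m. w2 i = b i" "X2 \<subseteq> span (w2 ` {..<k})"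
    using onf_extend_covering[OF ob mr _ k X2(1,2)] by auto
  define s where "s i = (if i < m then sqrt (\<kappa> (e i)) else 0)" for i
  have Teq: "T = (\<Sum>i<?r. s i *\<^sub>R outer (w1 i) (w2 i))"
  \<comment> \<open>On an eigenvector with positive value exactly one summand survives; the other
    eigenvectors lie in the kernel of \<open>T\<close>.\<close>
  proof (rule onb_matrix_eqI[OF v(1)])
    fix l
    have "(\<Sum>i<?r. s i *\<^sub>R outer (w1 i) (w2 i)) *v v l = (\<Sum>i<?r. (s i * (w2 i \<bullet> v l)) *\<^sub>R w1 i)"
      by (simp add: sum_matrix_vec scaleR_matrix_vec outer_mult_vec)
    also have "\<dots> = (\<Sum>i<m. (s i * (w2 i \<bullet> v l)) *\<^sub>R w1 i)"
      by (rule sum.mono_neutral_right) (use mr in \<open>auto simp: s_def\<close>)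
    also have "\<dots> = (\<Sum>i<m. if e i = l then T *v v l else 0)"
    proof (rule sum.cong)
      fix i assume "i \<in> {..<m}"
      then show "(s i * (w2 i \<bullet> v l)) *\<^sub>R w1 i = (if e i = l then T *v v l else 0)"
        using eP[of i] w1(2) w2(2) v(1) by (simp add: s_def a_def b_def onf_def)
    qed simp
    also have "(\<Sum>i<m. if e i = l then T *v v l else 0) = T *v v l"
    proof (cases "l \<in> P")
      case True
      then obtain i0 where i0: "i0 < m" "e i0 = l" using e_img by auto
      have "(\<Sum>i<m. if e i = l then T *v v l else 0) = (\<Sum>i<m. if i = i0 then T *v v l else 0)"
        by (rule sum.cong) (use i0 e_inj in \<open>auto simp: inj_on_def\<close>)
      then show ?thesis using i0 by simp
    next
      case False
      then have "T *v v l = 0" using \<kappa>T[of l l] \<kappa>0[of l] by (simp add: P_def)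
      then show ?thesis by (simp add: sum.neutral)
    qed
    finally show "T *v v l = (\<Sum>i<?r. s i *\<^sub>R outer (w1 i) (w2 i)) *v v l" by simp
  qed
  have svd: "is_svd T s w1 w2"
    unfolding is_svd_def Let_def
  proof (intro conjI)
    show "\<forall>i<?r. \<forall>j<?r. i \<le> j \<longrightarrow> s j \<le> s i"
      using e_dec \<kappa>0 by (auto simp: s_def)
    show "\<forall>i<?r. 0 \<le> s i" using \<kappa>0 by (simp add: s_def)
  qed (use w1(1) w2(1) Teq in \<open>simp_all add: onf_def\<close>)
  have lead: "\<forall>i<k. w2 i \<in> v ` D \<or> s i = 0 \<and> (\<forall>l\<in>D. w2 i \<bullet> v l = 0)"
  proof (intro allI impI)
    fix i assume i: "i < k"
    show "w2 i \<in> v ` D \<or> s i = 0 \<and> (\<forall>l\<in>D. w2 i \<bullet> v l = 0)"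
    proof (cases "i < m")
      case True
      then show ?thesis using minmk[OF True i] eD w2(2) by (auto simp: b_def)
    next
      case False
      have "w2 i \<bullet> v l = 0" if "l \<in> D" for l
      proof -
        have "l \<in> e ` {..<m}" using that DP e_img by auto
        then obtain j where j: "j < m" "e j = l" by auto
        then have "v l = w2 j" using w2(2) by (simp add: b_def)
        then show ?thesis using w2(1) j(1) i k mr False by (auto simp: onf_def)
      qed
      then show ?thesis using False by (simp add: s_def)
    qed
  qed
  show ?thesis by (rule that[OF svd w1(3) w2(3) lead])
qed

lemma contraction_scale:
  assumes "contraction X" "0 \<le> t" "t \<le> 1" shows "contraction (t *\<^sub>R X)"
  unfolding contraction_def
proof
  fix z
  have "((t *\<^sub>R X) *v z) \<bullet> ((t *\<^sub>R X) *v z) = t\<^sup>2 * ((X *v z) \<bullet> (X *v z))"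
    by (simp add: scaleR_matrix_vec power2_eq_square)
  also have "\<dots> \<le> 1 * ((X *v z) \<bullet> (X *v z))"
    using assms(2,3) by (intro mult_right_mono) (auto simp: power_le_one)
  also have "\<dots> \<le> z \<bullet> z" using assms(1) by (simp add: contraction_def)
  finally show "((t *\<^sub>R X) *v z) \<bullet> ((t *\<^sub>R X) *v z) \<le> z \<bullet> z" .
qed

section \<open>Matrices with prescribed columns\<close>

definition cols :: "('k \<Rightarrow> real^'n) \<Rightarrow> real^'k^'n" where
  "cols w = (\<chi> i k. w k $ i)"

lemma cols_vec: "cols w *v z = (\<Sum>k\<in>UNIV. z $ k *\<^sub>R w k)"
  by (simp add: cols_def vec_eq_iff matrix_vector_mult_def mult.commute)

lemma transpose_cols_vec: "transpose (cols w) *v y = (\<chi> k. w k \<bullet> y)"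
  by (simp add: cols_def vec_eq_iff matrix_vector_mult_def transpose_def inner_vec_def)

lemma cols_axis: "cols w *v axis k 1 = w k"
  unfolding cols_vec by (simp add: axis_def if_distrib[of "\<lambda>c. c *\<^sub>R _"] cong: if_cong)

lemma column_eq_imp: "(\<And>j. column j U = A *v w j) \<Longrightarrow> U = A ** cols w"
  by (simp add: vec_eq_iff column_def cols_def matrix_matrix_mult_def matrix_vector_mult_def)

lemma column_mult_cols: "column j (A ** cols w) = A *v w j"
  by (simp add: vec_eq_iff column_def cols_def matrix_matrix_mult_def matrix_vector_mult_def)

lemma contraction_cols:
  assumes "onf UNIV w" shows "contraction (cols w)"
  unfolding contraction_def cols_vec onf_norm_combine[OF assms finite]
  by (simp add: inner_vec_def)

lemma transpose_cols_onf:
  assumes "onf UNIV w" shows "transpose (cols w) *v w k = axis k 1"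
  using assms by (auto simp: transpose_cols_vec vec_eq_iff axis_def onf_def)

lemma cols_transpose_cols:
  fixes w :: "'k::finite \<Rightarrow> real^'n"
  assumes "onf UNIV w" "y \<in> span (range w)"
  shows "cols w *v (transpose (cols w) *v y) = y"
  unfolding transpose_cols_vec cols_vec
  using onf_expand[OF assms finite, symmetric] by (simp add: inner_commute)

lemma diag_axis: "diag p *v axis k 1 = p k *\<^sub>R axis k 1"
  unfolding matrix_vector_mult_basis by (simp add: vec_eq_iff column_def diag_def axis_def)

lemma onf_axis: "onf UNIV (\<lambda>k. axis k 1 :: real^'k)"
  by (simp add: onf_def inner_axis_axis)

section \<open>The maximum likelihood estimates\<close>

context cca_sample
begin

lemma eigen_bounds:
  fixes v :: "'b \<Rightarrow> real^'b"
  assumes v: "onf UNIV v" "\<And>l. (transpose T ** T) *v v l = \<kappa> l *\<^sub>R v l"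
  shows "0 \<le> \<kappa> l" "\<kappa> l \<le> 1"
proof -
  have "\<kappa> l = (T *v v l) \<bullet> (T *v v l)" using eigen_value[OF v, of l] by (simp add: gram_form)
  moreover have "(T *v v l) \<bullet> (T *v v l) \<le> 1"
    using T_contraction onf_self[OF v(1), of l] by (metis contraction_def UNIV_I)
  ultimately show "0 \<le> \<kappa> l" "\<kappa> l \<le> 1" by simp_all
qed

lemma strict_contraction:
  fixes v :: "'b \<Rightarrow> real^'b"
  assumes v: "onf UNIV v" "\<And>l. (transpose T ** T) *v v l = \<kappa> l *\<^sub>R v l" and "\<And>l. \<kappa> l < 1" and "x \<noteq> 0"
  shows "(T *v x) \<bullet> (T *v x) < x \<bullet> x"
proof (rule ccontr)
  assume "\<not> ?thesis"
  then have "(\<Sum>l\<in>UNIV. (1 - \<kappa> l) * (x \<bullet> v l)\<^sup>2) \<le> 0"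
    using eigen_form(2)[OF v, of x x] onb_parseval[OF v(1), of x x]
    by (simp add: gram_form algebra_simps sum_subtractf power2_eq_square)
  moreover have nn: "0 \<le> (1 - \<kappa> l) * (x \<bullet> v l)\<^sup>2" for l using assms(3)[of l] by simp
  ultimately have "(\<Sum>l\<in>UNIV. (1 - \<kappa> l) * (x \<bullet> v l)\<^sup>2) = 0" by (simp add: antisym sum_nonneg)
  then have z: "(1 - \<kappa> l) * (x \<bullet> v l)\<^sup>2 = 0" for l
    using sum_nonneg_eq_0_iff[of UNIV "\<lambda>l. (1 - \<kappa> l) * (x \<bullet> v l)\<^sup>2"] nn by simp
  have "x \<bullet> v l = 0" for l using z[of l] assms(3)[of l] by auto
  then have "x = 0" by (subst onb_expand[OF v(1), of x]) simp
  then show False using assms(4) by simp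
qed

lemma pd_resid:
  assumes "\<And>x. x \<noteq> 0 \<Longrightarrow> (T *v x) \<bullet> (T *v x) < x \<bullet> x" shows "pd (resid T H)"
  unfolding pd_def using resid_sym assms by (auto simp: resid_form' intro!: add_pos_nonneg)

text \<open>The rank constraint in usable form: the whitened regression factors through
  \<open>real^'k\<close>.\<close>

lemma whitened_regression:
  fixes W1 :: "real^'k^'a" and W2 :: "real^'k^'b"
  assumes "pd A" "W1 ** transpose W2 = A ** G"
  shows "R1 ** G ** inv_sqrt S22 = (R1 ** matrix_inv A ** W1) ** (transpose W2 ** inv_sqrt S22)"
proof -
  have "G = matrix_inv A ** (W1 ** transpose W2)"
    unfolding assms(2) by (simp add: matrix_mul_assoc invertible_inv[OF pd_invertible[OF assms(1)]])
  then show ?thesis by (simp add: matrix_mul_assoc)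
qed

lemma likelihood_upper:
  fixes \<theta> :: "('a, 'b, 'k::finite) cca_params" and v :: "'b \<Rightarrow> real^'b"
  assumes "valid_params \<theta>"
    and v: "onf UNIV v" "\<And>l. (transpose T ** T) *v v l = \<kappa> l *\<^sub>R v l" and \<kappa>1: "\<And>l. \<kappa> l < 1"
    and D: "card D = CARD('k)" "\<forall>i\<in>D. \<forall>j\<in>- D. \<kappa> j \<le> \<kappa> i"
  shows "likelihood n x1 x2 \<theta> \<le> lik_of (base + (\<Sum>l\<in>D. ln (1 - \<kappa> l)))"
  using assms(1)
proof (cases rule: likelihood_cases)
  case 1
  then show ?thesis using lik_of_pos less_imp_le by metis
next
  case (2 m1 m2 A E G)
  let ?H = "R1 ** G ** inv_sqrt S22"
  have R: "pd (resid T ?H)" by (rule pd_resid) (rule strict_contraction[OF v \<kappa>1])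
  obtain u \<sigma> where u: "onf UNIV (u :: 'b \<Rightarrow> real^'b)" "\<And>j. resid T ?H *v u j = \<sigma> j *\<^sub>R u j"
    using sym_eigenbasis[OF resid_sym] by metis
  have \<sigma>0: "0 < \<sigma> j" for j by (rule pd_eigenvalue[OF R u])
  have "(\<Sum>l\<in>D. ln (1 - \<kappa> l)) \<le> (\<Sum>j\<in>UNIV. ln (\<sigma> j))"
    by (rule reduced_rank_bound(1)[OF whitened_regression[OF 2(2) 2(5)] v \<kappa>1 u D])
  also have "\<dots> = ln (det (resid T ?H))"
    unfolding trace_det_eigenbasis(2)[OF u] by (rule ln_prod[symmetric]) (use \<sigma>0 in \<open>auto simp: less_imp_neq[symmetric]\<close>)
  finally have "base + (\<Sum>l\<in>D. ln (1 - \<kappa> l)) \<le> deviance m1 m2 A G E"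
    using deviance_lower(1)[OF 2(2,3) R, of m1 m2] by simp
  then show ?thesis using 2(7) by (simp add: lik_of_le)
qed

text \<open>Trial models for any eigenbasis, any small \<open>D\<close> and any shrinking factor.
  They also exist where no admissible pair \<open>M1\<close>, \<open>M2\<close> does, as is needed
  when a correlation equals one.\<close>

lemma likelihood_attains:
  fixes v :: "'b \<Rightarrow> real^'b"
  assumes v: "onf UNIV v" "\<And>l. (transpose T ** T) *v v l = \<kappa> l *\<^sub>R v l"
    and D: "card D \<le> CARD('k::finite)"
    and t: "0 \<le> t" "t \<le> 1" "\<forall>l\<in>D. t\<^sup>2 * \<kappa> l < 1"
  shows "\<exists>\<theta> :: ('a, 'b, 'k) cca_params. valid_params \<theta> \<and>
    lik_of (base + (\<Sum>l\<in>D. ln (1 - t\<^sup>2 * \<kappa> l))) \<le> likelihood n x1 x2 \<theta>"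
proof -
  obtain f where f: "inj_on f D" "f ` D \<subseteq> (UNIV :: 'k set)"
    using D inj_on_iff_card_le[of D "UNIV :: 'k set"] by auto
  \<comment> \<open>A partial isometry carrying the axis \<open>f l\<close> to \<open>v l\<close>;
    thus \<open>X2 ** transpose X2\<close> projects onto the span of the \<open>v l\<close> with
    \<open>l \<in> D\<close>, and \<open>X1 ** transpose X2\<close> is the shrunk
    truncation.\<close>
  define X2 :: "real^'k^'b" where "X2 = (\<Sum>l\<in>D. outer (v l) (axis (f l) 1))"
  define X1 where "X1 = t *\<^sub>R (T ** X2)"
  have X2v: "X2 *v z = (\<Sum>l\<in>D. z $ f l *\<^sub>R v l)" for z
    by (simp add: X2_def sum_matrix_vec outer_mult_vec inner_axis' )
  have cX2: "contraction X2"
    unfolding contraction_def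
  proof
    fix z
    have "(X2 *v z) \<bullet> (X2 *v z) = (\<Sum>l\<in>D. z $ f l * z $ f l)"
      unfolding X2v by (rule onf_norm_combine[OF onf_subset[OF v(1)]]) auto
    also have "\<dots> = (\<Sum>k\<in>f ` D. z $ k * z $ k)" by (simp add: sum.reindex[OF f(1)])
    also have "\<dots> \<le> (\<Sum>k\<in>UNIV. z $ k * z $ k)" by (rule sum_mono2) auto
    finally show "(X2 *v z) \<bullet> (X2 *v z) \<le> z \<bullet> z" by (simp add: inner_vec_def)
  qed
  have cX1: "contraction X1"
    unfolding X1_def using contraction_scale[OF contraction_mult[OF T_contraction cX2] t(1,2)] .
  have X2X2: "X2 *v (transpose X2 *v v m) = (if m \<in> D then v m else 0)" for m
  proof -
    have "transpose X2 *v v m = (\<Sum>l\<in>D. if l = m then axis (f l) 1 else 0)"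
      unfolding X2_def transpose_sum transpose_outer sum_matrix_vec outer_mult_vec
      by (rule sum.cong) (use v(1) in \<open>auto simp: onf_def\<close>)
    also have "\<dots> = (if m \<in> D then axis (f m) 1 else 0)" by simp
    finally have e: "transpose X2 *v v m = (if m \<in> D then axis (f m) 1 else 0)" .
    have "X2 *v axis (f m) 1 = v m" if "m \<in> D"
    proof -
      have "X2 *v axis (f m) 1 = (\<Sum>l\<in>D. if l = m then v l else 0)"
        unfolding X2v by (rule sum.cong) (use f(1) that in \<open>auto simp: axis_def inj_on_def\<close>)
      then show ?thesis using that by simp
    qed
    then show ?thesis unfolding e by simp
  qed
  have H: "(X1 ** transpose X2) *v v l = (if l \<in> D then t *\<^sub>R (T *v v l) else 0)" for l
    by (simp add: X1_def matrix_vector_mul_assoc[symmetric] scaleR_matrix_vec X2X2)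
  define \<theta> :: "('a, 'b, 'k) cca_params" where
    "\<theta> = \<lparr>latent_mean = 0, load1 = R1 ** X1, load2 = R2 ** X2,
      noise_mean1 = sample_mean n x1, noise_mean2 = sample_mean n x2,
      noise_cov1 = S11 - (R1 ** X1) ** transpose (R1 ** X1),
      noise_cov2 = S22 - (R2 ** X2) ** transpose (R2 ** X2)\<rparr>"
  note lt = likelihood_truncation[OF v H t(1,2) t(3)[rule_format] cX1 cX2, of \<theta>]
  show ?thesis
    by (rule exI[of _ \<theta>], rule conjI; rule lt) (simp_all add: \<theta>_def marginal_mean_def)
qed

text \<open>The condition \<open>M1 ** transpose M2 = P\<close> says precisely that the whitened
  loadings multiply to \<open>T\<close> truncated to the chosen right singular vectors. So the
  trial-model bound with \<open>t = 1\<close> meets the upper bound.\<close>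

lemma estimate_is_mle:
  fixes U1 :: "real^'k^'a" and U2 :: "real^'k^'b" and M1 M2 P :: "real^'k^'k"
    and idx :: "'k::finite \<Rightarrow> nat"
  assumes card: "CARD('k) \<le> min CARD('a) CARD('b)" and idx: "bij_betw idx UNIV {..<CARD('k)}"
    and can: "canonical_directions S11 S12 S22 idx U1 U2 P"
    and M: "spectral_norm M1 < 1" "spectral_norm M2 < 1" "M1 ** transpose M2 = P"
  shows "is_mle n x1 x2 (cca_estimate n x1 x2 U1 U2 M1 M2 m0)"
proof -
  let ?r = "min CARD('a) CARD('b)" and ?d = "CARD('k)"
  obtain s w1 w2 where svd: "is_svd T s w1 w2"
    and U: "\<And>j. column j U1 = inv_sqrt S11 *v w1 (idx j)" "\<And>j. column j U2 = inv_sqrt S22 *v w2 (idx j)"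
    and P: "P = diag (\<lambda>j. s (idx j))"
    using can by (auto simp: canonical_directions_def T_def)
  have s: "\<And>i. i < ?r \<Longrightarrow> 0 \<le> s i" "\<And>i j. i < ?r \<Longrightarrow> j < ?r \<Longrightarrow> i \<le> j \<Longrightarrow> s j \<le> s i"
    and w: "onf {..<?r} w1" "onf {..<?r} w2"
    using svd by (auto simp: is_svd_def Let_def onf_def)
  have idx_img: "idx j < ?d" for j using idx by (auto simp: bij_betw_def)
  have idx_ex: "\<exists>j. idx j = i" if "i < ?d" for i using idx that unfolding bij_betw_def by (metis imageE lessThan_iff)
  have wi: "onf UNIV (\<lambda>j. w1 (idx j))" "onf UNIV (\<lambda>j. w2 (idx j))"
  proof -
    have ii: "inj idx" "range idx \<subseteq> {..<?r}" using idx card by (auto simp: bij_betw_def)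
    show "onf UNIV (\<lambda>j. w1 (idx j))" "onf UNIV (\<lambda>j. w2 (idx j))"
      by (rule onf_reindex[OF w(1) ii], rule onf_reindex[OF w(2) ii])
  qed
  let ?V1 = "cols (\<lambda>j. w1 (idx j))" and ?V2 = "cols (\<lambda>j. w2 (idx j))"
  have U': "U1 = inv_sqrt S11 ** ?V1" "U2 = inv_sqrt S22 ** ?V2"
    by (rule column_eq_imp, rule U)+
  have gw: "(transpose T ** T) *v w2 i = (s i)\<^sup>2 *\<^sub>R w2 i" if "i < ?r" for i
    using svd_apply[OF svd that] by (simp add: matrix_vector_mul_assoc[symmetric] matrix_vector_mult_scaleR power2_eq_square)
  obtain v \<kappa> where v: "onf UNIV (v :: 'b \<Rightarrow> real^'b)" "\<And>l. (transpose T ** T) *v v l = \<kappa> l *\<^sub>R v l"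
    and wv: "w2 ` {..<?r} \<subseteq> range v"
    using sym_eigenbasis_extend[OF gram_sym w(2), of T] gw by (metis lessThan_iff)
  have \<kappa>s: "\<kappa> l = (s i)\<^sup>2" if "v l = w2 i" "i < ?r" for l i
    using gw[OF that(2)] v(2)[of l] that(1) onf_self[OF v(1), of l]
    by (metis UNIV_I inner_scaleR_left mult.right_neutral)
  have vw: "v l \<bullet> w2 i = 0" if "v l \<noteq> w2 i" "i < ?r" for l i
  proof -
    have "w2 i \<in> range v" using that(2) by (intro subsetD[OF wv] imageI) simp
    then obtain m where "w2 i = v m" by (rule rangeE)
    then show ?thesis using that(1) v(1) by (auto simp: onf_def)
  qed
  \<comment> \<open>For \<open>CARD('a) < CARD('b)\<close> the right singular vectors do not fill
    the space; the remaining basis vectors lie in the kernel of \<open>T\<close>.\<close>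
  have \<kappa>z: "\<kappa> l = 0" if "v l \<notin> w2 ` {..<?r}" for l
  proof -
    have "T *v v l = 0"
      unfolding svd_vec[OF svd]
    proof (rule sum.neutral, rule ballI)
      fix i assume i: "i \<in> {..<?r}"
      then have "v l \<noteq> w2 i" using that by auto
      then show "(s i * (w2 i \<bullet> v l)) *\<^sub>R w1 i = 0" using vw[of l i] i by (simp add: inner_commute)
    qed
    then show ?thesis using eigen_value[OF v, of l] by (simp add: gram_form)
  qed
  define D where "D = {l. v l \<in> w2 ` {..<?d}}"
  have "bij_betw v D (w2 ` {..<?d})"
  proof -
    have "inj_on v D" using onf_inj_on[OF v(1)] by (rule inj_on_subset) simp
    moreover have "v ` D = w2 ` {..<?d}"
    proof
      show "v ` D \<subseteq> w2 ` {..<?d}" by (auto simp: D_def)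
      show "w2 ` {..<?d} \<subseteq> v ` D"
      proof
        fix x assume x: "x \<in> w2 ` {..<?d}"
        then have "x \<in> range v" using wv card by (auto simp: subset_iff)
        then show "x \<in> v ` D" using x by (auto simp: D_def)
      qed
    qed
    ultimately show ?thesis by (simp add: bij_betw_def)
  qed
  then have cD: "card D = ?d"
    using onf_inj_on[OF onf_subset[OF w(2), of "{..<?d}"]] card by (simp add: bij_betw_same_card card_image)
  have top: "\<forall>i\<in>D. \<forall>j\<in>- D. \<kappa> j \<le> \<kappa> i"
  proof safe
    fix i j assume "i \<in> D" and j: "j \<notin> D"
    then obtain i' where i': "v i = w2 i'" "i' < ?d" by (auto simp: D_def)
    show "\<kappa> j \<le> \<kappa> i"
    proof (cases "v j \<in> w2 ` {..<?r}")
      case True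
      then obtain j' where j': "v j = w2 j'" "j' < ?r" by blast
      then have "i' \<le> j'" using j i'(2) by (force simp: D_def)
      then have "(s j')\<^sup>2 \<le> (s i')\<^sup>2" using s i' j' card by (intro power_mono) auto
      then show ?thesis using \<kappa>s i' j' card by simp
    next
      case False
      then show ?thesis using \<kappa>z eigen_bounds(1)[OF v] by simp
    qed
  qed
  have cM: "contraction M1" "contraction M2" using M(1,2) by (simp_all add: contraction_spectral_norm)
  \<comment> \<open>The largest correlation is a diagonal entry of
    \<open>M1 ** transpose M2\<close>, hence at most the product of the two norms. This excludes the
    unbounded case.\<close>
  have s0: "s 0 < 1"
  proof -
    obtain j where j: "idx j = 0" using idx_ex[of 0] by auto
    let ?e = "axis j 1 :: real^'k"
    have cM2: "contraction (transpose M2)" by (rule contraction_transpose[OF cM(2)])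
    have "(transpose M2 *v ?e) \<bullet> (transpose M2 *v ?e) \<le> ?e \<bullet> ?e" using cM2 unfolding contraction_def by blast
    then have n2: "norm (transpose M2 *v ?e) \<le> 1" by (simp only: norm_le[symmetric]) simp
    have "s 0 = ?e \<bullet> (P *v ?e)" by (simp add: P diag_axis j inner_axis_axis)
    also have "\<dots> \<le> norm ?e * norm (P *v ?e)" by (rule norm_cauchy_schwarz)
    also have "\<dots> = norm (M1 *v (transpose M2 *v ?e))" by (simp add: M(3)[symmetric] matrix_vector_mul_assoc)
    also have "\<dots> \<le> spectral_norm M1 * norm (transpose M2 *v ?e)"
      unfolding spectral_norm_def by (rule onorm) (rule matrix_vector_mul_bounded_linear)
    also have "\<dots> \<le> spectral_norm M1 * 1"
      by (intro mult_left_mono n2) (simp add: spectral_norm_def onorm_pos_le)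
    finally show ?thesis using M(1) by simp
  qed
  have \<kappa>1: "\<kappa> l < 1" for l
  proof (cases "v l \<in> w2 ` {..<?r}")
    case True
    then obtain i where i: "v l = w2 i" "i < ?r" by blast
    then have "s i < 1" using s(2)[of 0 i] s0 by simp
    then show ?thesis using \<kappa>s[OF i] s(1)[OF i(2)] by (simp add: power_less_one_iff abs_square_less_1)
  qed (simp add: \<kappa>z)
  let ?X1 = "?V1 ** M1" and ?X2 = "?V2 ** M2"
  have X: "contraction ?X1" "contraction ?X2"
    using contraction_cols[OF wi(1)] contraction_cols[OF wi(2)] cM by (auto intro!: contraction_mult)
  have H: "(?X1 ** transpose ?X2) *v v l = (if l \<in> D then 1 *\<^sub>R (T *v v l) else 0)" for l
  proof -
    have e: "(?X1 ** transpose ?X2) *v v l = ?V1 *v (P *v (transpose ?V2 *v v l))"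
      by (simp add: M(3)[symmetric] matrix_transpose_mul matrix_vector_mul_assoc matrix_mul_assoc)
    show ?thesis
    proof (cases "l \<in> D")
      case True
      then obtain i where i: "v l = w2 i" "i < ?d" by (auto simp: D_def)
      obtain j where j: "idx j = i" using idx_ex i by blast
      have "transpose ?V2 *v v l = axis j 1" using transpose_cols_onf[OF wi(2), of j] i j by simp
      then show ?thesis
        unfolding e using True svd_apply(1)[OF svd, of i] i card j
        by (simp add: P diag_axis matrix_vector_mult_scaleR cols_axis)
    next
      case False
      have "w2 (idx j) \<bullet> v l = 0" for j
        using vw[of l "idx j"] idx_img[of j] card False by (auto simp: D_def inner_commute)
      then have "transpose ?V2 *v v l = 0" by (simp add: transpose_cols_vec vec_eq_iff)
      then show ?thesis unfolding e using False by simp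
    qed
  qed
  let ?\<theta> = "cca_estimate n x1 x2 U1 U2 M1 M2 m0"
  have W: "S11 ** U1 ** M1 = R1 ** ?X1" "S22 ** U2 ** M2 = R2 ** ?X2"
    by (rule mat_eqI, simp add: U' matrix_vector_mul_assoc[symmetric] S11_vec S22_vec R_cancel)+
  have t: "\<And>l. l \<in> D \<Longrightarrow> 1\<^sup>2 * \<kappa> l < 1" using \<kappa>1 by simp
  note lt = likelihood_truncation[OF v H zero_le_one order_refl t X, of ?\<theta>]
  have valid: "valid_params ?\<theta>"
    by (rule lt(1)) (simp_all add: cca_estimate_def Let_def W marginal_mean_def)
  have "lik_of (base + (\<Sum>l\<in>D. ln (1 - 1\<^sup>2 * \<kappa> l))) \<le> likelihood n x1 x2 ?\<theta>"
    by (rule lt(2)) (simp_all add: cca_estimate_def Let_def W marginal_mean_def)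
  then show ?thesis
    unfolding is_mle_def using valid likelihood_upper[OF _ v \<kappa>1 cD top] by (auto intro: order_trans)
qed

text \<open>Comparison with the trial models makes every lower bound on the deviance sharp, which
  fixes the marginal law and the truncation of \<open>T\<close>. The loadings are then expressed in
  singular vectors adapted to them.\<close>

lemma mle_is_estimate:
  fixes \<theta> :: "('a, 'b, 'k::finite) cca_params" and idx :: "'k::finite \<Rightarrow> nat"
  assumes card: "CARD('k) \<le> min CARD('a) CARD('b)" and idx: "bij_betw idx UNIV {..<CARD('k)}"
    and mle: "is_mle n x1 x2 \<theta>"
  shows "\<exists>U1 U2 P M1 M2. canonical_directions S11 S12 S22 idx U1 U2 P \<and>
    spectral_norm M1 \<le> 1 \<and> spectral_norm M2 \<le> 1 \<and> M1 ** transpose M2 = P \<and>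
    \<theta> = cca_estimate n x1 x2 U1 U2 M1 M2 (latent_mean \<theta>)"
proof -
  have valid: "valid_params \<theta>"
    and max: "\<And>\<theta>' :: ('a, 'b, 'k) cca_params. valid_params \<theta>' \<Longrightarrow> likelihood n x1 x2 \<theta>' \<le> likelihood n x1 x2 \<theta>"
    using mle by (auto simp: is_mle_def)
  have lik: "lik_of (base + (\<Sum>l\<in>D. ln (1 - t\<^sup>2 * \<kappa> l))) \<le> likelihood n x1 x2 \<theta>"
    if "onf UNIV (v :: 'b \<Rightarrow> real^'b)" "\<And>l. (transpose T ** T) *v v l = \<kappa> l *\<^sub>R v l" "card D \<le> CARD('k)"
      "0 \<le> t" "t \<le> 1" "\<forall>l\<in>D. t\<^sup>2 * \<kappa> l < 1" for v \<kappa> D t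
  proof -
    note D = that
    obtain \<theta>' :: "('a, 'b, 'k) cca_params" where "valid_params \<theta>'"
      "lik_of (base + (\<Sum>l\<in>D. ln (1 - t\<^sup>2 * \<kappa> l))) \<le> likelihood n x1 x2 \<theta>'"
      using likelihood_attains[OF D] by blast
    then show ?thesis using max order_trans by blast
  qed
  obtain v0 \<kappa>0 where v0: "onf UNIV (v0 :: 'b \<Rightarrow> real^'b)" "\<And>l. (transpose T ** T) *v v0 l = \<kappa>0 l *\<^sub>R v0 l"
    using sym_eigenbasis[OF gram_sym] by metis
  \<comment> \<open>The trial model with empty \<open>D\<close> has positive likelihood, so a
    maximizer cannot have a singular covariance.\<close>
  have pos: "0 < likelihood n x1 x2 \<theta>"
    using lik[OF v0, of "{}" 0] lik_of_pos[of base] by simp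
  obtain m1 m2 A E G where \<theta>: "marginal_mean \<theta> = stack m1 m2" "pd A" "pd E"
    "A = load1 \<theta> ** transpose (load1 \<theta>) + noise_cov1 \<theta>"
    "load1 \<theta> ** transpose (load2 \<theta>) = A ** G"
    "load2 \<theta> ** transpose (load2 \<theta>) + noise_cov2 \<theta> = E + transpose G ** A ** G"
    "likelihood n x1 x2 \<theta> = lik_of (deviance m1 m2 A G E)"
    using valid
  proof (cases rule: likelihood_cases)
    case 1
    then show ?thesis using pos by simp
  next
    case 2
    then show ?thesis by (rule that)
  qed
  let ?dev = "deviance m1 m2 A G E"
  have opt: "?dev \<le> base + (\<Sum>l\<in>D. ln (1 - t\<^sup>2 * \<kappa> l))"
    if "onf UNIV (v :: 'b \<Rightarrow> real^'b)" "\<And>l. (transpose T ** T) *v v l = \<kappa> l *\<^sub>R v l" "card D \<le> CARD('k)"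
      "0 \<le> t" "t \<le> 1" "\<forall>l\<in>D. t\<^sup>2 * \<kappa> l < 1" for v \<kappa> D t
    using lik[OF that] unfolding \<theta>(7) lik_of_le .
  \<comment> \<open>A canonical correlation equal to one makes the likelihood unbounded.\<close>
  have \<kappa>1: "\<kappa> l < 1" if v: "onf UNIV (v :: 'b \<Rightarrow> real^'b)" "\<And>l. (transpose T ** T) *v v l = \<kappa> l *\<^sub>R v l" for v \<kappa> l
  proof (rule ccontr)
    assume "\<not> \<kappa> l < 1"
    then have one: "\<kappa> l = 1" using eigen_bounds(2)[OF v, of l] by simp
    \<comment> \<open>\<open>c\<close> plays the part of \<open>1 - t\<^sup>2\<close>:
      \<open>ln c\<close> lies below \<open>?dev - base\<close>, and the minimum with 0 keeps
      \<open>c\<close> below one.\<close>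
    define c where "c = exp (min 0 (?dev - base) - 1)"
    have c: "0 < c" "c < 1" "ln c < ?dev - base" by (auto simp: c_def)
    have sq: "(sqrt (1 - c))\<^sup>2 = 1 - c" using c by simp
    have "?dev \<le> base + (\<Sum>l\<in>{l}. ln (1 - (sqrt (1 - c))\<^sup>2 * \<kappa> l))"
      by (rule opt[OF v]) (use c one in \<open>auto simp: sq\<close>)
    then show False using c one by (simp add: sq)
  qed
  note strict = strict_contraction[OF v0 \<kappa>1[OF v0]]
  let ?H = "R1 ** G ** inv_sqrt S22"
  have pdH: "pd (resid T ?H)" by (rule pd_resid) (rule strict)
  note dl = deviance_lower[OF \<theta>(2,3) pdH, of m1 m2]
  have kb: "CARD('k) \<le> CARD('b)" using card by simp
  have least: "\<forall>(v :: 'b \<Rightarrow> real^'b) \<kappa> D.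
      onf UNIV v \<and> (\<forall>l. (transpose T ** T) *v v l = \<kappa> l *\<^sub>R v l) \<and> card D \<le> CARD('k) \<longrightarrow>
      ln (det (resid T ?H)) \<le> (\<Sum>l\<in>D. ln (1 - \<kappa> l))"
  proof (intro allI impI, elim conjE)
    fix v :: "'b \<Rightarrow> real^'b" and \<kappa> and D :: "'b set"
    assume v: "onf UNIV v" "\<forall>l. (transpose T ** T) *v v l = \<kappa> l *\<^sub>R v l" and D: "card D \<le> CARD('k)"
    have "\<forall>l\<in>D. 1\<^sup>2 * \<kappa> l < 1" using \<kappa>1[OF v(1) v(2)[rule_format]] by simp
    from opt[OF v(1) v(2)[rule_format] D zero_le_one order_refl this]
    show "ln (det (resid T ?H)) \<le> (\<Sum>l\<in>D. ln (1 - \<kappa> l))" using dl(1) by simp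
  qed
  have strict': "\<forall>x. x \<noteq> 0 \<longrightarrow> (T *v x) \<bullet> (T *v x) < x \<bullet> x" using strict by blast
  obtain v \<kappa> D where v: "onf UNIV (v :: 'b \<Rightarrow> real^'b)" "\<And>l. (transpose T ** T) *v v l = \<kappa> l *\<^sub>R v l"
    and D: "card D \<le> CARD('k)" "\<forall>l\<in>D. 0 < \<kappa> l" "\<forall>i\<in>D. \<forall>j\<in>- D. \<kappa> j \<le> \<kappa> i"
      "card D < CARD('k) \<longrightarrow> (\<forall>l\<in>- D. \<kappa> l = 0)"
    and H: "\<And>l. ?H *v v l = (if l \<in> D then T *v v l else 0)"
    and ldet: "ln (det (resid T ?H)) = (\<Sum>l\<in>D. ln (1 - \<kappa> l))"
    apply (insert reduced_rank_optimum[OF whitened_regression[OF \<theta>(2,5)] kb strict' least])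
    apply (elim exE conjE)
    apply (rule that)
    apply (assumption | erule spec)+
    done
  have "?dev \<le> base + ln (det (resid T ?H))"
    using opt[OF v D(1) zero_le_one order_refl] \<kappa>1[OF v] ldet by simp
  from dl(2)[OF this] have opt_eq: "A = S11" "E = resid_cov G" "m1 = sample_mean n x1" "m2 = sample_mean n x2"
    by auto
  define Y1 where "Y1 = inv_sqrt S11 ** load1 \<theta>"
  define Y2 where "Y2 = inv_sqrt S22 ** load2 \<theta>"
  have W: "load1 \<theta> = R1 ** Y1" "load2 \<theta> = R2 ** Y2" by (simp_all add: Y1_def Y2_def matrix_mul_assoc R_inv)
  have HY: "?H = Y1 ** transpose Y2"
  proof (rule mat_eqI)
    fix x
    have "S11 *v (G *v y) = load1 \<theta> *v (transpose (load2 \<theta>) *v y)" for y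
      using \<theta>(5) opt_eq(1) by (simp add: matrix_vector_mul_assoc)
    then have "R1 *v (G *v y) = inv_sqrt S11 *v (load1 \<theta> *v (transpose (load2 \<theta>) *v y))" for y
      by (metis S11_vec R_cancel(2))
    then show "?H *v x = (Y1 ** transpose Y2) *v x"
      by (simp add: Y1_def Y2_def matrix_transpose_mul R_inv matrix_vector_mul_assoc[symmetric])
  qed
  have HD: "\<And>l. ?H *v v l = (if l \<in> D then 1 *\<^sub>R (T *v v l) else 0)" using H by simp
  note te = truncation_eigen[OF v HD]
  \<comment> \<open>Gibbs' inequality fixes only the conditional covariance \<open>E\<close>. The
    marginal one follows because a truncation with \<open>t = 1\<close> splits the identity into
    \<open>resid T ?H\<close> and \<open>transpose ?H ** ?H\<close>.\<close>
  have cov2: "load2 \<theta> ** transpose (load2 \<theta>) + noise_cov2 \<theta> = S22"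
  proof -
    have "resid T ?H + transpose ?H ** ?H = mat 1"
      by (rule onb_matrix_eqI[OF v(1)])
         (simp add: matrix_vector_mult_add_rdistrib te scaleR_left_distrib[symmetric])
    then have "(resid T ?H + transpose ?H ** ?H) *v x = x" for x by simp
    then have e: "resid T ?H *v x + transpose ?H *v (?H *v x) = x" for x
      by (simp only: matrix_vector_mult_add_rdistrib matrix_vector_mul_assoc)
    define H where "H = ?H"
    note e = e[folded H_def]
    have tH: "transpose G *v (R1 *v y) = R2 *v (transpose H *v y)" for y
      by (simp add: H_def matrix_transpose_mul R R_inv matrix_vector_mul_assoc[symmetric] R_cancel)
    have HR: "R1 *v (G *v x) = H *v (R2 *v x)" for x
      by (simp add: H_def matrix_vector_mul_assoc[symmetric] R_cancel)
    have "R2 ** resid T H ** R2 + transpose G ** S11 ** G = S22"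
    proof (rule mat_eqI)
      fix x
      have "(R2 ** resid T H ** R2 + transpose G ** S11 ** G) *v x =
        R2 *v (resid T H *v (R2 *v x) + transpose H *v (H *v (R2 *v x)))"
        by (simp only: matrix_vector_mult_add_rdistrib matrix_vector_mul_assoc[symmetric] S11_vec tH HR
           matrix_vector_right_distrib)
      then show "(R2 ** resid T H ** R2 + transpose G ** S11 ** G) *v x = S22 *v x"
        by (simp only: e S22_vec)
    qed
    then show ?thesis by (simp only: \<theta>(6) opt_eq(1,2) resid_cov_whiten H_def)
  qed
  \<comment> \<open>In whitened coordinates the noise covariance is \<open>I - Y Y^T\<close>; its
    semidefiniteness says that \<open>transpose Y\<close> is a contraction.\<close>
  have cY: "contraction Y1" "contraction Y2"
  proof -
    have cov1: "load1 \<theta> ** transpose (load1 \<theta>) + noise_cov1 \<theta> = S11" using \<theta>(4) opt_eq(1) by simp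
    have N: "psd (noise_cov1 \<theta>)" "psd (noise_cov2 \<theta>)" using valid by (auto simp: valid_params_def)
    have "(transpose Y1 *v y) \<bullet> (transpose Y1 *v y) \<le> y \<bullet> y" for y
    proof -
      let ?z = "inv_sqrt S11 *v y"
      have "?z \<bullet> (S11 *v ?z) = (transpose Y1 *v y) \<bullet> (transpose Y1 *v y) + ?z \<bullet> (noise_cov1 \<theta> *v ?z)"
      proof -
        have "(load1 \<theta> ** transpose (load1 \<theta>) + noise_cov1 \<theta>) *v ?z =
            load1 \<theta> *v (transpose (load1 \<theta>) *v ?z) + noise_cov1 \<theta> *v ?z"
          by (simp only: matrix_vector_mult_add_rdistrib matrix_vector_mul_assoc[symmetric])
        then have "S11 *v ?z = load1 \<theta> *v (transpose (load1 \<theta>) *v ?z) + noise_cov1 \<theta> *v ?z"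
          by (simp only: cov1)
        moreover have "transpose (load1 \<theta>) *v ?z = transpose Y1 *v y"
          by (simp add: W(1) matrix_transpose_mul R R_cancel matrix_vector_mul_assoc[symmetric])
        moreover have "?z \<bullet> (load1 \<theta> *v u) = (transpose (load1 \<theta>) *v ?z) \<bullet> u" for u
          by (rule inner_matrix_vector)
        ultimately show ?thesis by (simp only: inner_add_right)
      qed
      moreover have "?z \<bullet> (S11 *v ?z) = y \<bullet> y" by (simp add: S11_vec R_cancel inner_matrix_vector[of _ R1] R)
      moreover have "0 \<le> ?z \<bullet> (noise_cov1 \<theta> *v ?z)" using N by (simp add: psd_def)
      ultimately show ?thesis by simp
    qed
    then have "contraction (transpose Y1)" by (simp add: contraction_def)
    then show "contraction Y1" by (simp only: contraction_transpose_iff)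
    have "(transpose Y2 *v y) \<bullet> (transpose Y2 *v y) \<le> y \<bullet> y" for y
    proof -
      let ?z = "inv_sqrt S22 *v y"
      have "?z \<bullet> (S22 *v ?z) = (transpose Y2 *v y) \<bullet> (transpose Y2 *v y) + ?z \<bullet> (noise_cov2 \<theta> *v ?z)"
      proof -
        have "(load2 \<theta> ** transpose (load2 \<theta>) + noise_cov2 \<theta>) *v ?z =
            load2 \<theta> *v (transpose (load2 \<theta>) *v ?z) + noise_cov2 \<theta> *v ?z"
          by (simp only: matrix_vector_mult_add_rdistrib matrix_vector_mul_assoc[symmetric])
        then have "S22 *v ?z = load2 \<theta> *v (transpose (load2 \<theta>) *v ?z) + noise_cov2 \<theta> *v ?z"
          by (simp only: cov2)
        moreover have "transpose (load2 \<theta>) *v ?z = transpose Y2 *v y"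
          by (simp add: W(2) matrix_transpose_mul R R_cancel matrix_vector_mul_assoc[symmetric])
        moreover have "?z \<bullet> (load2 \<theta> *v u) = (transpose (load2 \<theta>) *v ?z) \<bullet> u" for u
          by (rule inner_matrix_vector)
        ultimately show ?thesis by (simp only: inner_add_right)
      qed
      moreover have "?z \<bullet> (S22 *v ?z) = y \<bullet> y" by (simp add: S22_vec R_cancel inner_matrix_vector[of _ R2] R)
      moreover have "0 \<le> ?z \<bullet> (noise_cov2 \<theta> *v ?z)" using N by (simp add: psd_def)
      ultimately show ?thesis by simp
    qed
    then have "contraction (transpose Y2)" by (simp add: contraction_def)
    then show "contraction Y2" by (simp only: contraction_transpose_iff)
  qed
  have dimY: "subspace (range ((*v) Y))" "dim (range ((*v) Y)) \<le> CARD('k)" for Y :: "real^'k^'m"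
    using dim_image_le[OF matrix_vector_mul_linear[of Y], of UNIV] by (simp_all add: linear_subspace_image)
  have X1: "\<forall>l\<in>D. T *v v l \<in> range ((*v) Y1)"
  proof
    fix l assume "l \<in> D"
    then have "T *v v l = Y1 *v (transpose Y2 *v v l)"
      using H[of l] by (simp only: HY matrix_vector_mul_assoc if_True)
    then show "T *v v l \<in> range ((*v) Y1)" by simp
  qed
  have X2: "\<forall>l\<in>D. v l \<in> range ((*v) Y2)"
  proof
    fix l assume that: "l \<in> D"
    \<comment> \<open>The left side is \<open>transpose ?H ** ?H\<close> applied to
      \<open>v l\<close>; dividing by the positive \<open>\<kappa> l\<close> exhibits a preimage
      under \<open>Y2\<close>.\<close>
    have "Y2 *v (transpose Y1 *v (?H *v v l)) = \<kappa> l *\<^sub>R v l"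
      using te(1)[of l] that by (simp add: HY matrix_transpose_mul matrix_vector_mul_assoc[symmetric] transpose_transpose)
    then have "Y2 *v ((1 / \<kappa> l) *\<^sub>R (transpose Y1 *v (?H *v v l))) = v l"
      using D(2) that by (auto simp: matrix_vector_mult_scaleR)
    then show "v l \<in> range ((*v) Y2)" by (metis rangeI)
  qed
  obtain s w1 w2 where svd: "is_svd T s w1 w2"
    and cover: "range ((*v) Y1) \<subseteq> span (w1 ` {..<CARD('k)})" "range ((*v) Y2) \<subseteq> span (w2 ` {..<CARD('k)})"
    and lead: "\<forall>i<CARD('k). w2 i \<in> v ` D \<or> s i = 0 \<and> (\<forall>l\<in>D. w2 i \<bullet> v l = 0)"
    by (rule svd_covering[OF v card D dimY X1 dimY X2], rule that)
  let ?r = "min CARD('a) CARD('b)"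
  have w: "onf {..<?r} w1" "onf {..<?r} w2"
    using svd by (auto simp: is_svd_def Let_def onf_def)
  have idx_img: "idx j < CARD('k)" for j using idx by (auto simp: bij_betw_def)
  have wi: "onf UNIV (\<lambda>j. w1 (idx j))" "onf UNIV (\<lambda>j. w2 (idx j))"
  proof -
    have ii: "inj idx" "range idx \<subseteq> {..<?r}" using idx card by (auto simp: bij_betw_def)
    show "onf UNIV (\<lambda>j. w1 (idx j))" "onf UNIV (\<lambda>j. w2 (idx j))"
      by (rule onf_reindex[OF w(1) ii], rule onf_reindex[OF w(2) ii])
  qed
  have rng: "range (\<lambda>j. w1 (idx j)) = w1 ` {..<CARD('k)}" "range (\<lambda>j. w2 (idx j)) = w2 ` {..<CARD('k)}"
    using idx by (auto simp: bij_betw_def image_image[symmetric])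
  define V1 where "V1 = cols (\<lambda>j. w1 (idx j))"
  define V2 where "V2 = cols (\<lambda>j. w2 (idx j))"
  \<comment> \<open>Coordinates of the whitened loadings in the leading singular vectors; nothing is
    lost, as these vectors span a space containing the range of \<open>Y1\<close>, and likewise for
    \<open>Y2\<close>.\<close>
  define M1 where "M1 = transpose V1 ** Y1"
  define M2 where "M2 = transpose V2 ** Y2"
  have VM: "V1 ** M1 = Y1" "V2 ** M2 = Y2"
    unfolding M1_def M2_def V1_def V2_def
    using cover
    by (intro mat_eqI; simp add: matrix_vector_mul_assoc[symmetric] image_subset_iff cols_transpose_cols[OF wi(1)]
        cols_transpose_cols[OF wi(2)] rng)+
  have M: "contraction M1" "contraction M2"
    unfolding M1_def M2_def V1_def V2_def
    using cY contraction_cols[OF wi(1)] contraction_cols[OF wi(2)]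
    by (auto intro!: contraction_mult contraction_transpose)
  have P: "M1 ** transpose M2 = diag (\<lambda>j. s (idx j))"
  proof (rule onb_matrix_eqI[OF onf_axis])
    fix k :: 'k
    have i: "idx k < ?r" using idx_img[of k] card by simp
    have "(M1 ** transpose M2) *v axis k 1 = transpose V1 *v (?H *v (V2 *v axis k 1))"
      by (simp add: M1_def M2_def HY matrix_transpose_mul transpose_transpose matrix_vector_mul_assoc matrix_mul_assoc)
    also have "V2 *v axis k 1 = w2 (idx k)" by (simp add: V2_def cols_axis)
    \<comment> \<open>A leading right vector either belongs to \<open>D\<close>, where
      \<open>?H\<close> agrees with \<open>T\<close>, or has singular value zero and is orthogonal
      to everything \<open>?H\<close> sees.\<close>
    also have "?H *v w2 (idx k) = s (idx k) *\<^sub>R w1 (idx k)"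
    proof (cases "w2 (idx k) \<in> v ` D")
      case True
      then have "?H *v w2 (idx k) = T *v w2 (idx k)" using H by auto
      then show ?thesis using svd_apply(1)[OF svd i] by simp
    next
      case False
      then have z: "s (idx k) = 0" "\<And>l. l \<in> D \<Longrightarrow> w2 (idx k) \<bullet> v l = 0" using lead idx_img[of k] by auto
      have "?H *v w2 (idx k) = (\<Sum>l\<in>UNIV. (w2 (idx k) \<bullet> v l) *\<^sub>R (?H *v v l))"
        by (subst onb_expand[OF v(1), of "w2 (idx k)"]) (simp only: matrix_vec_sum matrix_vector_mult_scaleR)
      also have "\<dots> = 0" by (rule sum.neutral) (use z H in auto)
      finally show ?thesis using z by simp
    qed
    finally show "(M1 ** transpose M2) *v axis k 1 = diag (\<lambda>j. s (idx j)) *v axis k 1"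
      using transpose_cols_onf[OF wi(1), of k] by (simp add: diag_axis matrix_vector_mult_scaleR V1_def)
  qed
  let ?U1 = "inv_sqrt S11 ** V1" and ?U2 = "inv_sqrt S22 ** V2"
  have can: "canonical_directions S11 S12 S22 idx ?U1 ?U2 (diag (\<lambda>j. s (idx j)))"
    unfolding canonical_directions_def
    using svd by (intro exI[of _ s] exI[of _ w1] exI[of _ w2]) (simp add: T_def V1_def V2_def column_mult_cols)
  have L: "S11 ** ?U1 ** M1 = load1 \<theta>" "S22 ** ?U2 ** M2 = load2 \<theta>"
  proof -
    have "S11 ** ?U1 ** M1 = R1 ** (V1 ** M1)"
      by (rule mat_eqI) (simp add: matrix_vector_mul_assoc[symmetric] S11_vec R_cancel)
    then show "S11 ** ?U1 ** M1 = load1 \<theta>" by (simp add: VM W)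
    have "S22 ** ?U2 ** M2 = R2 ** (V2 ** M2)"
      by (rule mat_eqI) (simp add: matrix_vector_mul_assoc[symmetric] S22_vec R_cancel)
    then show "S22 ** ?U2 ** M2 = load2 \<theta>" by (simp add: VM W)
  qed
  have means: "noise_mean1 \<theta> = sample_mean n x1 - load1 \<theta> *v latent_mean \<theta>"
    "noise_mean2 \<theta> = sample_mean n x2 - load2 \<theta> *v latent_mean \<theta>"
  proof -
    have "load1 \<theta> *v latent_mean \<theta> + noise_mean1 \<theta> = sample_mean n x1"
      "load2 \<theta> *v latent_mean \<theta> + noise_mean2 \<theta> = sample_mean n x2"
      using \<theta>(1) opt_eq(3,4) by (auto simp: marginal_mean_def)
    then show "noise_mean1 \<theta> = sample_mean n x1 - load1 \<theta> *v latent_mean \<theta>"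
      "noise_mean2 \<theta> = sample_mean n x2 - load2 \<theta> *v latent_mean \<theta>"
      by (metis add_diff_cancel_left')+
  qed
  have covs: "noise_cov1 \<theta> = S11 - load1 \<theta> ** transpose (load1 \<theta>)"
    "noise_cov2 \<theta> = S22 - load2 \<theta> ** transpose (load2 \<theta>)"
    using \<theta>(4) opt_eq(1) cov2 by (metis add_diff_cancel_left')+
  have "\<theta> = cca_estimate n x1 x2 ?U1 ?U2 M1 M2 (latent_mean \<theta>)"
    by (rule cca_params.equality) (simp_all add: cca_estimate_def Let_def L means covs)
  then show ?thesis
    using can M P unfolding contraction_spectral_norm
    by (intro exI[of _ ?U1] exI[of _ ?U2] exI[of _ "diag (\<lambda>j. s (idx j))"] exI[of _ M1] exI[of _ M2] conjI)
qed

end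

text \<open>A shift of the latent mean is absorbed by the noise means, leaving the marginal law
  unchanged.\<close>

lemma mle_any_latent_mean:
  fixes \<theta> :: "('a::finite, 'b::finite, 'k::finite) cca_params"
  assumes "is_mle n x1 x2 \<theta>"
  shows "\<exists>\<theta>' :: ('a, 'b, 'k) cca_params. is_mle n x1 x2 \<theta>' \<and> latent_mean \<theta>' = m0"
proof -
  let ?\<theta> = "\<theta>\<lparr>latent_mean := m0,
    noise_mean1 := load1 \<theta> *v latent_mean \<theta> + noise_mean1 \<theta> - load1 \<theta> *v m0,
    noise_mean2 := load2 \<theta> *v latent_mean \<theta> + noise_mean2 \<theta> - load2 \<theta> *v m0\<rparr>"
  have "marginal_mean ?\<theta> = marginal_mean \<theta>" "marginal_cov ?\<theta> = marginal_cov \<theta>"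
    by (simp_all add: marginal_mean_def marginal_cov_def)
  then have "likelihood n x1 x2 ?\<theta> = likelihood n x1 x2 \<theta>" by (simp add: likelihood_def)
  moreover have "valid_params ?\<theta> = valid_params \<theta>" by (simp add: valid_params_def)
  ultimately have "is_mle n x1 x2 ?\<theta>" using assms by (simp add: is_mle_def)
  then show ?thesis by (intro exI[of _ ?\<theta>]) simp
qed

section \<open>Conditional independence\<close>

text \<open>Given \<open>\<phi>\<close>, the joint conditional probability is the product of the two
  kernels; it is verified as a conditional expectation on the sets generating \<open>F\<close>.
  Second countability identifies the Borel sets of the product with the product
  sigma-algebra.\<close>

lemma cond_indep_kernel:
  fixes Q :: "'x::second_countable_topology measure"
    and K1 :: "'x \<Rightarrow> 'y::second_countable_topology measure"
    and K2 :: "'x \<Rightarrow> 'z::second_countable_topology measure"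
  assumes Q: "prob_space Q" "sets Q = sets borel"
    and K: "K1 \<in> borel \<rightarrow>\<^sub>M prob_algebra borel" "K2 \<in> borel \<rightarrow>\<^sub>M prob_algebra borel"
  shows "cond_indep_given (Q \<bind> (\<lambda>\<phi>. distr (K1 \<phi> \<Otimes>\<^sub>M K2 \<phi>) borel (\<lambda>z. (\<phi>, z))))
    (\<lambda>(\<phi>, z1, z2). z1) (\<lambda>(\<phi>, z1, z2). z2) (\<lambda>(\<phi>, z1, z2). \<phi>)"
proof -
  interpret Q: prob_space Q by fact
  define \<kappa> where "\<kappa> \<phi> = distr (K1 \<phi> \<Otimes>\<^sub>M K2 \<phi>) borel (\<lambda>z. (\<phi>, z))" for \<phi>
  define M where "M = Q \<bind> \<kappa>"
  have spQ: "space Q = UNIV" using sets_eq_imp_space_eq[OF Q(2)] by simp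
  have K1: "prob_space (K1 \<phi>)" "sets (K1 \<phi>) = sets borel" and K2: "prob_space (K2 \<phi>)" "sets (K2 \<phi>) = sets borel" for \<phi>
    using measurable_space[OF K(1), of \<phi>] measurable_space[OF K(2), of \<phi>] by (auto simp: space_prob_algebra)
  have sets12: "sets (K1 \<phi> \<Otimes>\<^sub>M K2 \<phi>) = sets (borel :: ('y \<times> 'z) measure)" for \<phi>
    unfolding borel_prod[symmetric] by (rule sets_pair_measure_cong[OF K1(2) K2(2)])
  have meas_pair: "(\<lambda>z. (\<phi>, z)) \<in> K1 \<phi> \<Otimes>\<^sub>M K2 \<phi> \<rightarrow>\<^sub>M (borel :: ('x \<times> 'y \<times> 'z) measure)" for \<phi>
    unfolding measurable_cong_sets[OF sets12 refl] borel_prod[symmetric] by measurable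
  have \<kappa>meas: "\<kappa> \<in> borel \<rightarrow>\<^sub>M prob_algebra borel"
    unfolding \<kappa>_def
  proof (rule measurable_distr_prob_space2)
    show "(\<lambda>\<phi>. K1 \<phi> \<Otimes>\<^sub>M K2 \<phi>) \<in> borel \<rightarrow>\<^sub>M prob_algebra (borel \<Otimes>\<^sub>M borel)"
      by (rule measurable_pair_prob[OF K])
    show "(\<lambda>(\<phi>, z). (\<phi>, z)) \<in> borel \<Otimes>\<^sub>M (borel \<Otimes>\<^sub>M borel) \<rightarrow>\<^sub>M (borel :: ('x \<times> 'y \<times> 'z) measure)"
      unfolding borel_prod by simp
  qed
  have \<kappa>sub: "\<kappa> \<in> Q \<rightarrow>\<^sub>M subprob_algebra borel"
    using measurable_prob_algebraD[OF \<kappa>meas] unfolding measurable_cong_sets[OF Q(2) refl] .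
  have \<kappa>prob: "prob_space (\<kappa> \<phi>)" "sets (\<kappa> \<phi>) = sets borel" for \<phi>
    using measurable_space[OF \<kappa>meas, of \<phi>] by (auto simp: space_prob_algebra)
  interpret M: prob_space M
    unfolding M_def by (rule Q.prob_space_bind[OF _ \<kappa>sub]) (simp add: \<kappa>prob)
  have setsM: "sets M = sets borel"
    unfolding M_def by (rule sets_bind) (use \<kappa>prob spQ in auto)
  have spM: "space M = UNIV" using sets_eq_imp_space_eq[OF setsM] by simp
  let ?X = "\<lambda>(\<phi> :: 'x, z1 :: 'y, z2 :: 'z). z1" and ?Y = "\<lambda>(\<phi> :: 'x, z1 :: 'y, z2 :: 'z). z2"
    and ?Z = "\<lambda>(\<phi> :: 'x, z1 :: 'y, z2 :: 'z). \<phi>"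
  have XYZ: "?X \<in> M \<rightarrow>\<^sub>M borel" "?Y \<in> M \<rightarrow>\<^sub>M borel" "?Z \<in> M \<rightarrow>\<^sub>M borel"
    unfolding measurable_cong_sets[OF setsM refl] borel_prod[symmetric] by measurable
  define F where "F = vimage_algebra (space M) ?Z borel"
  have setsF: "sets F = {?Z -` C \<inter> space M | C. C \<in> sets borel}"
    unfolding F_def by (rule sets_vimage_algebra2) simp
  have "subalgebra M F"
    unfolding subalgebra_def setsF using XYZ(3) by (auto simp: F_def measurable_sets)
  then interpret finite_measure_subalgebra M F by unfold_locales
  have ZF: "?Z \<in> F \<rightarrow>\<^sub>M borel" unfolding F_def by (rule measurable_vimage_algebra1) simp
  define g1 where "g1 A \<phi> = measure (K1 \<phi>) A" for A \<phi>
  define g2 where "g2 B \<phi> = measure (K2 \<phi>) B" for B \<phi>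
  have g1: "g1 A \<in> borel_measurable borel" if "A \<in> sets borel" for A
    unfolding g1_def measure_def
    using measurable_compose[OF measurable_prob_algebraD[OF K(1)] measurable_emeasure_subprob_algebra[OF that]]
    by simp
  have g2: "g2 B \<in> borel_measurable borel" if "B \<in> sets borel" for B
    unfolding g2_def measure_def
    using measurable_compose[OF measurable_prob_algebraD[OF K(2)] measurable_emeasure_subprob_algebra[OF that]]
    by simp
  have gle: "0 \<le> g1 A \<phi>" "g1 A \<phi> \<le> 1" "0 \<le> g2 B \<phi>" "g2 B \<phi> \<le> 1" for A B \<phi>
    using prob_space.prob_le_1[OF K1(1)] prob_space.prob_le_1[OF K2(1)] by (auto simp: g1_def g2_def)
  have rect: "emeasure M (C \<times> A \<times> B) = (\<integral>\<^sup>+\<phi>. ennreal (indicator C \<phi> * (g1 A \<phi> * g2 B \<phi>)) \<partial>Q)"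
    if C: "C \<in> sets borel" and A: "A \<in> sets borel" and B: "B \<in> sets borel" for A B C
  proof -
    have CAB: "C \<times> A \<times> B \<in> sets borel"
      unfolding borel_prod[symmetric] using A B C by simp
    have "emeasure (\<kappa> \<phi>) (C \<times> A \<times> B) = ennreal (indicator C \<phi> * (g1 A \<phi> * g2 B \<phi>))" for \<phi>
    proof -
      interpret k1: prob_space "K1 \<phi>" by (rule K1)
      interpret k2: prob_space "K2 \<phi>" by (rule K2)
      have sp: "space (K1 \<phi> \<Otimes>\<^sub>M K2 \<phi>) = UNIV" using sets_eq_imp_space_eq[OF sets12] by simp
      have "emeasure (\<kappa> \<phi>) (C \<times> A \<times> B) = emeasure (K1 \<phi> \<Otimes>\<^sub>M K2 \<phi>) ((\<lambda>z. (\<phi>, z)) -` (C \<times> A \<times> B))"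
        unfolding \<kappa>_def using emeasure_distr[OF meas_pair CAB] by (simp add: sp)
      also have "(\<lambda>z. (\<phi>, z)) -` (C \<times> A \<times> B) = (if \<phi> \<in> C then A \<times> B else {})" by auto
      also have "emeasure (K1 \<phi> \<Otimes>\<^sub>M K2 \<phi>) (if \<phi> \<in> C then A \<times> B else {}) = indicator C \<phi> * (emeasure (K1 \<phi>) A * emeasure (K2 \<phi>) B)"
        using A B K1(2) K2(2) by (simp add: k2.emeasure_pair_measure_Times)
      also have "\<dots> = ennreal (indicator C \<phi> * (g1 A \<phi> * g2 B \<phi>))"
        by (simp add: k1.emeasure_eq_measure k2.emeasure_eq_measure g1_def g2_def ennreal_mult'' ennreal_indicator split: split_indicator)
      finally show ?thesis .
    qed
    then show ?thesis unfolding M_def using emeasure_bind[OF _ \<kappa>sub CAB] spQ by simp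
  qed
  \<comment> \<open>The first coordinate has law \<open>Q\<close> under \<open>M\<close>, since the
    kernels have total mass one.\<close>
  have marg: "(\<integral>\<^sup>+w. h (?Z w) \<partial>M) = (\<integral>\<^sup>+\<phi>. h \<phi> \<partial>Q)" if h: "h \<in> borel_measurable borel" for h :: "'x \<Rightarrow> ennreal"
  proof -
    have hZ: "(\<lambda>w. h (?Z w)) \<in> borel_measurable borel"
      using measurable_compose[OF XYZ(3) h] unfolding measurable_cong_sets[OF setsM refl] .
    have "(\<integral>\<^sup>+w. h (?Z w) \<partial>\<kappa> \<phi>) = h \<phi>" for \<phi>
    proof -
      interpret k1: prob_space "K1 \<phi>" by (rule K1)
      interpret k2: prob_space "K2 \<phi>" by (rule K2)
      interpret k12: pair_prob_space "K1 \<phi>" "K2 \<phi>" ..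
      show ?thesis unfolding \<kappa>_def
        by (subst nn_integral_distr[OF meas_pair]) (simp_all add: hZ k12.emeasure_space_1)
    qed
    then show ?thesis unfolding M_def nn_integral_bind[OF hZ \<kappa>sub] by simp
  qed
  have key: "AE w in M. real_cond_exp M F (\<lambda>w. indicator A (?X w) * indicator B (?Y w)) w = g1 A (?Z w) * g2 B (?Z w)"
    if A: "A \<in> sets borel" and B: "B \<in> sets borel" for A B
  proof (rule real_cond_exp_charact)
    have gg: "(\<lambda>\<phi>. g1 A \<phi> * g2 B \<phi>) \<in> borel_measurable borel" using g1[OF A] g2[OF B] by simp
    show gF: "(\<lambda>w. g1 A (?Z w) * g2 B (?Z w)) \<in> borel_measurable F"
      using measurable_compose[OF ZF gg] .
    have gM: "(\<lambda>w. g1 A (?Z w) * g2 B (?Z w)) \<in> borel_measurable M"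
      using measurable_compose[OF XYZ(3) gg] .
    have ABM: "(\<lambda>w. indicator A (?X w) * indicator B (?Y w) :: real) \<in> borel_measurable M"
      by (rule borel_measurable_times[OF measurable_compose[OF XYZ(1) borel_measurable_indicator[OF A]]
        measurable_compose[OF XYZ(2) borel_measurable_indicator[OF B]]])
    show "integrable M (\<lambda>w. indicator A (?X w) * indicator B (?Y w) :: real)"
      by (rule M.integrable_const_bound[where B = 1, OF _ ABM]) (auto split: split_indicator)
    show "integrable M (\<lambda>w. g1 A (?Z w) * g2 B (?Z w))"
      by (rule M.integrable_const_bound[where B = 1, OF _ gM])
         (auto simp: abs_mult gle intro!: mult_le_one)
    fix S assume "S \<in> sets F"
    then obtain C where C: "C \<in> sets borel" "S = ?Z -` C" unfolding setsF spM by auto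
    have CAB: "C \<times> A \<times> B \<in> sets M"
      unfolding setsM borel_prod[symmetric] using A B C by simp
    have hm: "(\<lambda>\<phi>. ennreal (indicator C \<phi> * (g1 A \<phi> * g2 B \<phi>))) \<in> borel_measurable borel"
      using gg C(1) by measurable
    have "(LINT w:S|M. indicator A (?X w) * indicator B (?Y w)) = (LINT w|M. indicator (C \<times> A \<times> B) w :: real)"
      unfolding set_lebesgue_integral_def
      by (rule Bochner_Integration.integral_cong) (auto simp: C(2) split: split_indicator)
    also have "\<dots> = measure M (C \<times> A \<times> B)" using CAB by simp
    also have "\<dots> = enn2real (\<integral>\<^sup>+w. ennreal (indicator C (?Z w) * (g1 A (?Z w) * g2 B (?Z w))) \<partial>M)"
      unfolding measure_def rect[OF C(1) A B] marg[OF hm] ..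
    also have "\<dots> = (LINT w|M. indicator C (?Z w) * (g1 A (?Z w) * g2 B (?Z w)))"
      by (rule integral_eq_nn_integral[symmetric],
          rule borel_measurable_times[OF measurable_compose[OF XYZ(3) borel_measurable_indicator[OF C(1)]] gM])
         (simp add: gle)
    also have "\<dots> = (LINT w:S|M. g1 A (?Z w) * g2 B (?Z w))"
      unfolding set_lebesgue_integral_def
      by (rule Bochner_Integration.integral_cong) (auto simp: C(2) split: split_indicator)
    finally show "(LINT w:S|M. indicator A (?X w) * indicator B (?Y w)) = (LINT w:S|M. g1 A (?Z w) * g2 B (?Z w))" .
  qed
  have one: "g1 UNIV \<phi> = 1" "g2 UNIV \<phi> = 1" for \<phi>
    using prob_space.prob_space[OF K1(1)] prob_space.prob_space[OF K2(1)]
      sets_eq_imp_space_eq[OF K1(2)] sets_eq_imp_space_eq[OF K2(2)] by (simp_all add: g1_def g2_def)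
  \<comment> \<open>Taking \<open>UNIV\<close> for one of the two sets in \<open>key\<close> gives
    each factor on the right.\<close>
  have "AE w in M. real_cond_exp M F (\<lambda>w. indicator A (?X w) * indicator B (?Y w)) w =
      real_cond_exp M F (\<lambda>w. indicator A (?X w)) w * real_cond_exp M F (\<lambda>w. indicator B (?Y w)) w"
    if A: "A \<in> sets borel" and B: "B \<in> sets borel" for A B
    using key[OF A B] key[OF A, of UNIV] key[OF _ B, of UNIV] by (simp add: one) (elim AE_mp, simp)
  then show ?thesis
    unfolding cond_indep_given_def Let_def \<kappa>_def[symmetric] M_def[symmetric] F_def[symmetric] by blast
qed

section \<open>Gaussian laws as probability kernels\<close>

lemma nn_integral_std_gaussian:
  "(\<integral>\<^sup>+x. ennreal (\<Prod>i\<in>UNIV. std_normal_density (x $ i)) \<partial>(lborel :: (real^'n) measure)) = 1"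
proof -
  have B: "Basis = range (\<lambda>i. axis i 1 :: real^'n)" by (auto simp: Basis_vec_def)
  have inj: "inj (\<lambda>i. axis i 1 :: real^'n)" by (auto simp: inj_on_def axis_eq_axis)
  have "(\<integral>\<^sup>+x. ennreal (\<Prod>i\<in>UNIV. std_normal_density (x $ i)) \<partial>(lborel :: (real^'n) measure))
    = (\<integral>\<^sup>+x. (\<Prod>b\<in>Basis. ennreal (std_normal_density (x \<bullet> b))) \<partial>(lborel :: (real^'n) measure))"
    by (simp add: B prod.reindex[OF inj] inner_axis prod_ennreal)
  also have "\<dots> = (\<Prod>b\<in>(Basis :: (real^'n) set). (\<integral>\<^sup>+x. ennreal (std_normal_density x) \<partial>lborel))"
    by (rule nn_integral_lborel_prod) auto
  also have "(\<integral>\<^sup>+x. ennreal (std_normal_density x) \<partial>lborel) = 1"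
    using prob_space.emeasure_space_1[OF prob_space_normal_density[of 1 0]] by (simp add: emeasure_density)
  finally show ?thesis by simp
qed

lemma sets_std_gaussian: "sets (std_gaussian :: (real^'n) measure) = sets borel"
  by (simp add: std_gaussian_def)

lemma prob_space_std_gaussian: "prob_space (std_gaussian :: (real^'n) measure)"
  by (rule prob_spaceI)
     (simp add: std_gaussian_def emeasure_density nn_integral_std_gaussian)

lemma borel_measurable_affine: "(\<lambda>x. m + C *v x) \<in> borel_measurable (borel :: (real^'n) measure)"
  by (intro borel_measurable_continuous_onI continuous_intros linear_continuous_on matrix_vector_mul_bounded_linear)

text \<open>The covariance is fixed, so the kernel is the image of one fixed law under a map jointly
  continuous in \<open>\<phi>\<close> and the noise.\<close>

lemma gaussian_kernel:
  fixes W :: "real^'k^'n"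
  shows "(\<lambda>\<phi>. gaussian (W *v \<phi> + m) C) \<in> borel \<rightarrow>\<^sub>M prob_algebra borel"
  unfolding gaussian_def
proof (rule measurable_distr_prob_space2)
  show "(\<lambda>\<phi>. std_gaussian) \<in> borel \<rightarrow>\<^sub>M prob_algebra (borel :: (real^'n) measure)"
    by (rule measurable_const) (simp add: space_prob_algebra prob_space_std_gaussian sets_std_gaussian)
  show "(\<lambda>(\<phi>, x). W *v \<phi> + m + psd_sqrt C *v x) \<in> borel \<Otimes>\<^sub>M borel \<rightarrow>\<^sub>M (borel :: (real^'n) measure)"
    unfolding borel_prod case_prod_beta
    by (intro borel_measurable_continuous_onI continuous_intros
        continuous_on_compose2[OF linear_continuous_on[OF matrix_vector_mul_bounded_linear]]) auto
qed

lemma model_cond_indep: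
  "cond_indep_given (model_law \<theta>) (\<lambda>(\<phi>, z1, z2). z1) (\<lambda>(\<phi>, z1, z2). z2) (\<lambda>(\<phi>, z1, z2). \<phi>)"
  unfolding model_law_def
proof (rule cond_indep_kernel[OF _ _ gaussian_kernel gaussian_kernel])
  show "sets (gaussian (latent_mean \<theta>) (mat 1)) = sets borel" by (simp add: gaussian_def)
  show "prob_space (gaussian (latent_mean \<theta>) (mat 1))"
    unfolding gaussian_def
    by (intro prob_space.prob_space_distr prob_space_std_gaussian)
       (simp add: measurable_cong_sets[OF sets_std_gaussian refl] borel_measurable_affine)
qed

theorem theorem1:
  fixes n :: nat
    and x1 :: "nat \<Rightarrow> real^'a"
    and x2 :: "nat \<Rightarrow> real^'b"
    and idx :: "'k::finite \<Rightarrow> nat"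
  assumes "0 < n"
    and "CARD('k) \<le> min CARD('a) CARD('b)"
    and "bij_betw idx UNIV {..<CARD('k)}"
    and "invertible (sample_cov n x1)"
    and "invertible (sample_cov n x2)"
  shows
    "(\<forall>(U1 :: real^'k^'a) (U2 :: real^'k^'b) P M1 M2 m0.
        canonical_directions (sample_cov n x1) (sample_cross_cov n x1 x2) (sample_cov n x2)
          idx U1 U2 P \<and>
        spectral_norm M1 < 1 \<and> spectral_norm M2 < 1 \<and> M1 ** transpose M2 = P \<longrightarrow>
        is_mle n x1 x2 (cca_estimate n x1 x2 U1 U2 M1 M2 m0)) \<and>
     (\<forall>\<theta> :: ('a, 'b, 'k) cca_params. is_mle n x1 x2 \<theta> \<longrightarrow>
        (\<exists>U1 U2 P M1 M2.
          canonical_directions (sample_cov n x1) (sample_cross_cov n x1 x2) (sample_cov n x2)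
            idx U1 U2 P \<and>
          spectral_norm M1 \<le> 1 \<and> spectral_norm M2 \<le> 1 \<and> M1 ** transpose M2 = P \<and>
          \<theta> = cca_estimate n x1 x2 U1 U2 M1 M2 (latent_mean \<theta>))) \<and>
     (\<forall>\<theta> :: ('a, 'b, 'k) cca_params. valid_params \<theta> \<longrightarrow>
        cond_indep_given (model_law \<theta>) (\<lambda>(\<phi>, z1, z2). z1) (\<lambda>(\<phi>, z1, z2). z2) (\<lambda>(\<phi>, z1, z2). \<phi>)) \<and>
     (\<forall>(\<theta> :: ('a, 'b, 'k) cca_params) m0. is_mle n x1 x2 \<theta> \<longrightarrow>
        (\<exists>\<theta>' :: ('a, 'b, 'k) cca_params. is_mle n x1 x2 \<theta>' \<and> latent_mean \<theta>' = m0))"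
proof -
  interpret cca_sample n x1 x2 using assms by unfold_locales
  show ?thesis
    using estimate_is_mle[OF assms(2,3)] mle_is_estimate[OF assms(2,3)] model_cond_indep mle_any_latent_mean
    by blast
qed

end
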